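(* Let $U$ be an admissible utility function, let $v\in A=\,]a,\infty[$, let $\gamma$ be a market price of risk process with associated density $\xi_{\bar T}$, and let $\hat X=I(\hat\lambda\,\xi_{\bar T})$, where $\hat\lambda\in B$ is the unique element of $B$ with $E_P[I(\hat\lambda\xi_{\bar T})\,\xi_{\bar T}]=v$. Then $\hat X$ is the unique solution of the problem of maximizing $E_P[U(X)]$ over all $X\in L^2(\Omega,\mathcal F_{\bar T},P)$ satisfying $E_P[\xi_{\bar T}X]=v$.
   Context: Probability setting: $\bar T>0$, $\mathbb T=[0,\bar T]$; $\mathbb I$ is a finite set or $\mathbb I=\mathbb N$; $(W^i)_{i\in\mathbb I}$ are independent standard Brownian motions on a complete filtered probability space $(\Omega,P,\mathcal F,(\mathcal F_t)_{t\in\mathbb T})$ whose filtration is generated by the $W^i$, with $\mathcal F=\mathcal F_{\bar T}$; $\ell^2=\ell^2(\mathbb I)$. Function spaces: for $s\ge 0$, $H^s([0,\infty[)$ is the space of restrictions to $[0,\infty[$ of functions of the Sobolev space $H^s(\mathbb R)$, with the quotient norm $\|f\|=\inf\{\|g\|_{H^s(\mathbb R)}: g=f \text{ a.e. on }[0,\infty[\}$; $E^s=H^s([0,\infty[)\oplus\mathbb R$ is the space of functions $f=g+a$ ($g\in H^s([0,\infty[)$, $a\in\mathbb R$ constant) with $\|f\|_{E^s}^2=\|g\|_{H^s}^2+a^2$. Fix $s>1/2$. Market: the drift $m_t$ and the volatilities $\sigma^i_t$, $i\in\mathbb I$, are progressively measurable $E^{s+1}$-valued processes; $\sigma_t:\ell^2\to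 E^{s}$ is the volatility operator $\sigma_t z=\sum_i z^i\sigma^i_t$, also viewed as a Hilbert–Schmidt operator from $\ell^2$ to $E^{s+1}$. It is assumed that $\sigma_t^i(0)=0$ for all $i,t$, and that for all $a\in[1,\infty[$, $E[(\int_0^{\bar T}\|\sigma_t\|^2_{\mathcal{HS}(\ell^2,E^{s+1})}dt)^a+\exp(a\int_0^{\bar T}\|\sigma_t\|^2_{\mathcal{HS}(\ell^2,E^{s})}dt)]<\infty$. A market price of risk process is a progressively measurable $\ell^2$-valued process $\gamma$ with $m_t=\sigma_t\gamma_t$ for all $t\in\mathbb T$ and $E[\exp(a\int_0^{\bar T}\|\gamma_t\|_{\ell^2}^2dt)]<\infty$ for all $a\ge0$; it is assumed that such a $\gamma$ exists. Its density process is $$\xi_t=\exp\Big(-\tfrac12\int_0^t\|\gamma_s\|^2_{\ell^2}ds-\sum_{i\in\mathbb I}\int_0^t\gamma^i_s\,dW^i_s\Big).$$ Admissible utility function: $U:\mathbb R\to\{-\infty\}\cup\mathbb R$ is admissible if (1) $U$ is concave and upper semicontinuous; (2) there is $a\in\{-\infty\}\cup\,]-\infty,0]$ with $U(x)=-\infty$ for $x<a$ and $U(x)>-\infty$ for $x>a$; (3) $U$ is twice differentiable on $A=\,]a,\infty[$, and we set $B=U'(A)$; (4) $\sup B=+\infty$, and $\inf B=0$ or $\inf B=-\infty$; (5) $U':A\to B$ is one-to-one and there are positive constants $r,c_1,c_2,c_3$ such that its inverse $I=[U']^{-1}$ satisfies $|I(y)|+|yI'(y)|\le c_1+c_2|y|^r+c_3|y|^{-r}$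 for $y\in B$. *)

theory Defs
  imports "HOL-Probability.Probability"
begin

section \<open>Function spaces\<close>

text \<open>
  Fourier--Plancherel transform with the unitary convention: \<open>h\<close> is the \<open>L\<^sup>2\<close>-limit of
  \<open>k \<mapsto> 1 / sqrt (2 pi) \<integral>\<^bsub>[-n,n]\<^esub> exp (- i k x) g(x) dx\<close>. It is determined almost everywhere by \<open>g\<close>.
\<close>

definition is_fourier :: "(real \<Rightarrow> real) \<Rightarrow> (real \<Rightarrow> complex) \<Rightarrow> bool" where
  "is_fourier g h \<longleftrightarrow> h \<in> borel_measurable borel \<and>
     (\<lambda>n::nat. \<integral>\<^sup>+ k. ennreal ((cmod (h k -
         (1 / sqrt (2 * pi)) *\<^sub>R
           (LINT x:{- real n..real n}|lborel. cis (- (k * x)) * complex_of_real (g x))))\<^sup>2) \<partial>lborel)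
       \<longlonglongrightarrow> 0"

definition fourier :: "(real \<Rightarrow> real) \<Rightarrow> real \<Rightarrow> complex" where
  "fourier g = (SOME h. is_fourier g h)"

definition sobolev :: "real \<Rightarrow> (real \<Rightarrow> real) set" where
  "sobolev s = {g \<in> borel_measurable borel. integrable lborel (\<lambda>x. (g x)\<^sup>2) \<and>
     integrable lborel (\<lambda>k. (1 + k\<^sup>2) powr s * (cmod (fourier g k))\<^sup>2)}"

definition sobolev_norm :: "real \<Rightarrow> (real \<Rightarrow> real) \<Rightarrow> real" where
  "sobolev_norm s g = sqrt (LINT k|lborel. (1 + k\<^sup>2) powr s * (cmod (fourier g k))\<^sup>2)"

text \<open>
  Elements of \<open>H\<^sup>s([0,\<infinity>[)\<close> are represented by functions on the whole line of which only the values
  on \<open>[0,\<infinity>[\<close> matter. The spaces are used for \<open>s > 1/2\<close> only, where every class has exactly one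
  continuous representative on \<open>[0,\<infinity>[\<close>; it is this representative that is chosen, so that point
  evaluation makes sense.
\<close>

definition halfline_extensions :: "real \<Rightarrow> (real \<Rightarrow> real) \<Rightarrow> (real \<Rightarrow> real) set" where
  "halfline_extensions s f = {g \<in> sobolev s. AE x in lborel. 0 \<le> x \<longrightarrow> g x = f x}"

definition sobolev_halfline :: "real \<Rightarrow> (real \<Rightarrow> real) set" where
  "sobolev_halfline s = {f. continuous_on {0..} f \<and> halfline_extensions s f \<noteq> {}}"

definition sobolev_halfline_norm :: "real \<Rightarrow> (real \<Rightarrow> real) \<Rightarrow> real" where
  "sobolev_halfline_norm s f = (INF g\<in>halfline_extensions s f. sobolev_norm s g)"

definition E_space :: "real \<Rightarrow> (real \<Rightarrow> real) set" where
  "E_space s = {f. \<exists>a. (\<lambda>x. f x - a) \<in> sobolev_halfline s}"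

text \<open>Nonzero constants are not in \<open>H\<^sup>s([0,\<infinity>[)\<close>, so the constant part is unique.\<close>

definition E_const :: "real \<Rightarrow> (real \<Rightarrow> real) \<Rightarrow> real" where
  "E_const s f = (THE a. (\<lambda>x. f x - a) \<in> sobolev_halfline s)"

definition E_norm :: "real \<Rightarrow> (real \<Rightarrow> real) \<Rightarrow> real" where
  "E_norm s f =
     sqrt ((sobolev_halfline_norm s (\<lambda>x. f x - E_const s f))\<^sup>2 + (E_const s f)\<^sup>2)"

text \<open>Elements of \<open>\<ell>\<^sup>2(I)\<close> are functions on \<open>nat\<close> of which only the values on \<open>I\<close> matter.\<close>

definition l2_space :: "nat set \<Rightarrow> (nat \<Rightarrow> real) set" where
  "l2_space I = {z. (\<lambda>i. (z i)\<^sup>2) summable_on I}"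

definition l2_norm :: "nat set \<Rightarrow> (nat \<Rightarrow> real) \<Rightarrow> real" where
  "l2_norm I z = sqrt (\<Sum>\<^sub>\<infinity>i\<in>I. (z i)\<^sup>2)"

text \<open>Borel \<open>\<sigma>\<close>-algebra of the space of functions \<open>S\<close> with norm \<open>N\<close>.\<close>

definition norm_borel :: "('b \<Rightarrow> real) set \<Rightarrow> (('b \<Rightarrow> real) \<Rightarrow> real) \<Rightarrow> ('b \<Rightarrow> real) measure" where
  "norm_borel S N = sigma S
     {U. U \<subseteq> S \<and> (\<forall>f\<in>U. \<exists>e>0. \<forall>g\<in>S. N (\<lambda>x. g x - f x) < e \<longrightarrow> g \<in> U)}"


section \<open>Brownian setting\<close>

text \<open>
  The filtration is augmented by the null sets. Increments of a Brownian motion on a filtered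
  space are independent of the past \<open>F s\<close>, not only of its own past.
\<close>

definition brownian_filtration ::
  "'a measure \<Rightarrow> real \<Rightarrow> nat set \<Rightarrow> (nat \<Rightarrow> real \<Rightarrow> 'a \<Rightarrow> real) \<Rightarrow> real \<Rightarrow> 'a measure" where
  "brownian_filtration M T I W t = sigma (space M)
     ({W i s -` B \<inter> space M | i s B. i \<in> I \<and> 0 \<le> s \<and> s \<le> t \<and> s \<le> T \<and> B \<in> sets borel}
      \<union> null_sets M)"

definition standard_brownian_motion ::
  "'a measure \<Rightarrow> real \<Rightarrow> (real \<Rightarrow> 'a measure) \<Rightarrow> (real \<Rightarrow> 'a \<Rightarrow> real) \<Rightarrow> bool" where
  "standard_brownian_motion M T F X \<longleftrightarrow>
     (AE \<omega> in M. X 0 \<omega> = 0) \<and>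
     (AE \<omega> in M. continuous_on {0..T} (\<lambda>t. X t \<omega>)) \<and>
     (\<forall>t\<in>{0..T}. X t \<in> borel_measurable (F t)) \<and>
     (\<forall>s t. 0 \<le> s \<and> s < t \<and> t \<le> T \<longrightarrow>
        distributed M lborel (\<lambda>\<omega>. X t \<omega> - X s \<omega>) (normal_density 0 (sqrt (t - s))) \<and>
        prob_space.indep_set M (sets (F s))
          (sets (vimage_algebra (space M) (\<lambda>\<omega>. X t \<omega> - X s \<omega>) borel)))"

definition brownian_setting ::
  "'a measure \<Rightarrow> real \<Rightarrow> nat set \<Rightarrow> (nat \<Rightarrow> real \<Rightarrow> 'a \<Rightarrow> real) \<Rightarrow> bool" where
  "brownian_setting M T I W \<longleftrightarrow>
     prob_space M \<and> complete_measure M \<and> 0 < T \<and> (finite I \<or> I = UNIV) \<and>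
     (\<forall>i\<in>I. standard_brownian_motion M T (brownian_filtration M T I W) (W i)) \<and>
     prob_space.indep_vars M (\<lambda>_. PiM {0..T} (\<lambda>_. borel)) (\<lambda>i \<omega>. \<lambda>t\<in>{0..T}. W i t \<omega>) I \<and>
     sets M = sets (brownian_filtration M T I W T)"

definition progressively_measurable ::
  "real \<Rightarrow> (real \<Rightarrow> 'a measure) \<Rightarrow> 'b measure \<Rightarrow> (real \<Rightarrow> 'a \<Rightarrow> 'b) \<Rightarrow> bool" where
  "progressively_measurable T F N X \<longleftrightarrow>
     (\<forall>t\<in>{0..T}. (\<lambda>(s, \<omega>). X s \<omega>) \<in> measurable (restrict_space borel {0..t} \<Otimes>\<^sub>M F t) N)"


section \<open>Stochastic integrals of square integrable integrands\<close>

text \<open>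
  An elementary integrand is given by times \<open>\<tau> 0 \<le> \<dots> \<le> \<tau> n\<close> and bounded
  \<open>F (\<tau> k)\<close>-measurable variables \<open>c k\<close>, its value on \<open>]\<tau> k, \<tau> (k + 1)]\<close>.
\<close>

definition elementary ::
  "'a measure \<Rightarrow> real \<Rightarrow> (real \<Rightarrow> 'a measure) \<Rightarrow> nat \<Rightarrow> (nat \<Rightarrow> real) \<Rightarrow> (nat \<Rightarrow> 'a \<Rightarrow> real) \<Rightarrow> bool" where
  "elementary M T F n \<tau> c \<longleftrightarrow>
     0 \<le> \<tau> 0 \<and> \<tau> n \<le> T \<and> (\<forall>k<n. \<tau> k \<le> \<tau> (Suc k)) \<and>
     (\<forall>k<n. c k \<in> borel_measurable (F (\<tau> k)) \<and> (\<exists>C. \<forall>\<omega>\<in>space M. \<bar>c k \<omega>\<bar> \<le> C))"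

definition elementary_process ::
  "nat \<Rightarrow> (nat \<Rightarrow> real) \<Rightarrow> (nat \<Rightarrow> 'a \<Rightarrow> real) \<Rightarrow> real \<Rightarrow> 'a \<Rightarrow> real" where
  "elementary_process n \<tau> c t \<omega> = (\<Sum>k<n. c k \<omega> * indicator {\<tau> k<..\<tau> (Suc k)} t)"

definition elementary_integral ::
  "(real \<Rightarrow> 'a \<Rightarrow> real) \<Rightarrow> nat \<Rightarrow> (nat \<Rightarrow> real) \<Rightarrow> (nat \<Rightarrow> 'a \<Rightarrow> real) \<Rightarrow> real \<Rightarrow> 'a \<Rightarrow> real" where
  "elementary_integral X n \<tau> c t \<omega> =
     (\<Sum>k<n. c k \<omega> * (X (min (\<tau> (Suc k)) t) \<omega> - X (min (\<tau> k) t) \<omega>))"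

text \<open>
  \<open>J\<close> is a version of \<open>\<integral>\<^bsub>0\<^esub>\<^bsup>t\<^esup> h dX\<close>: the Ito integral as \<open>L\<^sup>2(P)\<close>-limit of the integrals of
  elementary integrands converging to \<open>h\<close> in \<open>L\<^sup>2(dt \<otimes> P)\<close>. It is determined almost surely.
\<close>

definition has_ito_integral ::
  "'a measure \<Rightarrow> real \<Rightarrow> (real \<Rightarrow> 'a measure) \<Rightarrow> (real \<Rightarrow> 'a \<Rightarrow> real) \<Rightarrow> (real \<Rightarrow> 'a \<Rightarrow> real) \<Rightarrow>
     real \<Rightarrow> ('a \<Rightarrow> real) \<Rightarrow> bool" where
  "has_ito_integral M T F X h t J \<longleftrightarrow> J \<in> borel_measurable M \<and>
     (\<exists>n \<tau> c. (\<forall>j::nat. elementary M T F (n j) (\<tau> j) (c j)) \<and>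
        (\<lambda>j. \<integral>\<^sup>+ \<omega>. (\<integral>\<^sup>+ r\<in>{0..t}.
             ennreal ((h r \<omega> - elementary_process (n j) (\<tau> j) (c j) r \<omega>)\<^sup>2) \<partial>lborel) \<partial>M)
          \<longlonglongrightarrow> 0 \<and>
        (\<lambda>j. \<integral>\<^sup>+ \<omega>. ennreal ((J \<omega> - elementary_integral X (n j) (\<tau> j) (c j) t \<omega>)\<^sup>2) \<partial>M)
          \<longlonglongrightarrow> 0)"

text \<open>
  \<open>J\<close> is a version of \<open>\<Sum>i\<in>I. \<integral>\<^bsub>0\<^esub>\<^bsup>t\<^esup> h\<^sup>i dW\<^sup>i\<close>, the sum being taken in \<open>L\<^sup>2(P)\<close>.
\<close>

definition has_ito_integral_sum ::
  "'a measure \<Rightarrow> real \<Rightarrow> (real \<Rightarrow> 'a measure) \<Rightarrow> nat set \<Rightarrow> (nat \<Rightarrow> real \<Rightarrow> 'a \<Rightarrow> real) \<Rightarrow>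
     (real \<Rightarrow> 'a \<Rightarrow> nat \<Rightarrow> real) \<Rightarrow> real \<Rightarrow> ('a \<Rightarrow> real) \<Rightarrow> bool" where
  "has_ito_integral_sum M T F I W h t J \<longleftrightarrow> J \<in> borel_measurable M \<and>
     (\<exists>K. (\<forall>i\<in>I. has_ito_integral M T F (W i) (\<lambda>r \<omega>. h r \<omega> i) t (K i)) \<and>
        ((\<lambda>A. \<integral>\<^sup>+ \<omega>. ennreal ((J \<omega> - (\<Sum>i\<in>A. K i \<omega>))\<^sup>2) \<partial>M) \<longlongrightarrow> 0)
          (finite_subsets_at_top I))"


section \<open>The market\<close>

text \<open>
  \<open>\<sigma> i t \<omega>\<close> is the \<open>i\<close>-th volatility, an element of \<open>E\<^sup>s\<^sup>+\<^sup>1\<close>. The volatility operator maps the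
  \<open>i\<close>-th unit vector of \<open>\<ell>\<^sup>2(I)\<close> to \<open>\<sigma> i t \<omega>\<close>, so its squared Hilbert--Schmidt norm is
  the sum of the squared norms of these elements.
\<close>

definition hilbert_schmidt :: "real \<Rightarrow> nat set \<Rightarrow> (nat \<Rightarrow> real \<Rightarrow> real) \<Rightarrow> bool" where
  "hilbert_schmidt s I v \<longleftrightarrow> (\<lambda>i. (E_norm s (v i))\<^sup>2) summable_on I"

definition hs_norm :: "real \<Rightarrow> nat set \<Rightarrow> (nat \<Rightarrow> real \<Rightarrow> real) \<Rightarrow> real" where
  "hs_norm s I v = sqrt (\<Sum>\<^sub>\<infinity>i\<in>I. (E_norm s (v i))\<^sup>2)"

text \<open>\<open>f = \<Sum>i\<in>I. z i \<cdot> v i\<close> with convergence in \<open>E\<^sup>s\<close>.\<close>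

definition has_operator_value ::
  "real \<Rightarrow> nat set \<Rightarrow> (nat \<Rightarrow> real \<Rightarrow> real) \<Rightarrow> (nat \<Rightarrow> real) \<Rightarrow> (real \<Rightarrow> real) \<Rightarrow> bool" where
  "has_operator_value s I v z f \<longleftrightarrow> f \<in> E_space s \<and>
     ((\<lambda>A. E_norm s (\<lambda>x. f x - (\<Sum>i\<in>A. z i * v i x))) \<longlongrightarrow> 0) (finite_subsets_at_top I)"

definition bond_market ::
  "'a measure \<Rightarrow> real \<Rightarrow> nat set \<Rightarrow> (nat \<Rightarrow> real \<Rightarrow> 'a \<Rightarrow> real) \<Rightarrow> real \<Rightarrow>
     (real \<Rightarrow> 'a \<Rightarrow> real \<Rightarrow> real) \<Rightarrow> (nat \<Rightarrow> real \<Rightarrow> 'a \<Rightarrow> real \<Rightarrow> real) \<Rightarrow> bool" where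
  "bond_market M T I W s m \<sigma> \<longleftrightarrow>
     progressively_measurable T (brownian_filtration M T I W)
       (norm_borel (E_space (s + 1)) (E_norm (s + 1))) m \<and>
     (\<forall>i\<in>I. progressively_measurable T (brownian_filtration M T I W)
       (norm_borel (E_space (s + 1)) (E_norm (s + 1))) (\<sigma> i)) \<and>
     (AE \<omega> in M. \<forall>t\<in>{0..T}. \<forall>i\<in>I. \<sigma> i t \<omega> 0 = 0) \<and>
     (AE \<omega> in M. \<forall>t\<in>{0..T}. hilbert_schmidt (s + 1) I (\<lambda>i. \<sigma> i t \<omega>)) \<and>
     (AE \<omega> in M. set_integrable lborel {0..T} (\<lambda>t. (hs_norm (s + 1) I (\<lambda>i. \<sigma> i t \<omega>))\<^sup>2)) \<and>
     (AE \<omega> in M. set_integrable lborel {0..T} (\<lambda>t. (hs_norm s I (\<lambda>i. \<sigma> i t \<omega>))\<^sup>2)) \<and>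
     (\<forall>a\<ge>1. integrable M (\<lambda>\<omega>.
        (LINT t:{0..T}|lborel. (hs_norm (s + 1) I (\<lambda>i. \<sigma> i t \<omega>))\<^sup>2) powr a +
        exp (a * (LINT t:{0..T}|lborel. (hs_norm s I (\<lambda>i. \<sigma> i t \<omega>))\<^sup>2))))"

definition market_price_of_risk ::
  "'a measure \<Rightarrow> real \<Rightarrow> nat set \<Rightarrow> (nat \<Rightarrow> real \<Rightarrow> 'a \<Rightarrow> real) \<Rightarrow> real \<Rightarrow>
     (real \<Rightarrow> 'a \<Rightarrow> real \<Rightarrow> real) \<Rightarrow> (nat \<Rightarrow> real \<Rightarrow> 'a \<Rightarrow> real \<Rightarrow> real) \<Rightarrow>
     (real \<Rightarrow> 'a \<Rightarrow> nat \<Rightarrow> real) \<Rightarrow> bool" where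
  "market_price_of_risk M T I W s m \<sigma> \<gamma> \<longleftrightarrow>
     progressively_measurable T (brownian_filtration M T I W)
       (norm_borel (l2_space I) (l2_norm I)) \<gamma> \<and>
     (AE \<omega> in M. \<forall>t\<in>{0..T}. has_operator_value s I (\<lambda>i. \<sigma> i t \<omega>) (\<gamma> t \<omega>) (m t \<omega>)) \<and>
     (AE \<omega> in M. set_integrable lborel {0..T} (\<lambda>t. (l2_norm I (\<gamma> t \<omega>))\<^sup>2)) \<and>
     (\<forall>a\<ge>0. integrable M (\<lambda>\<omega>. exp (a * (LINT t:{0..T}|lborel. (l2_norm I (\<gamma> t \<omega>))\<^sup>2))))"

definition density_process ::
  "'a measure \<Rightarrow> real \<Rightarrow> nat set \<Rightarrow> (nat \<Rightarrow> real \<Rightarrow> 'a \<Rightarrow> real) \<Rightarrow> (real \<Rightarrow> 'a \<Rightarrow> nat \<Rightarrow> real) \<Rightarrow>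
     (real \<Rightarrow> 'a \<Rightarrow> real) \<Rightarrow> bool" where
  "density_process M T I W \<gamma> \<xi> \<longleftrightarrow>
     (\<forall>t\<in>{0..T}. \<exists>J. has_ito_integral_sum M T (brownian_filtration M T I W) I W \<gamma> t J \<and>
        (\<forall>\<omega>\<in>space M.
           \<xi> t \<omega> = exp (- (1/2) * (LINT r:{0..t}|lborel. (l2_norm I (\<gamma> r \<omega>))\<^sup>2) - J \<omega>)))"


section \<open>Admissible utility functions\<close>

definition marginal_utility :: "(real \<Rightarrow> ereal) \<Rightarrow> real \<Rightarrow> real" where
  "marginal_utility U = deriv (\<lambda>x. real_of_ereal (U x))"

definition utility_domain :: "ereal \<Rightarrow> real set" where
  "utility_domain a = {x. a < ereal x}"

definition marginal_range :: "(real \<Rightarrow> ereal) \<Rightarrow> ereal \<Rightarrow> real set" where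
  "marginal_range U a = marginal_utility U ` utility_domain a"

definition inverse_marginal :: "(real \<Rightarrow> ereal) \<Rightarrow> ereal \<Rightarrow> real \<Rightarrow> real" where
  "inverse_marginal U a = the_inv_into (utility_domain a) (marginal_utility U)"

text \<open>
  The condition \<open>a \<le> 0\<close> covers \<open>a = -\<infinity>\<close>. The growth bound is imposed at \<open>y \<noteq> 0\<close> only:
  at \<open>y = 0\<close> its right-hand side is infinite, whereas \<open>0 powr (- r) = 0\<close>.
\<close>

definition admissible_utility :: "(real \<Rightarrow> ereal) \<Rightarrow> ereal \<Rightarrow> bool" where
  "admissible_utility U a \<longleftrightarrow>
     (\<forall>x. U x \<noteq> \<infinity>) \<and>
     (\<forall>x y. \<forall>u\<in>{0<..<1}. ereal u * U x + ereal (1 - u) * U y \<le> U (u * x + (1 - u) * y)) \<and>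
     (\<forall>x. Limsup (at x) U \<le> U x) \<and>
     a \<le> 0 \<and> (\<forall>x. ereal x < a \<longrightarrow> U x = -\<infinity>) \<and> (\<forall>x. a < ereal x \<longrightarrow> U x > -\<infinity>) \<and>
     (\<forall>x\<in>utility_domain a. (\<lambda>x. real_of_ereal (U x)) differentiable at x \<and>
        marginal_utility U differentiable at x) \<and>
     (SUP y\<in>marginal_range U a. ereal y) = \<infinity> \<and>
     (INF y\<in>marginal_range U a. ereal y) \<in> {0, -\<infinity>} \<and>
     inj_on (marginal_utility U) (utility_domain a) \<and>
     (\<forall>y\<in>marginal_range U a. inverse_marginal U a differentiable at y) \<and>
     (\<exists>r c1 c2 c3. r > 0 \<and> c1 > 0 \<and> c2 > 0 \<and> c3 > 0 \<and>
        (\<forall>y\<in>marginal_range U a. y \<noteq> 0 \<longrightarrow>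
           \<bar>inverse_marginal U a y\<bar> + \<bar>y * deriv (inverse_marginal U a) y\<bar>
             \<le> c1 + c2 * \<bar>y\<bar> powr r + c3 * \<bar>y\<bar> powr (- r)))"


section \<open>The optimization problem\<close>

text \<open>
  Expectation of a variable with values in \<open>[-\<infinity>,\<infinity>[\<close> whose positive part is integrable; this is
  the case for \<open>U(X)\<close> with \<open>U\<close> concave and \<open>X\<close> integrable.
\<close>

definition ereal_expectation :: "'a measure \<Rightarrow> ('a \<Rightarrow> ereal) \<Rightarrow> ereal" where
  "ereal_expectation M Z =
     enn2ereal (\<integral>\<^sup>+ \<omega>. e2ennreal (Z \<omega>) \<partial>M) - enn2ereal (\<integral>\<^sup>+ \<omega>. e2ennreal (- Z \<omega>) \<partial>M)"

definition budget_set :: "'a measure \<Rightarrow> ('a \<Rightarrow> real) \<Rightarrow> real \<Rightarrow> ('a \<Rightarrow> real) set" where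
  "budget_set M \<zeta> v = {X \<in> borel_measurable M. integrable M (\<lambda>\<omega>. (X \<omega>)\<^sup>2) \<and>
     has_bochner_integral M (\<lambda>\<omega>. \<zeta> \<omega> * X \<omega>) v}"

definition is_utility_maximizer ::
  "'a measure \<Rightarrow> (real \<Rightarrow> ereal) \<Rightarrow> ('a \<Rightarrow> real) \<Rightarrow> real \<Rightarrow> ('a \<Rightarrow> real) \<Rightarrow> bool" where
  "is_utility_maximizer M U \<zeta> v X \<longleftrightarrow> X \<in> budget_set M \<zeta> v \<and>
     (\<forall>Y\<in>budget_set M \<zeta> v.
        ereal_expectation M (\<lambda>\<omega>. U (Y \<omega>)) \<le> ereal_expectation M (\<lambda>\<omega>. U (X \<omega>)))"

end

theory Submission
  imports Defs "HOL-Real_Asymp.Real_Asymp"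
begin

text \<open>
  Write \<open>\<zeta> = \<xi> T\<close> for the terminal density, \<open>u\<close> for the marginal utility and \<open>inv u\<close> for its inverse. The
  market enters through three properties of \<open>\<zeta>\<close> only: it is positive, all its real powers are
  integrable, and its expectation is \<open>1\<close>. Given these, the theorem is concave duality. The candidate
  \<open>X = inv u (\<lambda> \<zeta>)\<close> satisfies \<open>u X = \<lambda> \<zeta>\<close>, so the tangent inequality reads
  \<open>U Y \<le> U X + \<lambda> \<zeta> (Y - X)\<close> for every payoff \<open>Y\<close>; the last term has expectation zero as soon as \<open>X\<close> and
  \<open>Y\<close> cost the same. If \<open>Y\<close> does as well as \<open>X\<close>, the inequality is an equality almost everywhere,
  and strict concavity forces \<open>Y = X\<close>. This is \<open>optimal_payoff\<close>, resting on
  \<open>utility_below_tangent\<close> and \<open>utility_eq_tangent_imp_eq\<close>.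

  The multiplier exists and is unique (\<open>ex1_multiplier\<close>) because the cost \<open>E[inv u (\<lambda> \<zeta>) \<zeta>]\<close> is a
  continuous and strictly decreasing function of \<open>\<lambda>\<close>; the growth bound on \<open>inv u\<close> and the moments of
  \<open>\<zeta>\<close> make it finite. Its infimum is at most \<open>x E \<zeta>\<close> for every \<open>x\<close> in the domain, and it is here
  that \<open>E \<zeta> = 1\<close> is indispensable: it puts the infimum below \<open>v\<close> however close \<open>v\<close> is to the left end
  point \<open>a\<close> of the domain.

  The probabilistic part therefore consists in a Novikov theorem for \<open>\<zeta> = exp (S - Q / 2)\<close>, where
  \<open>S\<close> is minus the stochastic integral of \<open>\<gamma>\<close> and \<open>Q\<close> is the integral of \<open>\<bar>\<gamma>\<bar>\<^sup>2\<close>. The increments of the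
  family of Brownian motions over an interval are jointly Gaussian and independent of the past, so
  for elementary integrands \<open>E exp (p S - p\<^sup>2 Q / 2) = 1\<close> for all real \<open>p\<close>
  (\<open>discrete_exponential_expectation\<close>). The inequality \<open>\<le> 1\<close> survives limits by Fatou's lemma
  and yields the moments of \<open>\<zeta>\<close> because \<open>Q\<close> has all exponential moments. The converse bound
  \<open>E \<zeta> \<ge> 1\<close> does not survive limits by itself, since mass can escape where \<open>Q\<close> is large. It is
  therefore replaced by a quantitative estimate, obtained by switching the integrand off once \<open>Q\<close>
  would exceed a level \<open>K\<close>; it involves only continuous functions of \<open>S\<close> and \<open>Q\<close> that are
  bounded in \<open>L\<^sup>2\<close>, whose expectations do converge. The two properties together are called an \<open>exponential_pair\<close>. They hold for
  elementary integrands (\<open>discrete_exponential_pair\<close>), pass to almost sure limits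
  (\<open>exponential_pair_limit\<close>), hence to the stochastic integral in question, and imply
  \<open>E \<zeta> = 1\<close> on letting \<open>K\<close> tend to infinity (\<open>exponential_pair_expectation\<close>).
\<close>

section \<open>Concavity and the inverse marginal utility\<close>

context
  fixes U :: "real \<Rightarrow> ereal" and a :: ereal
  assumes adm: "admissible_utility U a"
begin

lemma admissible_utilityD:
  shows "U x \<noteq> \<infinity>"
    and "0 < w \<Longrightarrow> w < 1 \<Longrightarrow> ereal w * U x + ereal (1 - w) * U y \<le> U (w * x + (1 - w) * y)"
    and "ereal x < a \<Longrightarrow> U x = -\<infinity>"
    and "x \<in> utility_domain a \<Longrightarrow> U x \<noteq> -\<infinity>"
    and "x \<in> utility_domain a \<Longrightarrow> (\<lambda>x. real_of_ereal (U x)) differentiable at x"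
    and "x \<in> utility_domain a \<Longrightarrow> marginal_utility U differentiable at x"
    and "(SUP y\<in>marginal_range U a. ereal y) = \<infinity>"
    and "(INF y\<in>marginal_range U a. ereal y) \<in> {0, -\<infinity>}"
    and "inj_on (marginal_utility U) (utility_domain a)"
    and "z \<in> marginal_range U a \<Longrightarrow> inverse_marginal U a differentiable at z"
    and "\<exists>r c1 c2 c3. \<forall>y\<in>marginal_range U a. y \<noteq> 0 \<longrightarrow>
           \<bar>inverse_marginal U a y\<bar> + \<bar>y * deriv (inverse_marginal U a) y\<bar>
             \<le> c1 + c2 * \<bar>y\<bar> powr r + c3 * \<bar>y\<bar> powr (- r)"
proof -
  note h = adm[unfolded admissible_utility_def]
  note h1 = h[THEN conjunct1] and h2 = h[THEN conjunct2]
  note k1 = h2[THEN conjunct1] and k2 = h2[THEN conjunct2, THEN conjunct2, THEN conjunct2]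
  note l1 = k2[THEN conjunct1] and l2 = k2[THEN conjunct2]
  note m1 = l2[THEN conjunct1] and m2 = l2[THEN conjunct2]
  note n1 = m2[THEN conjunct1] and n2 = m2[THEN conjunct2]
  note o1 = n2[THEN conjunct1] and o2 = n2[THEN conjunct2]
  note p1 = o2[THEN conjunct1] and p2 = o2[THEN conjunct2]
  note q1 = p2[THEN conjunct1] and q2 = p2[THEN conjunct2]
  show "U x \<noteq> \<infinity>" using h1 ..
  show "0 < w \<Longrightarrow> w < 1 \<Longrightarrow> ereal w * U x + ereal (1 - w) * U y \<le> U (w * x + (1 - w) * y)"
    using k1 by simp
  show "ereal x < a \<Longrightarrow> U x = -\<infinity>" using l1 by blast
  show "x \<in> utility_domain a \<Longrightarrow> U x \<noteq> -\<infinity>" using m1 by (auto simp: utility_domain_def)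
  show "x \<in> utility_domain a \<Longrightarrow> (\<lambda>x. real_of_ereal (U x)) differentiable at x"
    "x \<in> utility_domain a \<Longrightarrow> marginal_utility U differentiable at x" using n1 by blast+
  show "(SUP y\<in>marginal_range U a. ereal y) = \<infinity>" using o1 .
  show "(INF y\<in>marginal_range U a. ereal y) \<in> {0, -\<infinity>}" using p1 .
  show "inj_on (marginal_utility U) (utility_domain a)" using q1 .
  show "z \<in> marginal_range U a \<Longrightarrow> inverse_marginal U a differentiable at z"
    using q2[THEN conjunct1] by blast
  show "\<exists>r c1 c2 c3. \<forall>y\<in>marginal_range U a. y \<noteq> 0 \<longrightarrow>
           \<bar>inverse_marginal U a y\<bar> + \<bar>y * deriv (inverse_marginal U a) y\<bar>
             \<le> c1 + c2 * \<bar>y\<bar> powr r + c3 * \<bar>y\<bar> powr (- r)"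
    using q2[THEN conjunct2] by blast
qed

lemma utility_eq_ereal:
  assumes "U x \<noteq> -\<infinity>"
  shows "U x = ereal (real_of_ereal (U x))"
  using admissible_utilityD(1)[of x] assms by (cases "U x") auto

lemma utility_finite_on_domain: "x \<in> utility_domain a \<Longrightarrow> U x = ereal (real_of_ereal (U x))"
  by (intro utility_eq_ereal admissible_utilityD(4))

lemma has_marginal_utility:
  "x \<in> utility_domain a \<Longrightarrow>
    ((\<lambda>x. real_of_ereal (U x)) has_real_derivative marginal_utility U x) (at x)"
  using admissible_utilityD(5)[of x] unfolding marginal_utility_def
  by (simp add: DERIV_deriv_iff_real_differentiable)

lemma open_utility_domain: "open (utility_domain a)"
proof -
  have "utility_domain a = ereal -` {a<..}"
    by (auto simp: utility_domain_def)
  then show ?thesis by (simp add: open_ereal_vimage)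
qed

lemma utility_domain_upward: "x \<in> utility_domain a \<Longrightarrow> x \<le> y \<Longrightarrow> y \<in> utility_domain a"
  unfolding utility_domain_def by (auto intro: less_le_trans)

lemma connected_utility_domain: "connected (utility_domain a)"
  unfolding connected_iff_interval using utility_domain_upward by blast

text \<open>
  A point at which the utility is finite lies in the closure of the domain; the half-open segment from
  it to an interior point stays in the domain.
\<close>

lemma utility_domain_segment:
  assumes "x \<in> utility_domain a" "U y \<noteq> -\<infinity>" "0 \<le> w" "w < 1"
  shows "w * y + (1 - w) * x \<in> utility_domain a"
proof (cases a)
  case (real r)
  have "\<not> ereal y < a" using assms(2) admissible_utilityD(3) by blast
  then have "r \<le> y" "r < x" using assms(1) real by (auto simp: utility_domain_def)
  then have "w * r \<le> w * y" "(1 - w) * r < (1 - w) * x"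
    using assms by (auto intro: mult_left_mono)
  then have "r < w * y + (1 - w) * x" by (simp add: algebra_simps)
  then show ?thesis using real by (simp add: utility_domain_def)
next
  case PInf
  then show ?thesis using assms by (simp add: utility_domain_def)
next
  case MInf
  then show ?thesis by (simp add: utility_domain_def)
qed

lemma utility_concave:
  assumes "x \<in> utility_domain a" "U y = ereal c" "0 < w" "w < 1"
  shows "w * c + (1 - w) * real_of_ereal (U x) \<le> real_of_ereal (U (w * y + (1 - w) * x))"
proof -
  have "ereal w * U y + ereal (1 - w) * U x \<le> U (w * y + (1 - w) * x)"
    using admissible_utilityD(2) assms by blast
  moreover have "w * y + (1 - w) * x \<in> utility_domain a"
    using utility_domain_segment assms by auto
  ultimately show ?thesis
    using utility_finite_on_domain[of "w * y + (1 - w) * x"] utility_finite_on_domain[of x] assms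
    by (metis ereal_less_eq(3) plus_ereal.simps(1) times_ereal.simps(1))
qed

text \<open>
  The point \<open>y\<close> may be the left end point of the domain, where the utility need not be continuous. The
  difference quotients at \<open>x\<close> along the segment towards \<open>y\<close> dominate the slope of the chord by concavity,
  and they converge to the directional derivative at \<open>x\<close>.
\<close>

lemma utility_below_tangent:
  assumes x: "x \<in> utility_domain a"
  shows "U y \<le> ereal (real_of_ereal (U x) + marginal_utility U x * (y - x))"
proof (cases "U y = -\<infinity>")
  case False
  define f where "f = (\<lambda>x. real_of_ereal (U x))"
  define c where "c = f y"
  have c: "U y = ereal c" using utility_eq_ereal[OF False] by (simp add: c_def f_def)
  have "(f has_real_derivative marginal_utility U x) (at (x + 0 * (y - x)))"
    using has_marginal_utility[OF x] by (simp add: f_def)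
  then have "((\<lambda>w. f (x + w * (y - x))) has_real_derivative marginal_utility U x * (y - x)) (at 0)"
    by (rule DERIV_chain2) (auto intro!: derivative_eq_intros)
  then have "((\<lambda>h. (f (x + h * (y - x)) - f x) / h) \<longlongrightarrow> marginal_utility U x * (y - x)) (at 0)"
    by (simp add: DERIV_def)
  then have lim: "((\<lambda>h. (f (x + h * (y - x)) - f x) / h) \<longlongrightarrow> marginal_utility U x * (y - x)) (at_right 0)"
    by (rule tendsto_within_subset) auto
  have "c - f x \<le> marginal_utility U x * (y - x)"
  proof (rule tendsto_lowerbound[OF lim])
    show "\<forall>\<^sub>F h in at_right 0. c - f x \<le> (f (x + h * (y - x)) - f x) / h"
      using eventually_at_right_real[of 0 1]
    proof (rule eventually_mono)
      show "0 < (1::real)" by simp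
      fix h :: real assume h: "h \<in> {0<..<1}"
      then have "h * c + (1 - h) * f x \<le> f (h * y + (1 - h) * x)"
        unfolding f_def using utility_concave[OF x c] by auto
      also have "h * y + (1 - h) * x = x + h * (y - x)" by (simp add: algebra_simps)
      finally have "h * (c - f x) \<le> f (x + h * (y - x)) - f x" by (simp add: algebra_simps)
      then show "c - f x \<le> (f (x + h * (y - x)) - f x) / h"
        using h by (simp add: field_simps)
    qed
  qed simp
  then show ?thesis using c by (simp add: f_def)
qed simp

text \<open>
  Two tangent inequalities give monotonicity; injectivity of the marginal utility makes it strict.
\<close>

lemma marginal_utility_strict_decreasing:
  assumes "x \<in> utility_domain a" "y \<in> utility_domain a" "x < y"
  shows "marginal_utility U y < marginal_utility U x"
proof -
  let ?f = "\<lambda>x. real_of_ereal (U x)" and ?u = "marginal_utility U"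
  have "?f y \<le> ?f x + ?u x * (y - x)"
    using utility_below_tangent[OF assms(1), of y] utility_finite_on_domain[OF assms(2)]
    by (metis ereal_less_eq(3))
  moreover have "?f x \<le> ?f y + ?u y * (x - y)"
    using utility_below_tangent[OF assms(2), of x] utility_finite_on_domain[OF assms(1)]
    by (metis ereal_less_eq(3))
  ultimately have "(?u y - ?u x) * (y - x) \<le> 0" by (simp add: algebra_simps)
  then have "?u y \<le> ?u x" using assms(3) by (simp add: mult_le_0_iff)
  moreover have "?u y \<noteq> ?u x"
    using inj_onD[OF admissible_utilityD(9) _ assms(2,1)] assms(3) by auto
  ultimately show ?thesis by simp
qed

text \<open>
  If a tangent touched the graph at a second point, then the graph would be straight in between, and the
  tangent at the midpoint, which has a strictly different slope, would fall below one of the two points.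
\<close>

lemma utility_eq_tangent_imp_eq:
  assumes x: "x \<in> utility_domain a"
    and eq: "U y = ereal (real_of_ereal (U x) + marginal_utility U x * (y - x))"
  shows "y = x"
proof (rule ccontr)
  assume neq: "y \<noteq> x"
  let ?f = "\<lambda>x. real_of_ereal (U x)" and ?u = "marginal_utility U"
  \<comment> \<open>the midpoint, written in the form required by concavity\<close>
  define z where "z = 1/2 * y + (1 - 1/2) * x"
  have z: "z \<in> utility_domain a"
    unfolding z_def using eq by (intro utility_domain_segment[OF x]) auto
  have "1/2 * (?f x + ?u x * (y - x)) + (1 - 1/2) * ?f x \<le> ?f z"
    unfolding z_def by (rule utility_concave[OF x eq]) auto
  then have 1: "?f x + ?u x * (y - x) / 2 \<le> ?f z" by (simp add: field_simps)
  have 2: "?f z \<le> ?f x + ?u x * (z - x)"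
    using utility_below_tangent[OF x, of z] utility_finite_on_domain[OF z]
    by (metis ereal_less_eq(3))
  have "?f x + ?u x * (y - x) \<le> ?f z + ?u z * (y - z)"
    using utility_below_tangent[OF z, of y] unfolding eq by simp
  with 2 have "?u x * (y - x) - ?u x * (z - x) \<le> ?u z * (y - z)" by simp
  moreover have "y - z = (y - x) / 2" "z - x = (y - x) / 2" by (auto simp: z_def field_simps)
  ultimately have "?u x * (y - x) - ?u x * ((y - x) / 2) \<le> ?u z * ((y - x) / 2)" by metis
  then have "(?u x - ?u z) * (y - x) \<le> 0"
    unfolding left_diff_distrib times_divide_eq_right by linarith
  moreover have "(?u x - ?u z) * (y - x) > 0"
  proof (cases "x < y")
    case True
    then show ?thesis
      using marginal_utility_strict_decreasing[OF x z] by (auto simp: z_def)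
  next
    case False
    with neq have "y < x" by simp
    then show ?thesis
      using marginal_utility_strict_decreasing[OF z x] by (auto simp: z_def mult_neg_neg)
  qed
  ultimately show False by simp
qed

text \<open>
  The range is an interval, being the continuous image of an interval, and it is unbounded above. If its
  infimum is \<open>0\<close> then it is not attained, because the marginal utility takes a smaller value further to
  the right.
\<close>

lemma marginal_range_cases: "marginal_range U a = UNIV \<or> marginal_range U a = {0<..}"
proof -
  let ?u = "marginal_utility U" and ?B = "marginal_range U a"
  have "continuous_on (utility_domain a) ?u"
    using admissible_utilityD(6)
    by (intro continuous_at_imp_continuous_on) (blast intro: differentiable_imp_continuous_within)
  then have conn: "connected ?B"
    unfolding marginal_range_def by (rule connected_continuous_image[OF _ connected_utility_domain])
  have Sup: "(SUP y\<in>?B. ereal y) = \<infinity>" and Inf: "(INF y\<in>?B. ereal y) \<in> {0, -\<infinity>}"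
    by (rule admissible_utilityD)+
  have up: "\<exists>y\<in>?B. b < y" for b :: real
  proof -
    have "ereal b < (SUP y\<in>?B. ereal y)" by (simp add: Sup)
    then show ?thesis unfolding less_SUP_iff by auto
  qed
  have down: "\<exists>y\<in>?B. y < b" if "(INF y\<in>?B. ereal y) < ereal b" for b :: real
    using that unfolding INF_less_iff by auto
  have mem: "b \<in> ?B" if "(INF y\<in>?B. ereal y) < ereal b" for b :: real
    using up[of b] down[OF that] conn unfolding connected_iff_interval by (metis less_imp_le)
  from Inf consider "(INF y\<in>?B. ereal y) = -\<infinity>" | "(INF y\<in>?B. ereal y) = 0" by auto
  then show ?thesis
  proof cases
    case 1
    then show ?thesis using mem by auto
  next
    case 2
    have "0 < y" if y: "y \<in> ?B" for y
    proof -
      obtain x where x: "x \<in> utility_domain a" "y = ?u x"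
        using y by (auto simp: marginal_range_def)
      have x1: "x + 1 \<in> utility_domain a" using utility_domain_upward[OF x(1)] by auto
      then have "?u (x + 1) \<in> ?B" by (auto simp: marginal_range_def)
      then have "0 \<le> ereal (?u (x + 1))" using 2 INF_lower[of "?u (x + 1)" ?B ereal] by simp
      then show ?thesis using marginal_utility_strict_decreasing[OF x(1) x1] x by auto
    qed
    then show ?thesis using mem 2 by auto
  qed
qed

lemma inverse_marginal_in_domain:
  "y \<in> marginal_range U a \<Longrightarrow> inverse_marginal U a y \<in> utility_domain a"
  and marginal_utility_inverse_marginal:
  "y \<in> marginal_range U a \<Longrightarrow> marginal_utility U (inverse_marginal U a y) = y"
  and inverse_marginal_marginal_utility:
  "x \<in> utility_domain a \<Longrightarrow> inverse_marginal U a (marginal_utility U x) = x"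
  using admissible_utilityD(9) unfolding marginal_range_def inverse_marginal_def
  by (simp_all add: the_inv_into_into f_the_inv_into_f the_inv_into_f_f)

lemma inverse_marginal_strict_decreasing:
  assumes "y \<in> marginal_range U a" "z \<in> marginal_range U a" "y < z"
  shows "inverse_marginal U a z < inverse_marginal U a y"
proof (rule ccontr)
  assume "\<not> ?thesis"
  then have "inverse_marginal U a y = inverse_marginal U a z \<or>
      inverse_marginal U a y < inverse_marginal U a z" by auto
  then show False
    using marginal_utility_strict_decreasing[of "inverse_marginal U a y" "inverse_marginal U a z"]
      inverse_marginal_in_domain[OF assms(1)] inverse_marginal_in_domain[OF assms(2)]
      marginal_utility_inverse_marginal[OF assms(1)] marginal_utility_inverse_marginal[OF assms(2)]
      assms(3) by auto
qed

lemma continuous_on_inverse_marginal: "continuous_on (marginal_range U a) (inverse_marginal U a)"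
  using admissible_utilityD(10)
  by (intro continuous_at_imp_continuous_on) (blast intro: differentiable_imp_continuous_within)

lemma borel_marginal_range: "marginal_range U a \<in> sets borel"
  by (rule disjE[OF marginal_range_cases]) (simp_all only: borel_open open_UNIV open_greaterThan)

text \<open>
  Hence the inverse marginal utility can be evaluated at every positive multiple of a multiplier.
\<close>

lemma marginal_range_scale:
  "y \<in> marginal_range U a \<Longrightarrow> 0 < c \<Longrightarrow> y * c \<in> marginal_range U a"
  by (rule disjE[OF marginal_range_cases]) (simp_all only: UNIV_I greaterThan_iff mult_pos_pos)

text \<open>
  The utility is continuous in the interior of its domain and constant to the left of it; this leaves
  at most a single point.
\<close>

lemma borel_measurable_utility: "U \<in> borel_measurable borel"
proof -
  let ?f = "\<lambda>x. real_of_ereal (U x)" and ?A = "utility_domain a"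
  have A[measurable]: "?A \<in> sets borel" using open_utility_domain by auto
  have "continuous_on ?A ?f"
    using has_marginal_utility by (intro continuous_at_imp_continuous_on) (auto dest: DERIV_isCont)
  then have [measurable]: "(\<lambda>x. indicator ?A x *\<^sub>R ?f x) \<in> borel_measurable borel"
    by (rule borel_measurable_continuous_on_indicator[OF A])
  have "U = (\<lambda>x. if x \<in> ?A then ereal (indicator ?A x *\<^sub>R ?f x)
      else if ereal x = a then U (real_of_ereal a) else -\<infinity>)"
  proof
    fix x
    have "\<not> a < ereal x \<Longrightarrow> ereal x \<noteq> a \<Longrightarrow> U x = -\<infinity>"
      using admissible_utilityD(3)[of x] by (metis linorder_neqE)
    then show "U x = (if x \<in> ?A then ereal (indicator ?A x *\<^sub>R ?f x)
      else if ereal x = a then U (real_of_ereal a) else -\<infinity>)"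
      using utility_finite_on_domain[of x] by (auto simp: utility_domain_def)
  qed
  also have "\<dots> \<in> borel_measurable borel" by measurable
  finally show ?thesis .
qed

end

lemma inverse_marginal_growth:
  assumes adm: "admissible_utility U a"
  shows "\<exists>r c1 c2 c3. \<forall>y\<in>marginal_range U a. y \<noteq> 0 \<longrightarrow>
    \<bar>inverse_marginal U a y\<bar> \<le> c1 + c2 * \<bar>y\<bar> powr r + c3 * \<bar>y\<bar> powr (- r)"
proof -
  from admissible_utilityD(11)[OF adm] obtain r c1 c2 c3 where *: "\<forall>y\<in>marginal_range U a. y \<noteq> 0 \<longrightarrow>
           \<bar>inverse_marginal U a y\<bar> + \<bar>y * deriv (inverse_marginal U a) y\<bar>
             \<le> c1 + c2 * \<bar>y\<bar> powr r + c3 * \<bar>y\<bar> powr (- r)" by blast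
  have "\<forall>y\<in>marginal_range U a. y \<noteq> 0 \<longrightarrow>
    \<bar>inverse_marginal U a y\<bar> \<le> c1 + c2 * \<bar>y\<bar> powr r + c3 * \<bar>y\<bar> powr (- r)"
  proof (intro ballI impI)
    fix y assume "y \<in> marginal_range U a" "y \<noteq> 0"
    then have "\<bar>inverse_marginal U a y\<bar> + \<bar>y * deriv (inverse_marginal U a) y\<bar>
             \<le> c1 + c2 * \<bar>y\<bar> powr r + c3 * \<bar>y\<bar> powr (- r)" using * by blast
    then show "\<bar>inverse_marginal U a y\<bar> \<le> c1 + c2 * \<bar>y\<bar> powr r + c3 * \<bar>y\<bar> powr (- r)"
      using abs_ge_zero[of "y * deriv (inverse_marginal U a) y"] by linarith
  qed
  then show ?thesis by blast
qed

section \<open>Expectations of extended real variables\<close>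

lemma ereal_expectation_of_real:
  assumes "integrable M k" "\<And>\<omega>. \<omega> \<in> space M \<Longrightarrow> Z \<omega> = ereal (k \<omega>)"
  shows "ereal_expectation M Z = ereal (\<integral>\<omega>. k \<omega> \<partial>M)"
proof -
  have 1: "(\<integral>\<^sup>+ \<omega>. e2ennreal (Z \<omega>) \<partial>M) = (\<integral>\<^sup>+ \<omega>. ennreal (k \<omega>) \<partial>M)"
    using assms(2) by (intro nn_integral_cong) (simp add: e2ennreal_ereal)
  have 2: "(\<integral>\<^sup>+ \<omega>. e2ennreal (- Z \<omega>) \<partial>M) = (\<integral>\<^sup>+ \<omega>. ennreal (- k \<omega>) \<partial>M)"
    using assms(2) by (intro nn_integral_cong) (simp add: e2ennreal_ereal)
  obtain r q where *: "0 \<le> r" "0 \<le> q" "(\<integral>\<^sup>+ \<omega>. ennreal (k \<omega>) \<partial>M) = ennreal r"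
      "(\<integral>\<^sup>+ \<omega>. ennreal (- k \<omega>) \<partial>M) = ennreal q" "(\<integral>\<omega>. k \<omega> \<partial>M) = r - q"
    using integrableE[OF assms(1)] by metis
  show ?thesis
    unfolding ereal_expectation_def 1 2 * using * by simp
qed

text \<open>
  The dominated variable has an integrable positive part. Either its negative part has infinite
  expectation, and then so has the variable, or it is almost everywhere a real integrable function.
\<close>

lemma ereal_expectation_le:
  assumes Z[measurable]: "Z \<in> borel_measurable M" and k: "integrable M k"
    and le: "\<And>\<omega>. \<omega> \<in> space M \<Longrightarrow> Z \<omega> \<le> ereal (k \<omega>)"
  shows "ereal_expectation M Z \<le> ereal (\<integral>\<omega>. k \<omega> \<partial>M)"
    and "ereal_expectation M Z = ereal (\<integral>\<omega>. k \<omega> \<partial>M) \<Longrightarrow> AE \<omega> in M. Z \<omega> = ereal (k \<omega>)"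
proof -
  define p q where "p = (\<integral>\<^sup>+ \<omega>. e2ennreal (Z \<omega>) \<partial>M)" and "q = (\<integral>\<^sup>+ \<omega>. e2ennreal (- Z \<omega>) \<partial>M)"
  have "p \<le> (\<integral>\<^sup>+ \<omega>. ennreal (k \<omega>) \<partial>M)"
    unfolding p_def
    by (intro nn_integral_mono) (metis e2ennreal_ereal e2ennreal_mono le)
  also have "\<dots> < \<infinity>"
    using integrableE[OF k] by (metis ennreal_less_top infinity_ennreal_def)
  finally have p: "p < \<infinity>" .
  have "ereal_expectation M Z \<le> ereal (\<integral>\<omega>. k \<omega> \<partial>M) \<and>
      (ereal_expectation M Z = ereal (\<integral>\<omega>. k \<omega> \<partial>M) \<longrightarrow> (AE \<omega> in M. Z \<omega> = ereal (k \<omega>)))"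
  proof (cases "q = \<infinity>")
    case True
    have "\<bar>enn2ereal p\<bar> \<noteq> \<infinity>" using p by (cases p) auto
    then have "ereal_expectation M Z = -\<infinity>"
      unfolding ereal_expectation_def p_def[symmetric] q_def[symmetric] using True
      by (cases "enn2ereal p") (auto simp: enn2ereal_eq_top_iff)
    then show ?thesis by simp
  next
    case False
    have "AE \<omega> in M. e2ennreal (- Z \<omega>) \<noteq> \<infinity>"
      using False unfolding q_def by (intro nn_integral_PInf_AE) auto
    then have fin: "AE \<omega> in M. Z \<omega> = ereal (real_of_ereal (Z \<omega>))"
    proof (rule AE_mp, intro AE_I2 impI)
      fix \<omega> assume "\<omega> \<in> space M" "e2ennreal (- Z \<omega>) \<noteq> \<infinity>"
      then show "Z \<omega> = ereal (real_of_ereal (Z \<omega>))"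
        using le[of \<omega>] by (cases "Z \<omega>") auto
    qed
    define z where "z = (\<lambda>\<omega>. real_of_ereal (Z \<omega>))"
    have [measurable]: "z \<in> borel_measurable M" unfolding z_def by measurable
    have P: "p = (\<integral>\<^sup>+ \<omega>. ennreal (z \<omega>) \<partial>M)"
      unfolding p_def 
    proof (rule nn_integral_cong_AE)
      show "AE \<omega> in M. e2ennreal (Z \<omega>) = ennreal (z \<omega>)"
        using fin
      proof eventually_elim
        case (elim \<omega>)
        then show ?case by (metis e2ennreal_ereal z_def)
      qed
    qed
    have Q: "q = (\<integral>\<^sup>+ \<omega>. ennreal (- z \<omega>) \<partial>M)"
      unfolding q_def
    proof (rule nn_integral_cong_AE)
      show "AE \<omega> in M. e2ennreal (- Z \<omega>) = ennreal (- z \<omega>)"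
        using fin
      proof eventually_elim
        case (elim \<omega>)
        then show ?case by (metis e2ennreal_ereal uminus_ereal.simps(1) z_def)
      qed
    qed
    have int: "integrable M z"
      using p False P Q by (auto simp: real_integrable_def)
    have E: "ereal_expectation M Z = ereal (\<integral>\<omega>. z \<omega> \<partial>M)"
      using ereal_expectation_of_real[OF int, of "\<lambda>\<omega>. ereal (z \<omega>)"] P Q
      unfolding ereal_expectation_def p_def[symmetric] q_def[symmetric] by (simp add: e2ennreal_ereal)
    have zk: "AE \<omega> in M. z \<omega> \<le> k \<omega>"
      using fin
    proof (rule AE_mp, intro AE_I2 impI)
      fix \<omega> assume "\<omega> \<in> space M" "Z \<omega> = ereal (real_of_ereal (Z \<omega>))"
      then show "z \<omega> \<le> k \<omega>" using le[of \<omega>] unfolding z_def by (metis ereal_less_eq(3))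
    qed
    show ?thesis
    proof (intro conjI impI)
      show "ereal_expectation M Z \<le> ereal (\<integral>\<omega>. k \<omega> \<partial>M)"
        unfolding E using integral_mono_AE[OF int k zk] by simp
      assume "ereal_expectation M Z = ereal (\<integral>\<omega>. k \<omega> \<partial>M)"
      then have "(\<integral>\<omega>. k \<omega> - z \<omega> \<partial>M) = 0" unfolding E using int k by simp
      then have "AE \<omega> in M. k \<omega> - z \<omega> = 0"
        using int k zk by (subst (asm) integral_nonneg_eq_0_iff_AE) auto
      then show "AE \<omega> in M. Z \<omega> = ereal (k \<omega>)"
        using fin unfolding z_def by eventually_elim (metis eq_iff_diff_eq_0)
    qed
  qed
  then show "ereal_expectation M Z \<le> ereal (\<integral>\<omega>. k \<omega> \<partial>M)"
    and "ereal_expectation M Z = ereal (\<integral>\<omega>. k \<omega> \<partial>M) \<Longrightarrow> AE \<omega> in M. Z \<omega> = ereal (k \<omega>)" by auto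
qed

section \<open>The optimal payoff for a pricing density with all moments\<close>

context
  fixes M :: "'a measure" and U :: "real \<Rightarrow> ereal" and a :: ereal and \<zeta> :: "'a \<Rightarrow> real"
  assumes prob: "prob_space M" and adm: "admissible_utility U a"
    and \<zeta>[measurable]: "\<zeta> \<in> borel_measurable M"
    and pos: "\<And>\<omega>. \<omega> \<in> space M \<Longrightarrow> 0 < \<zeta> \<omega>"
    and moments: "\<And>p. integrable M (\<lambda>\<omega>. \<zeta> \<omega> powr p)"
begin

lemma integrable_density: "integrable M \<zeta>"
  using moments[of 1] pos
  by (subst (asm) Bochner_Integration.integrable_cong[of _ _ _ \<zeta>]) (auto simp: abs_of_pos)

lemma measurable_optimal_payoff:
  assumes lam: "lam \<in> marginal_range U a"
  shows "(\<lambda>\<omega>. inverse_marginal U a (lam * \<zeta> \<omega>)) \<in> borel_measurable M"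
proof -
  let ?B = "marginal_range U a" and ?I = "inverse_marginal U a"
  have [measurable]: "(\<lambda>y. indicator ?B y *\<^sub>R ?I y) \<in> borel_measurable borel"
    by (rule borel_measurable_continuous_on_indicator[OF borel_marginal_range[OF adm] continuous_on_inverse_marginal[OF adm]])
  have "(\<lambda>\<omega>. indicator ?B (lam * \<zeta> \<omega>) *\<^sub>R ?I (lam * \<zeta> \<omega>)) \<in> borel_measurable M"
    by measurable
  then show ?thesis
    using marginal_range_scale[OF adm lam pos] by (subst measurable_cong) auto
qed

text \<open>
  For a nonzero multiplier this is the growth bound of the inverse marginal utility. That bound is
  silent at \<open>0\<close>, but for the multiplier \<open>0\<close> the payoff is constant.
\<close>

lemma optimal_payoff_growth:
  assumes lam: "lam \<in> marginal_range U a"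
  shows "\<exists>r c1 c2 c3. \<forall>\<omega>\<in>space M.
    \<bar>inverse_marginal U a (lam * \<zeta> \<omega>)\<bar> \<le> c1 + c2 * \<zeta> \<omega> powr r + c3 * \<zeta> \<omega> powr (- r)"
proof (cases "lam = 0")
  case True
  then show ?thesis
    by (intro exI[of _ 0] exI[of _ "\<bar>inverse_marginal U a 0\<bar>"]) simp
next
  case False
  from inverse_marginal_growth[OF adm] obtain r c1 c2 c3 where
    *: "\<forall>y\<in>marginal_range U a. y \<noteq> 0 \<longrightarrow>
    \<bar>inverse_marginal U a y\<bar> \<le> c1 + c2 * \<bar>y\<bar> powr r + c3 * \<bar>y\<bar> powr (- r)" by blast
  have "\<forall>\<omega>\<in>space M. \<bar>inverse_marginal U a (lam * \<zeta> \<omega>)\<bar> \<le>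
        c1 + (c2 * \<bar>lam\<bar> powr r) * \<zeta> \<omega> powr r + (c3 * \<bar>lam\<bar> powr (- r)) * \<zeta> \<omega> powr (- r)"
  proof
    fix \<omega> assume w: "\<omega> \<in> space M"
    have "lam * \<zeta> \<omega> \<noteq> 0" using False pos[OF w] by auto
    from *[rule_format, OF marginal_range_scale[OF adm lam pos[OF w]] this]
    show "\<bar>inverse_marginal U a (lam * \<zeta> \<omega>)\<bar> \<le>
        c1 + (c2 * \<bar>lam\<bar> powr r) * \<zeta> \<omega> powr r + (c3 * \<bar>lam\<bar> powr (- r)) * \<zeta> \<omega> powr (- r)"
      using pos[OF w] by (simp add: abs_mult powr_mult mult.assoc)
  qed
  then show ?thesis by blast
qed

lemma integrable_optimal_payoff:
  assumes lam: "lam \<in> marginal_range U a"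
  shows "integrable M (\<lambda>\<omega>. inverse_marginal U a (lam * \<zeta> \<omega>) * \<zeta> \<omega>)"
    and "integrable M (\<lambda>\<omega>. (inverse_marginal U a (lam * \<zeta> \<omega>))\<^sup>2)"
proof -
  let ?X = "\<lambda>\<omega>. inverse_marginal U a (lam * \<zeta> \<omega>)"
  note [measurable] = measurable_optimal_payoff[OF lam]
  from optimal_payoff_growth[OF lam] obtain r c1 c2 c3 where
    "\<forall>\<omega>\<in>space M. \<bar>?X \<omega>\<bar> \<le> c1 + c2 * \<zeta> \<omega> powr r + c3 * \<zeta> \<omega> powr (- r)"
    by blast
  note b = bspec[OF this]
  show "integrable M (\<lambda>\<omega>. ?X \<omega> * \<zeta> \<omega>)"
  proof (rule Bochner_Integration.integrable_bound)
    show "integrable M (\<lambda>\<omega>. c1 * \<zeta> \<omega> powr 1 + c2 * \<zeta> \<omega> powr (r + 1) + c3 * \<zeta> \<omega> powr (- r + 1))"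
      by (intro Bochner_Integration.integrable_add integrable_mult_right moments)
    show "AE \<omega> in M. norm (?X \<omega> * \<zeta> \<omega>) \<le>
      norm (c1 * \<zeta> \<omega> powr 1 + c2 * \<zeta> \<omega> powr (r + 1) + c3 * \<zeta> \<omega> powr (- r + 1))"
    proof (rule AE_I2)
      fix \<omega> assume w: "\<omega> \<in> space M"
      have "norm (?X \<omega> * \<zeta> \<omega>) \<le> (c1 + c2 * \<zeta> \<omega> powr r + c3 * \<zeta> \<omega> powr (- r)) * \<zeta> \<omega>"
        using b[OF w] pos[OF w] by (simp add: abs_mult mult_right_mono)
      also have "\<dots> = c1 * \<zeta> \<omega> powr 1 + c2 * \<zeta> \<omega> powr (r + 1) + c3 * \<zeta> \<omega> powr (- r + 1)"
        using pos[OF w] by (simp only: powr_add powr_one) (simp add: algebra_simps)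
      finally show "norm (?X \<omega> * \<zeta> \<omega>) \<le>
          norm (c1 * \<zeta> \<omega> powr 1 + c2 * \<zeta> \<omega> powr (r + 1) + c3 * \<zeta> \<omega> powr (- r + 1))" by simp
    qed
  qed measurable
  show "integrable M (\<lambda>\<omega>. (?X \<omega>)\<^sup>2)"
  proof (rule Bochner_Integration.integrable_bound)
    show "integrable M (\<lambda>\<omega>. 3 * c1\<^sup>2 * \<zeta> \<omega> powr 0 + 3 * c2\<^sup>2 * \<zeta> \<omega> powr (r + r) + 3 * c3\<^sup>2 * \<zeta> \<omega> powr (- r + - r))"
      by (intro Bochner_Integration.integrable_add integrable_mult_right moments)
    show "AE \<omega> in M. norm ((?X \<omega>)\<^sup>2) \<le>
      norm (3 * c1\<^sup>2 * \<zeta> \<omega> powr 0 + 3 * c2\<^sup>2 * \<zeta> \<omega> powr (r + r) + 3 * c3\<^sup>2 * \<zeta> \<omega> powr (- r + - r))"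
    proof (rule AE_I2)
      fix \<omega> assume w: "\<omega> \<in> space M"
      define b' c' where "b' = c2 * \<zeta> \<omega> powr r" and "c' = c3 * \<zeta> \<omega> powr (- r)"
      have "(?X \<omega>)\<^sup>2 \<le> (c1 + b' + c')\<^sup>2"
        using b[OF w] power_mono[of "\<bar>?X \<omega>\<bar>" "c1 + b' + c'" 2] by (simp add: b'_def c'_def)
      also have "\<dots> \<le> 3 * c1\<^sup>2 + 3 * b'\<^sup>2 + 3 * c'\<^sup>2"
        using zero_le_power2[of "c1 - b'"] zero_le_power2[of "b' - c'"] zero_le_power2[of "c1 - c'"]
        by (simp add: power2_eq_square algebra_simps)
      also have "\<dots> = 3 * c1\<^sup>2 * \<zeta> \<omega> powr 0 + 3 * c2\<^sup>2 * \<zeta> \<omega> powr (r + r) + 3 * c3\<^sup>2 * \<zeta> \<omega> powr (- r + - r)"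
        using pos[OF w] by (simp only: powr_add b'_def c'_def power_mult_distrib) (simp add: power2_eq_square algebra_simps)
      finally show "norm ((?X \<omega>)\<^sup>2) \<le>
          norm (3 * c1\<^sup>2 * \<zeta> \<omega> powr 0 + 3 * c2\<^sup>2 * \<zeta> \<omega> powr (r + r) + 3 * c3\<^sup>2 * \<zeta> \<omega> powr (- r + - r))" by simp
    qed
  qed measurable
qed

lemma optimal_payoff_decreasing:
  assumes "l1 \<in> marginal_range U a" "l2 \<in> marginal_range U a" "l1 < l2" "\<omega> \<in> space M"
  shows "inverse_marginal U a (l2 * \<zeta> \<omega>) < inverse_marginal U a (l1 * \<zeta> \<omega>)"
  using assms pos by (intro inverse_marginal_strict_decreasing[OF adm] marginal_range_scale[OF adm]) auto

lemma cost_decreasing: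
  assumes "l1 \<in> marginal_range U a" "l2 \<in> marginal_range U a" "l1 < l2"
  shows "(\<integral>\<omega>. inverse_marginal U a (l2 * \<zeta> \<omega>) * \<zeta> \<omega> \<partial>M) < (\<integral>\<omega>. inverse_marginal U a (l1 * \<zeta> \<omega>) * \<zeta> \<omega> \<partial>M)"
proof -
  interpret prob_space M by (rule prob)
  show ?thesis
    using optimal_payoff_decreasing[OF assms] pos
    by (intro integral_less_AE_space integrable_optimal_payoff assms AE_I2)
      (auto simp: emeasure_space_1)
qed

text \<open>
  By monotonicity the payoffs for all multipliers in an interval are sandwiched between those for the two
  end points, which provides an integrable bound.
\<close>

lemma continuous_on_cost:
  assumes "l1 \<in> marginal_range U a" "l2 \<in> marginal_range U a"
  shows "continuous_on {l1..l2} (\<lambda>l. \<integral>\<omega>. inverse_marginal U a (l * \<zeta> \<omega>) * \<zeta> \<omega> \<partial>M)"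
  unfolding continuous_on_sequentially comp_def
proof (intro allI ballI impI)
  fix x l assume l: "l \<in> {l1..l2}" and xl: "(\<forall>n. x n \<in> {l1..l2}) \<and> x \<longlonglongrightarrow> l"
  let ?I = "inverse_marginal U a" and ?B = "marginal_range U a"
  have B: "y \<in> ?B" if "y \<in> {l1..l2}" for y
    by (rule disjE[OF marginal_range_cases[OF adm]]) (use assms that in auto)
  show "(\<lambda>n. \<integral>\<omega>. ?I (x n * \<zeta> \<omega>) * \<zeta> \<omega> \<partial>M) \<longlonglongrightarrow> (\<integral>\<omega>. ?I (l * \<zeta> \<omega>) * \<zeta> \<omega> \<partial>M)"
  proof (rule integral_dominated_convergence[where w="\<lambda>\<omega>. \<bar>?I (l1 * \<zeta> \<omega>) * \<zeta> \<omega>\<bar> + \<bar>?I (l2 * \<zeta> \<omega>) * \<zeta> \<omega>\<bar>"])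
    show "integrable M (\<lambda>\<omega>. \<bar>?I (l1 * \<zeta> \<omega>) * \<zeta> \<omega>\<bar> + \<bar>?I (l2 * \<zeta> \<omega>) * \<zeta> \<omega>\<bar>)"
      by (intro Bochner_Integration.integrable_add integrable_abs integrable_optimal_payoff assms)
    show "(\<lambda>\<omega>. ?I (l * \<zeta> \<omega>) * \<zeta> \<omega>) \<in> borel_measurable M"
      "\<And>n. (\<lambda>\<omega>. ?I (x n * \<zeta> \<omega>) * \<zeta> \<omega>) \<in> borel_measurable M"
      using xl l by (auto intro!: borel_measurable_integrable integrable_optimal_payoff B)
    show "AE \<omega> in M. (\<lambda>n. ?I (x n * \<zeta> \<omega>) * \<zeta> \<omega>) \<longlonglongrightarrow> ?I (l * \<zeta> \<omega>) * \<zeta> \<omega>"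
    proof (rule AE_I2)
      fix \<omega> assume w: "\<omega> \<in> space M"
      have "isCont ?I (l * \<zeta> \<omega>)"
        using admissible_utilityD(10)[OF adm marginal_range_scale[OF adm B[OF l] pos[OF w]]]
        by (rule differentiable_imp_continuous_within)
      then have "(\<lambda>n. ?I (x n * \<zeta> \<omega>)) \<longlonglongrightarrow> ?I (l * \<zeta> \<omega>)"
        by (rule isCont_tendsto_compose) (intro tendsto_intros, use xl in auto)
      then show "(\<lambda>n. ?I (x n * \<zeta> \<omega>) * \<zeta> \<omega>) \<longlonglongrightarrow> ?I (l * \<zeta> \<omega>) * \<zeta> \<omega>"
        by (intro tendsto_intros)
    qed
    fix n
    show "AE \<omega> in M. norm (?I (x n * \<zeta> \<omega>) * \<zeta> \<omega>) \<le> \<bar>?I (l1 * \<zeta> \<omega>) * \<zeta> \<omega>\<bar> + \<bar>?I (l2 * \<zeta> \<omega>) * \<zeta> \<omega>\<bar>"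
    proof (rule AE_I2)
      fix \<omega> assume w: "\<omega> \<in> space M"
      have n: "l1 \<le> x n" "x n \<le> l2" "x n \<in> ?B" using xl B by auto
      have "?I (l2 * \<zeta> \<omega>) \<le> ?I (x n * \<zeta> \<omega>)" "?I (x n * \<zeta> \<omega>) \<le> ?I (l1 * \<zeta> \<omega>)"
        using optimal_payoff_decreasing[OF n(3) assms(2) _ w] optimal_payoff_decreasing[OF assms(1) n(3) _ w] n
        by (cases "x n = l2"; cases "l1 = x n"; force)+
      then have "\<bar>?I (x n * \<zeta> \<omega>)\<bar> \<le> \<bar>?I (l1 * \<zeta> \<omega>)\<bar> + \<bar>?I (l2 * \<zeta> \<omega>)\<bar>" by linarith
      then have "\<bar>?I (x n * \<zeta> \<omega>)\<bar> * \<zeta> \<omega> \<le> (\<bar>?I (l1 * \<zeta> \<omega>)\<bar> + \<bar>?I (l2 * \<zeta> \<omega>)\<bar>) * \<zeta> \<omega>"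
        using pos[OF w] by (intro mult_right_mono) auto
      then show "norm (?I (x n * \<zeta> \<omega>) * \<zeta> \<omega>) \<le> \<bar>?I (l1 * \<zeta> \<omega>) * \<zeta> \<omega>\<bar> + \<bar>?I (l2 * \<zeta> \<omega>) * \<zeta> \<omega>\<bar>"
        using pos[OF w] by (simp add: abs_mult algebra_simps)
    qed
  qed
qed

text \<open>
  A sequence of multipliers tending to the upper end of the range of the marginal utility.
\<close>

lemma eventually_multiple_above:
  obtains l :: "nat \<Rightarrow> real" where "\<And>n. l n \<in> marginal_range U a"
    and "\<And>z c. 0 < z \<Longrightarrow> c \<in> marginal_range U a \<Longrightarrow> \<forall>\<^sub>F n in sequentially. c \<le> l n * z"
    and "decseq (\<lambda>n. - l n)"
proof (rule that[of "\<lambda>n. real n + 1"])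
  show "real n + 1 \<in> marginal_range U a" for n
    by (rule disjE[OF marginal_range_cases[OF adm]]) auto
  fix z c :: real assume "0 < z"
  then have "filterlim (\<lambda>n. (real n + 1) * z) at_top sequentially"
    by real_asymp
  then show "\<forall>\<^sub>F n in sequentially. c \<le> (real n + 1) * z"
    by (simp add: filterlim_at_top)
qed (auto simp: decseq_def)

text \<open>
  A sequence of multipliers tending to the lower end of the range, which is either \<open>-\<infinity>\<close> or \<open>0\<close>.
\<close>

lemma eventually_multiple_below:
  obtains l :: "nat \<Rightarrow> real" where "\<And>n. l n \<in> marginal_range U a"
    and "\<And>z c. 0 < z \<Longrightarrow> c \<in> marginal_range U a \<Longrightarrow> \<forall>\<^sub>F n in sequentially. l n * z \<le> c"
    and "decseq l"
proof (cases "marginal_range U a = UNIV")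
  case True
  show ?thesis
  proof (rule that[of "\<lambda>n. - real n - 1"])
    fix z c :: real assume "0 < z"
    then have "filterlim (\<lambda>n. (- real n - 1) * z) at_bot sequentially"
      by real_asymp
    then show "\<forall>\<^sub>F n in sequentially. (- real n - 1) * z \<le> c"
      by (simp add: filterlim_at_bot)
  qed (auto simp: decseq_def True)
next
  case False
  then have B: "marginal_range U a = {0<..}" using marginal_range_cases[OF adm] by blast
  show ?thesis
  proof (rule that[of "\<lambda>n. 1 / (real n + 1)"])
    fix z c :: real assume "0 < z" "c \<in> marginal_range U a"
    then have "0 < c" unfolding B by simp
    have "(\<lambda>n. 1 / (real n + 1) * z) \<longlonglongrightarrow> 0" by real_asymp
    from order_tendstoD(2)[OF this \<open>0 < c\<close>]
    show "\<forall>\<^sub>F n in sequentially. 1 / (real n + 1) * z \<le> c"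
      by eventually_elim simp
  qed (auto simp: decseq_def B field_simps)
qed

lemma marginal_utility_in_range: "x \<in> utility_domain a \<Longrightarrow> marginal_utility U x \<in> marginal_range U a"
  by (simp add: marginal_range_def)

text \<open>
  For multipliers tending to one end of the range, every payoff eventually passes any fixed \<open>x\<close> in the
  domain, but at a rate that depends on the state. The cut-off \<open>\<phi>\<close> at \<open>x\<close> makes dominated convergence
  applicable: the cost of the modified payoff tends to \<open>x\<close> times the mean of the density.
\<close>

lemma cutoff_cost_tendsto:
  assumes mean: "(\<integral>\<omega>. \<zeta> \<omega> \<partial>M) = 1" and l: "\<And>n. l n \<in> marginal_range U a"
    and [measurable]: "\<phi> \<in> borel_measurable borel"
    and \<phi>: "\<And>y. \<bar>\<phi> y\<bar> \<le> \<bar>y\<bar> + \<bar>x\<bar>"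
    and dom: "\<And>\<omega> n. \<omega> \<in> space M \<Longrightarrow>
      \<bar>\<phi> (inverse_marginal U a (l n * \<zeta> \<omega>))\<bar> \<le> \<bar>\<phi> (inverse_marginal U a (l 0 * \<zeta> \<omega>))\<bar> + \<bar>x\<bar>"
    and ev: "\<And>\<omega>. \<omega> \<in> space M \<Longrightarrow> \<forall>\<^sub>F n in sequentially. \<phi> (inverse_marginal U a (l n * \<zeta> \<omega>)) = x"
  shows "integrable M (\<lambda>\<omega>. \<phi> (inverse_marginal U a (l n * \<zeta> \<omega>)) * \<zeta> \<omega>)"
    and "(\<lambda>n. \<integral>\<omega>. \<phi> (inverse_marginal U a (l n * \<zeta> \<omega>)) * \<zeta> \<omega> \<partial>M) \<longlonglongrightarrow> x"
proof -
  let ?X = "\<lambda>n \<omega>. \<phi> (inverse_marginal U a (l n * \<zeta> \<omega>))"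
  note [measurable] = measurable_optimal_payoff[OF l]
  have int: "integrable M (\<lambda>\<omega>. ?X n \<omega> * \<zeta> \<omega>)" for n
  proof (rule Bochner_Integration.integrable_bound)
    show "integrable M (\<lambda>\<omega>. \<bar>inverse_marginal U a (l n * \<zeta> \<omega>) * \<zeta> \<omega>\<bar> + \<bar>x * \<zeta> \<omega>\<bar>)"
      by (intro Bochner_Integration.integrable_add integrable_abs integrable_optimal_payoff l
          integrable_mult_right integrable_density)
    show "AE \<omega> in M. norm (?X n \<omega> * \<zeta> \<omega>) \<le> norm (\<bar>inverse_marginal U a (l n * \<zeta> \<omega>) * \<zeta> \<omega>\<bar> + \<bar>x * \<zeta> \<omega>\<bar>)"
      using mult_right_mono[OF \<phi> abs_ge_zero] by (intro AE_I2) (simp add: abs_mult distrib_right)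
  qed measurable
  then show "integrable M (\<lambda>\<omega>. ?X n \<omega> * \<zeta> \<omega>)" .
  have "(\<lambda>n. \<integral>\<omega>. ?X n \<omega> * \<zeta> \<omega> \<partial>M) \<longlonglongrightarrow> (\<integral>\<omega>. x * \<zeta> \<omega> \<partial>M)"
  proof (rule integral_dominated_convergence[where w="\<lambda>\<omega>. \<bar>?X 0 \<omega> * \<zeta> \<omega>\<bar> + \<bar>x * \<zeta> \<omega>\<bar>"])
    show "integrable M (\<lambda>\<omega>. \<bar>?X 0 \<omega> * \<zeta> \<omega>\<bar> + \<bar>x * \<zeta> \<omega>\<bar>)"
      by (intro Bochner_Integration.integrable_add integrable_abs int integrable_mult_right integrable_density)
    show "AE \<omega> in M. (\<lambda>n. ?X n \<omega> * \<zeta> \<omega>) \<longlonglongrightarrow> x * \<zeta> \<omega>"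
      using ev by (intro AE_I2 tendsto_intros tendsto_eventually)
    show "AE \<omega> in M. norm (?X n \<omega> * \<zeta> \<omega>) \<le> \<bar>?X 0 \<omega> * \<zeta> \<omega>\<bar> + \<bar>x * \<zeta> \<omega>\<bar>" for n
      using mult_right_mono[OF dom abs_ge_zero] by (intro AE_I2) (simp add: abs_mult distrib_right)
  qed measurable
  then show "(\<lambda>n. \<integral>\<omega>. ?X n \<omega> * \<zeta> \<omega> \<partial>M) \<longlonglongrightarrow> x"
    using mean by simp
qed

text \<open>
  The cut-off from below at some \<open>x < v\<close> in the domain increases the cost, which still tends to \<open>x\<close>.
\<close>

lemma cost_below:
  assumes mean: "(\<integral>\<omega>. \<zeta> \<omega> \<partial>M) = 1" and v: "v \<in> utility_domain a"
  obtains l where "l \<in> marginal_range U a"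
    "(\<integral>\<omega>. inverse_marginal U a (l * \<zeta> \<omega>) * \<zeta> \<omega> \<partial>M) < v"
proof -
  let ?I = "inverse_marginal U a"
  obtain e where e: "0 < e" "ball v e \<subseteq> utility_domain a"
    using open_utility_domain[OF adm] v open_contains_ball by metis
  define x where "x = v - e / 2"
  have x: "x \<in> utility_domain a" "x < v" using e by (auto simp: x_def dist_real_def)
  obtain l :: "nat \<Rightarrow> real" where l: "\<And>n. l n \<in> marginal_range U a"
    "\<And>z c. 0 < z \<Longrightarrow> c \<in> marginal_range U a \<Longrightarrow> \<forall>\<^sub>F n in sequentially. c \<le> l n * z"
    "decseq (\<lambda>n. - l n)" by (rule eventually_multiple_above) blast
  have ev: "\<forall>\<^sub>F n in sequentially. max (?I (l n * \<zeta> \<omega>)) x = x" if w: "\<omega> \<in> space M" for \<omega>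
    using l(2)[OF pos[OF w] marginal_utility_in_range[OF x(1)]]
  proof eventually_elim
    case (elim n)
    have "?I (l n * \<zeta> \<omega>) \<le> ?I (marginal_utility U x)"
      using inverse_marginal_strict_decreasing[OF adm marginal_utility_in_range[OF x(1)] marginal_range_scale[OF adm l(1) pos[OF w]]] elim
      by (cases "marginal_utility U x = l n * \<zeta> \<omega>") (auto intro: less_imp_le)
    then show ?case using inverse_marginal_marginal_utility[OF adm x(1)] by (simp add: max_def)
  qed
  have dom: "\<bar>max (?I (l n * \<zeta> \<omega>)) x\<bar> \<le> \<bar>max (?I (l 0 * \<zeta> \<omega>)) x\<bar> + \<bar>x\<bar>" if w: "\<omega> \<in> space M" for \<omega> n
  proof -
    have "l 0 \<le> l n" using l(3) by (auto simp: decseq_def)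
    then have "?I (l n * \<zeta> \<omega>) \<le> ?I (l 0 * \<zeta> \<omega>)"
      using optimal_payoff_decreasing[OF l(1) l(1) _ w, of 0 n] by (cases "l 0 = l n") (auto intro: less_imp_le)
    then show ?thesis by linarith
  qed
  note cutoff = cutoff_cost_tendsto[of l "\<lambda>y. max y x", OF mean l(1) _ _ dom ev]
  have "(\<lambda>n. \<integral>\<omega>. max (?I (l n * \<zeta> \<omega>)) x * \<zeta> \<omega> \<partial>M) \<longlonglongrightarrow> x"
    by (rule cutoff(2)) auto
  from order_tendstoD(2)[OF this x(2)] obtain n where n: "(\<integral>\<omega>. max (?I (l n * \<zeta> \<omega>)) x * \<zeta> \<omega> \<partial>M) < v"
    by (auto simp: eventually_sequentially)
  have "integrable M (\<lambda>\<omega>. max (?I (l n * \<zeta> \<omega>)) x * \<zeta> \<omega>)"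
    by (rule cutoff(1)) auto
  then have "(\<integral>\<omega>. ?I (l n * \<zeta> \<omega>) * \<zeta> \<omega> \<partial>M) \<le> (\<integral>\<omega>. max (?I (l n * \<zeta> \<omega>)) x * \<zeta> \<omega> \<partial>M)"
    using pos by (intro integral_mono integrable_optimal_payoff l mult_right_mono) (auto intro: less_imp_le)
  with n show thesis by (intro that[OF l(1)[of n]]) auto
qed

lemma cost_above:
  assumes mean: "(\<integral>\<omega>. \<zeta> \<omega> \<partial>M) = 1" and v: "v \<in> utility_domain a"
  obtains l where "l \<in> marginal_range U a"
    "v < (\<integral>\<omega>. inverse_marginal U a (l * \<zeta> \<omega>) * \<zeta> \<omega> \<partial>M)"
proof -
  let ?I = "inverse_marginal U a"
  define x where "x = v + 1"
  have x: "x \<in> utility_domain a" "v < x" using utility_domain_upward[OF adm v, of x] by (auto simp: x_def)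
  obtain l :: "nat \<Rightarrow> real" where l: "\<And>n. l n \<in> marginal_range U a"
    "\<And>z c. 0 < z \<Longrightarrow> c \<in> marginal_range U a \<Longrightarrow> \<forall>\<^sub>F n in sequentially. l n * z \<le> c"
    "decseq l" by (rule eventually_multiple_below) blast
  have ev: "\<forall>\<^sub>F n in sequentially. min (?I (l n * \<zeta> \<omega>)) x = x" if w: "\<omega> \<in> space M" for \<omega>
    using l(2)[OF pos[OF w] marginal_utility_in_range[OF x(1)]]
  proof eventually_elim
    case (elim n)
    have "?I (marginal_utility U x) \<le> ?I (l n * \<zeta> \<omega>)"
      using inverse_marginal_strict_decreasing[OF adm marginal_range_scale[OF adm l(1) pos[OF w]] marginal_utility_in_range[OF x(1)]] elim
      by (cases "marginal_utility U x = l n * \<zeta> \<omega>") (auto intro: less_imp_le)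
    then show ?case using inverse_marginal_marginal_utility[OF adm x(1)] by (simp add: min_def)
  qed
  have dom: "\<bar>min (?I (l n * \<zeta> \<omega>)) x\<bar> \<le> \<bar>min (?I (l 0 * \<zeta> \<omega>)) x\<bar> + \<bar>x\<bar>" if w: "\<omega> \<in> space M" for \<omega> n
  proof -
    have "l n \<le> l 0" using l(3) by (auto simp: decseq_def)
    then have "?I (l 0 * \<zeta> \<omega>) \<le> ?I (l n * \<zeta> \<omega>)"
      using optimal_payoff_decreasing[OF l(1) l(1) _ w, of n 0] by (cases "l 0 = l n") (auto intro: less_imp_le)
    then show ?thesis by linarith
  qed
  note cutoff = cutoff_cost_tendsto[of l "\<lambda>y. min y x", OF mean l(1) _ _ dom ev]
  have "(\<lambda>n. \<integral>\<omega>. min (?I (l n * \<zeta> \<omega>)) x * \<zeta> \<omega> \<partial>M) \<longlonglongrightarrow> x"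
    by (rule cutoff(2)) auto
  from order_tendstoD(1)[OF this x(2)] obtain n where n: "v < (\<integral>\<omega>. min (?I (l n * \<zeta> \<omega>)) x * \<zeta> \<omega> \<partial>M)"
    by (auto simp: eventually_sequentially)
  have "integrable M (\<lambda>\<omega>. min (?I (l n * \<zeta> \<omega>)) x * \<zeta> \<omega>)"
    by (rule cutoff(1)) auto
  then have "(\<integral>\<omega>. min (?I (l n * \<zeta> \<omega>)) x * \<zeta> \<omega> \<partial>M) \<le> (\<integral>\<omega>. ?I (l n * \<zeta> \<omega>) * \<zeta> \<omega> \<partial>M)"
    using pos by (intro integral_mono integrable_optimal_payoff l mult_right_mono) (auto intro: less_imp_le)
  with n show thesis by (intro that[OF l(1)[of n]]) auto
qed

lemma ex1_multiplier:
  assumes mean: "(\<integral>\<omega>. \<zeta> \<omega> \<partial>M) = 1" and v: "v \<in> utility_domain a"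
  shows "\<exists>!lam. lam \<in> marginal_range U a \<and>
      has_bochner_integral M (\<lambda>\<omega>. inverse_marginal U a (lam * \<zeta> \<omega>) * \<zeta> \<omega>) v"
proof -
  define g where "g = (\<lambda>l. \<integral>\<omega>. inverse_marginal U a (l * \<zeta> \<omega>) * \<zeta> \<omega> \<partial>M)"
  have iff: "has_bochner_integral M (\<lambda>\<omega>. inverse_marginal U a (l * \<zeta> \<omega>) * \<zeta> \<omega>) v \<longleftrightarrow> g l = v"
    if "l \<in> marginal_range U a" for l
    unfolding has_bochner_integral_iff g_def using integrable_optimal_payoff(1)[OF that] by simp
  obtain l1 where l1: "l1 \<in> marginal_range U a" "v < g l1"
    unfolding g_def by (rule cost_above[OF mean v])
  obtain l2 where l2: "l2 \<in> marginal_range U a" "g l2 < v"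
    unfolding g_def by (rule cost_below[OF mean v])
  have "l1 < l2"
    using cost_decreasing[OF l2(1) l1(1)] l1 l2 unfolding g_def by (cases l1 l2 rule: linorder_cases) auto
  then obtain l where l: "l1 \<le> l" "l \<le> l2" "g l = v"
    using IVT2'[of g l2 v l1] l1 l2 continuous_on_cost[OF l1(1) l2(1)] unfolding g_def by auto
  have lB: "l \<in> marginal_range U a"
    by (rule disjE[OF marginal_range_cases[OF adm]]) (use l1 l in auto)
  show ?thesis
  proof (rule ex1I[of _ l])
    show "l \<in> marginal_range U a \<and> has_bochner_integral M (\<lambda>\<omega>. inverse_marginal U a (l * \<zeta> \<omega>) * \<zeta> \<omega>) v"
      using lB iff l by simp
    fix k assume "k \<in> marginal_range U a \<and> has_bochner_integral M (\<lambda>\<omega>. inverse_marginal U a (k * \<zeta> \<omega>) * \<zeta> \<omega>) v"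
    then have k: "k \<in> marginal_range U a" "g k = v" using iff by auto
    then show "k = l"
      using cost_decreasing[OF k(1) lB] cost_decreasing[OF lB k(1)] l(3) unfolding g_def
      by (cases k l rule: linorder_cases) auto
  qed
qed

text \<open>
  The function \<open>k\<close> below is the tangent to \<open>U\<close> at the candidate, evaluated at the competitor. Its slope
  is proportional to the density, hence it has the same expectation as the utility of the
  candidate for every competitor that satisfies the budget constraint.
\<close>

lemma optimal_payoff:
  assumes v: "v \<in> utility_domain a"
    and lam: "lam \<in> marginal_range U a"
    and budget: "has_bochner_integral M (\<lambda>\<omega>. inverse_marginal U a (lam * \<zeta> \<omega>) * \<zeta> \<omega>) v"
  defines "X \<equiv> \<lambda>\<omega>. inverse_marginal U a (lam * \<zeta> \<omega>)"
  shows "is_utility_maximizer M U \<zeta> v X"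
    and "is_utility_maximizer M U \<zeta> v Y \<Longrightarrow> AE \<omega> in M. Y \<omega> = X \<omega>"
proof -
  interpret prob_space M by (rule prob)
  have Xm[measurable]: "X \<in> borel_measurable M" unfolding X_def by (rule measurable_optimal_payoff[OF lam])
  have [measurable]: "U \<in> borel_measurable borel" by (rule borel_measurable_utility[OF adm])
  define f where "f = (\<lambda>x. real_of_ereal (U x))"
  have XA: "X \<omega> \<in> utility_domain a" "marginal_utility U (X \<omega>) = lam * \<zeta> \<omega>" if "\<omega> \<in> space M" for \<omega>
    using inverse_marginal_in_domain[OF adm] marginal_utility_inverse_marginal[OF adm]
      marginal_range_scale[OF adm lam pos[OF that]] by (auto simp: X_def)
  have fX: "U (X \<omega>) = ereal (f (X \<omega>))" if "\<omega> \<in> space M" for \<omega>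
    using utility_finite_on_domain[OF adm XA(1)[OF that]] by (simp add: f_def)
  have XB: "X \<in> budget_set M \<zeta> v"
    using budget integrable_optimal_payoff(2)[OF lam] Xm
    by (simp add: budget_set_def X_def mult.commute)
  note int\<zeta> = integrable_density
  have int\<zeta>X: "integrable M (\<lambda>\<omega>. \<zeta> \<omega> * X \<omega>)"
    using XB by (auto simp: budget_set_def has_bochner_integral_iff)
  have [measurable]: "(\<lambda>\<omega>. f (X \<omega>)) \<in> borel_measurable M" unfolding f_def by measurable
  have fv: "U v = ereal (f v)" using utility_finite_on_domain[OF adm v] by (simp add: f_def)
  \<comment> \<open>the tangent at v bounds the utility of the candidate from above, the tangent at the
    candidate, evaluated at v, bounds it from below\<close>
  have intf: "integrable M (\<lambda>\<omega>. f (X \<omega>))"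
  proof (rule Bochner_Integration.integrable_bound)
    show "integrable M (\<lambda>\<omega>. \<bar>f v\<bar> + \<bar>lam * (v * \<zeta> \<omega> - \<zeta> \<omega> * X \<omega>)\<bar> + \<bar>marginal_utility U v * (X \<omega> - v)\<bar>)"
      using int\<zeta> int\<zeta>X square_integrable_imp_integrable[OF Xm] XB
      by (intro Bochner_Integration.integrable_add integrable_abs integrable_mult_right
          Bochner_Integration.integrable_diff) (auto simp: budget_set_def)
    show "AE \<omega> in M. norm (f (X \<omega>)) \<le>
        norm (\<bar>f v\<bar> + \<bar>lam * (v * \<zeta> \<omega> - \<zeta> \<omega> * X \<omega>)\<bar> + \<bar>marginal_utility U v * (X \<omega> - v)\<bar>)"
    proof (rule AE_I2)
      fix \<omega> assume w: "\<omega> \<in> space M"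
      have "f (X \<omega>) \<le> f v + marginal_utility U v * (X \<omega> - v)"
        using utility_below_tangent[OF adm v, of "X \<omega>"]
        unfolding fX[OF w] f_def[symmetric] by (simp add: f_def)
      moreover have "f v \<le> f (X \<omega>) + lam * \<zeta> \<omega> * (v - X \<omega>)"
        using utility_below_tangent[OF adm XA(1)[OF w], of v]
        unfolding fv XA(2)[OF w] by (simp add: f_def)
      moreover have "lam * \<zeta> \<omega> * (v - X \<omega>) = lam * (v * \<zeta> \<omega> - \<zeta> \<omega> * X \<omega>)"
        by (simp add: algebra_simps)
      ultimately show "norm (f (X \<omega>)) \<le>
        norm (\<bar>f v\<bar> + \<bar>lam * (v * \<zeta> \<omega> - \<zeta> \<omega> * X \<omega>)\<bar> + \<bar>marginal_utility U v * (X \<omega> - v)\<bar>)"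
        unfolding real_norm_def by linarith
    qed
  qed measurable
  have EX: "ereal_expectation M (\<lambda>\<omega>. U (X \<omega>)) = ereal (\<integral>\<omega>. f (X \<omega>) \<partial>M)"
    by (rule ereal_expectation_of_real[OF intf fX])
  have main: "ereal_expectation M (\<lambda>\<omega>. U (Y \<omega>)) \<le> ereal (\<integral>\<omega>. f (X \<omega>) \<partial>M) \<and>
      (ereal_expectation M (\<lambda>\<omega>. U (Y \<omega>)) = ereal (\<integral>\<omega>. f (X \<omega>) \<partial>M) \<longrightarrow> (AE \<omega> in M. Y \<omega> = X \<omega>))"
    if Y: "Y \<in> budget_set M \<zeta> v" for Y
  proof -
    have [measurable]: "Y \<in> borel_measurable M" using Y by (simp add: budget_set_def)
    define k where "k = (\<lambda>\<omega>. f (X \<omega>) + lam * (\<zeta> \<omega> * Y \<omega> - \<zeta> \<omega> * X \<omega>))"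
    have intY: "integrable M (\<lambda>\<omega>. \<zeta> \<omega> * Y \<omega>)" "(\<integral>\<omega>. \<zeta> \<omega> * Y \<omega> \<partial>M) = (\<integral>\<omega>. \<zeta> \<omega> * X \<omega> \<partial>M)"
      using Y XB by (auto simp: budget_set_def has_bochner_integral_iff)
    have k: "integrable M k" "(\<integral>\<omega>. k \<omega> \<partial>M) = (\<integral>\<omega>. f (X \<omega>) \<partial>M)"
      unfolding k_def using intf int\<zeta>X intY by auto
    have tangent: "k \<omega> = f (X \<omega>) + marginal_utility U (X \<omega>) * (Y \<omega> - X \<omega>)" if "\<omega> \<in> space M" for \<omega>
      using XA(2)[OF that] by (simp add: k_def algebra_simps)
    have le: "U (Y \<omega>) \<le> ereal (k \<omega>)" if "\<omega> \<in> space M" for \<omega>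
      using utility_below_tangent[OF adm XA(1)[OF that]] unfolding tangent[OF that] f_def .
    have UY: "(\<lambda>\<omega>. U (Y \<omega>)) \<in> borel_measurable M" by measurable
    have "AE \<omega> in M. Y \<omega> = X \<omega>" if "ereal_expectation M (\<lambda>\<omega>. U (Y \<omega>)) = ereal (\<integral>\<omega>. f (X \<omega>) \<partial>M)"
    proof -
      have "AE \<omega> in M. U (Y \<omega>) = ereal (k \<omega>)"
        using ereal_expectation_le(2)[OF UY k(1) le] that k(2) by simp
      then show ?thesis
      proof (rule AE_mp, intro AE_I2 impI)
        fix \<omega> assume w: "\<omega> \<in> space M" and "U (Y \<omega>) = ereal (k \<omega>)"
        then show "Y \<omega> = X \<omega>"
          using utility_eq_tangent_imp_eq[OF adm XA(1)[OF w], of "Y \<omega>"] tangent[OF w] by (simp add: f_def)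
      qed
    qed
    then show ?thesis using ereal_expectation_le(1)[OF UY k(1) le] k(2) by simp
  qed
  show "is_utility_maximizer M U \<zeta> v X"
    using main XB EX by (simp add: is_utility_maximizer_def)
  assume "is_utility_maximizer M U \<zeta> v Y"
  then have "Y \<in> budget_set M \<zeta> v" "ereal (\<integral>\<omega>. f (X \<omega>) \<partial>M) \<le> ereal_expectation M (\<lambda>\<omega>. U (Y \<omega>))"
    using XB EX by (auto simp: is_utility_maximizer_def)
  then show "AE \<omega> in M. Y \<omega> = X \<omega>"
    using main[of Y] by (auto intro: antisym)
qed

end

section \<open>Independence of Brownian increments from the past\<close>

locale brownian_space =
  fixes M :: "'a measure" and T :: real and I :: "nat set" and W :: "nat \<Rightarrow> real \<Rightarrow> 'a \<Rightarrow> real"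
  assumes setting: "brownian_setting M T I W"

sublocale brownian_space \<subseteq> prob_space M
  using setting by (simp add: brownian_setting_def)

context brownian_space
begin

abbreviation F where "F \<equiv> brownian_filtration M T I W"

lemma brownian_settingD:
  shows "0 < T"
    and "i \<in> I \<Longrightarrow> standard_brownian_motion M T F (W i)"
    and "prob_space.indep_vars M (\<lambda>_. PiM {0..T} (\<lambda>_. borel)) (\<lambda>i \<omega>. \<lambda>t\<in>{0..T}. W i t \<omega>) I"
    and "sets M = sets (F T)"
  using setting unfolding brownian_setting_def by auto

lemma space_F [simp]: "space (F t) = space M"
  by (simp add: brownian_filtration_def space_measure_of_conv)

lemma sets_F: "sets (F t) = sigma_sets (space M)
     ({W i s -` B \<inter> space M | i s B. i \<in> I \<and> 0 \<le> s \<and> s \<le> t \<and> s \<le> T \<and> B \<in> sets borel}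
      \<union> null_sets M)"
  unfolding brownian_filtration_def
  by (rule sets_measure_of) (auto dest: sets.sets_into_space)

lemma sets_F_mono: "s \<le> t \<Longrightarrow> sets (F s) \<subseteq> sets (F t)"
  unfolding sets_F by (rule sigma_sets_mono') force

lemma sets_F_subset: 
  assumes "t \<le> T" shows "sets (F t) \<subseteq> sets M"
  using sets_F_mono[OF assms] brownian_settingD(4) by simp

lemma measurable_F_mono:
  assumes "f \<in> measurable (F s) N" "s \<le> t"
  shows "f \<in> measurable (F t) N"
  using assms(1) by (rule measurable_mono[THEN subsetD, rotated -1]) (use sets_F_mono[OF assms(2)] in auto)

lemma measurable_F_imp:
  assumes "f \<in> measurable (F s) N" "s \<le> T"
  shows "f \<in> measurable M N"
  using assms(1) by (rule measurable_mono[THEN subsetD, rotated -1]) (use sets_F_subset[OF assms(2)] in auto)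

lemma brownian_adapted: "i \<in> I \<Longrightarrow> 0 \<le> t \<Longrightarrow> t \<le> T \<Longrightarrow> W i t \<in> borel_measurable (F t)"
  using brownian_settingD(2) unfolding standard_brownian_motion_def by auto

lemma brownian_measurable: "i \<in> I \<Longrightarrow> 0 \<le> t \<Longrightarrow> t \<le> T \<Longrightarrow> W i t \<in> borel_measurable M"
  by (rule measurable_F_imp[OF brownian_adapted])

lemma brownian_increment:
  assumes "i \<in> I" "0 \<le> s" "s < t" "t \<le> T"
  shows "distributed M lborel (\<lambda>\<omega>. W i t \<omega> - W i s \<omega>) (normal_density 0 (sqrt (t - s)))"
    and "indep_set (sets (F s)) (sets (vimage_algebra (space M) (\<lambda>\<omega>. W i t \<omega> - W i s \<omega>) borel))"
  using brownian_settingD(2)[OF assms(1)] assms unfolding standard_brownian_motion_def by auto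

text \<open>
  The independent building blocks for the time interval from \<open>s\<close> to \<open>t\<close>: the past of each Brownian
  motion and its increment. The null sets, by which the filtration is augmented, are treated as one more
  block, with index \<open>None\<close>; they are independent of everything.
\<close>

definition pieces :: "real \<Rightarrow> real \<Rightarrow> (nat \<times> bool) option \<Rightarrow> 'a set set" where
  "pieces s t k = (case k of None \<Rightarrow> null_sets M
     | Some (i, True) \<Rightarrow> sigma_sets (space M) {W i u -` B \<inter> space M | u B. 0 \<le> u \<and> u \<le> s \<and> B \<in> sets borel}
     | Some (i, False) \<Rightarrow> sets (vimage_algebra (space M) (\<lambda>\<omega>. W i t \<omega> - W i s \<omega>) borel))"

lemma pieces_simps [simp]:
  "pieces s t None = null_sets M"
  "pieces s t (Some (i, True)) = sigma_sets (space M) {W i u -` B \<inter> space M | u B. 0 \<le> u \<and> u \<le> s \<and> B \<in> sets borel}"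
  "pieces s t (Some (i, False)) = sets (vimage_algebra (space M) (\<lambda>\<omega>. W i t \<omega> - W i s \<omega>) borel)"
  by (simp_all add: pieces_def)

lemma pieces_past_subset:
  assumes "i \<in> I" "s \<le> T"
  shows "pieces s t (Some (i, True)) \<subseteq> sets (F s)"
proof -
  have "{W i u -` B \<inter> space M | u B. 0 \<le> u \<and> u \<le> s \<and> B \<in> sets borel} \<subseteq> sets (F s)"
  proof safe
    fix u and B :: "real set" assume "0 \<le> u" "u \<le> s" "B \<in> sets borel"
    then show "W i u -` B \<inter> space M \<in> sets (F s)"
      unfolding sets_F using assms order.trans[of u s T] by (intro sigma_sets.Basic UnI1) blast
  qed
  then show ?thesis using sets.sigma_sets_subset[of _ "F s"] by simp
qed

text \<open>
  This is what allows blocks to be collected into one past \<open>\<sigma>\<close>-algebra while keeping independence.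
\<close>

lemma pieces_Int_stable: "Int_stable (pieces s t k)"
proof (cases k)
  case None
  then show ?thesis by (auto simp: Int_stable_def intro: null_set_Int1)
next
  case (Some p)
  then obtain i b where k: "k = Some (i, b)" by (cases p) auto
  show ?thesis
  proof (cases b)
    case True
    have "sigma_algebra (space M) (sigma_sets (space M) {W i u -` B \<inter> space M | u B. 0 \<le> u \<and> u \<le> s \<and> B \<in> sets borel})"
      by (rule sigma_algebra_sigma_sets) auto
    then interpret S: sigma_algebra "space M" "pieces s t k" using k True by simp
    show ?thesis by (auto simp: Int_stable_def)
  next
    case False
    then show ?thesis using k by (auto simp: Int_stable_def)
  qed
qed

text \<open>
  Different Brownian motions are independent as processes, and the increment of a single one is
  independent of its own past. The probability of a finite intersection therefore factorises over the
  motions, and then within each motion into past and increment.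
\<close>

lemma indep_pieces:
  assumes st: "0 \<le> s" "s < t" "t \<le> T"
  shows "indep_sets (pieces s t) (insert None (Some ` (I \<times> UNIV)))"
proof -
  define P where "P = (\<lambda>i \<omega>. \<lambda>u\<in>{0..T}. W i u \<omega>)"
  define V where "V = (\<lambda>i. vimage_algebra (space M) (P i) (PiM {0..T} (\<lambda>_. borel)))"
  have Psp: "P i \<in> space M \<rightarrow> space (PiM {0..T} (\<lambda>_. borel))" for i
    by (auto simp: P_def space_PiM)
  have sV: "sets (V i) = {P i -` A \<inter> space M | A. A \<in> sets (PiM {0..T} (\<lambda>_. borel))}" for i
    unfolding V_def by (rule sets_vimage_algebra2[OF Psp])
  have indV: "indep_sets (\<lambda>i. sets (V i)) I"
    using brownian_settingD(3) unfolding indep_vars_def2 sV P_def by simp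
  have [simp]: "space (V i) = space M" for i by (simp add: V_def)
  have WV: "W i u \<in> borel_measurable (V i)" if "0 \<le> u" "u \<le> T" for i u
  proof -
    have "(\<lambda>\<omega>. P i \<omega> u) \<in> borel_measurable (V i)"
      unfolding V_def using that
      by (intro measurable_compose[OF measurable_vimage_algebra1[OF Psp] measurable_component_singleton]) auto
    then show ?thesis using that by (simp add: P_def)
  qed
  have past: "pieces s t (Some (i, True)) \<subseteq> sets (V i)" for i
  proof -
    have "{W i u -` B \<inter> space M | u B. 0 \<le> u \<and> u \<le> s \<and> B \<in> sets borel} \<subseteq> sets (V i)"
      using measurable_sets[OF WV, of _ _ i] st by fastforce
    then show ?thesis using sets.sigma_sets_subset[of _ "V i"] by simp
  qed
  have incr: "pieces s t (Some (i, False)) \<subseteq> sets (V i)" for i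
  proof -
    have m: "(\<lambda>\<omega>. W i t \<omega> - W i s \<omega>) \<in> borel_measurable (V i)"
      using WV st by (intro borel_measurable_diff) auto
    show ?thesis
      unfolding pieces_simps by (subst sets_vimage_algebra2) (use measurable_sets[OF m] in auto)
  qed
  have ev: "pieces s t k \<subseteq> events" if "k \<in> insert None (Some ` (I \<times> UNIV))" for k
  proof -
    have VM: "sets (V i) \<subseteq> events" if "i \<in> I" for i using indV that by (auto simp: indep_sets_def)
    show ?thesis
    proof (cases k)
      case None
      then show ?thesis by (simp add: null_setsD2 subsetI)
    next
      case (Some p)
      obtain i b where p: "p = (i, b)" by (cases p)
      then have i: "i \<in> I" using that Some by auto
      show ?thesis
        unfolding Some p using order_trans[OF past VM[OF i]] order_trans[OF incr VM[OF i]]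
        by (cases b) metis+
    qed
  qed
  show ?thesis
  proof (rule indep_setsI[OF ev])
    fix A J assume J: "J \<noteq> {}" "J \<subseteq> insert None (Some ` (I \<times> UNIV))" "finite J"
      and A: "\<forall>j\<in>J. A j \<in> pieces s t j"
    show "prob (\<Inter>j\<in>J. A j) = (\<Prod>j\<in>J. prob (A j))"
    proof (cases "None \<in> J")
      case True
      \<comment> \<open>both sides vanish when one of the events is null\<close>
      then have N: "A None \<in> null_sets M" using A by force
      have "A j \<in> events" if "j \<in> J" for j using A J ev that by (meson subsetD)
      then have "(\<Inter>j\<in>J. A j) \<in> events" using J by (intro sets.finite_INT) auto
      then have "(\<Inter>j\<in>J. A j) \<in> null_sets M"
        using True by (intro null_sets_subset[OF N]) auto
      then have "prob (\<Inter>j\<in>J. A j) = 0" by (auto simp: measure_eq_0_null_sets)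
      moreover have "(\<Prod>j\<in>J. prob (A j)) = 0"
        using True J N by (intro prod_zero) (auto intro!: bexI[of _ None] simp: measure_eq_0_null_sets)
      ultimately show ?thesis by simp
    next
      case False
      define J1 where "J1 = {i. \<exists>b. Some (i, b) \<in> J}"
      \<comment> \<open>every motion that occurs is given both a past event and an increment event,
        the missing one being the whole space\<close>
      define A' where "A' = (\<lambda>i b. if Some (i, b) \<in> J then A (Some (i, b)) else space M)"
      have J1: "finite J1" "J1 \<noteq> {}" "J1 \<subseteq> I"
      proof -
        have "J1 \<subseteq> (\<lambda>k. fst (the k)) ` J" unfolding J1_def by force
        then show "finite J1" using J(3) by (rule finite_subset[OF _ finite_imageI])
        obtain k where "k \<in> J" using J by auto
        then obtain i b where "Some (i, b) \<in> J" using False by (cases k) auto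
        then show "J1 \<noteq> {}" by (auto simp: J1_def)
        show "J1 \<subseteq> I" using J by (auto simp: J1_def)
      qed
      have A'T: "A' i True \<in> pieces s t (Some (i, True))" for i
      proof (cases "Some (i, True) \<in> J")
        case True
        then show ?thesis using A unfolding A'_def by (metis (full_types))
      qed (simp add: A'_def sigma_sets_top)
      have A'F: "A' i False \<in> pieces s t (Some (i, False))" for i
      proof (cases "Some (i, False) \<in> J")
        case True
        then show ?thesis using A unfolding A'_def by (metis (full_types))
      next
        case False
        then show ?thesis
          using sets.top[of "vimage_algebra (space M) (\<lambda>\<omega>. W i t \<omega> - W i s \<omega>) borel"]
          by (simp add: A'_def)
      qed
      have sub: "A j \<subseteq> space M" if "j \<in> J" for j
        using ev A that J sets.sets_into_space by (meson subsetD)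
      have "(\<Inter>j\<in>J. A j) = (\<Inter>i\<in>J1. A' i True \<inter> A' i False)"
      proof (intro equalityI subsetI)
        fix x assume x: "x \<in> (\<Inter>j\<in>J. A j)"
        then have "x \<in> space M" using sub J(1) by blast
        then show "x \<in> (\<Inter>i\<in>J1. A' i True \<inter> A' i False)" using x by (auto simp: A'_def)
      next
        fix x assume x: "x \<in> (\<Inter>i\<in>J1. A' i True \<inter> A' i False)"
        show "x \<in> (\<Inter>j\<in>J. A j)"
        proof
          fix j assume j: "j \<in> J"
          then obtain i b where ib: "j = Some (i, b)" using False by (cases j) auto
          then have "i \<in> J1" using j by (auto simp: J1_def)
          then have "x \<in> A' i b" using x by (cases b) auto
          then show "x \<in> A j" using j ib by (simp add: A'_def)
        qed
      qed
      also have "prob \<dots> = (\<Prod>i\<in>J1. prob (A' i True \<inter> A' i False))"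
        using sets.Int[OF subsetD[OF past A'T] subsetD[OF incr A'F]] J1
        by (intro indep_setsD[OF indV]) auto
      also have "\<dots> = (\<Prod>i\<in>J1. prob (A' i True) * prob (A' i False))"
      proof (rule prod.cong[OF refl])
        fix i assume "i \<in> J1"
        then have i: "i \<in> I" using J1 by auto
        show "prob (A' i True \<inter> A' i False) = prob (A' i True) * prob (A' i False)"
          using A'T[of i] A'F[of i] pieces_past_subset[OF i, of s t] st
          by (intro indep_setD[OF brownian_increment(2)[OF i st]]) auto
      qed
      also have "\<dots> = (\<Prod>i\<in>J1. \<Prod>b\<in>UNIV. prob (A' i b))"
        by (simp add: UNIV_bool mult.commute)
      also have "\<dots> = (\<Prod>(i, b)\<in>J1 \<times> UNIV. prob (A' i b))"
        using J1 by (subst prod.cartesian_product) auto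
      also have "\<dots> = (\<Prod>(i, b)\<in>{(i, b). Some (i, b) \<in> J}. prob (A' i b))"
        using J1 by (intro prod.mono_neutral_right) (auto simp: J1_def A'_def prob_space)
      also have "\<dots> = (\<Prod>j\<in>J. prob (A j))"
      proof (rule prod.reindex_bij_witness[of _ the Some])
        fix j assume "j \<in> J"
        then show "Some (the j) = j" "the j \<in> {(i, b). Some (i, b) \<in> J}" using False by (cases j; auto)+
      qed (auto simp: A'_def)
      finally show ?thesis .
    qed
  qed
qed

lemma
  assumes st: "0 \<le> s" "s < t" "t \<le> T" and A: "A \<subseteq> I" "finite A"
  defines "\<Delta> \<equiv> \<lambda>i \<omega>. W i t \<omega> - W i s \<omega>"
  shows increments_indep_past:
      "indep_set (sets (F s)) (sets (vimage_algebra (space M) (\<lambda>\<omega>. \<lambda>i\<in>A. \<Delta> i \<omega>) (PiM A (\<lambda>_. borel))))"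
    and increments_indep: "indep_vars (\<lambda>_. borel) \<Delta> A"
proof -
  define K where "K = case_bool (insert None (Some ` (I \<times> {True}))) (Some ` (A \<times> {False}))"
  have \<Delta>m: "\<Delta> i \<in> borel_measurable M" if "i \<in> A" for i
    unfolding \<Delta>_def using brownian_measurable that A st by (intro borel_measurable_diff) auto
  have vim: "sets (vimage_algebra (space M) (\<Delta> i) borel) = {\<Delta> i -` B \<inter> space M |B. B \<in> sets borel}" for i
    by (rule sets_vimage_algebra2) auto
  have "indep_sets (\<lambda>j. sigma_sets (space M) (\<Union>k\<in>K j. pieces s t k)) UNIV"
  proof (rule indep_sets_collect_sigma)
    show "indep_sets (pieces s t) (\<Union>j\<in>UNIV. K j)"
      using A by (intro indep_sets_mono_index[OF _ indep_pieces[OF st]]) (auto simp: K_def UNIV_bool)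
    show "disjoint_family K"
      by (auto simp: disjoint_family_on_def K_def split: bool.split)
  qed (rule pieces_Int_stable)
  also have "(\<lambda>j. sigma_sets (space M) (\<Union>k\<in>K j. pieces s t k)) =
      case_bool (sigma_sets (space M) (\<Union>k\<in>K True. pieces s t k)) (sigma_sets (space M) (\<Union>k\<in>K False. pieces s t k))"
    by (intro ext) (simp split: bool.split)
  finally have ind: "indep_set (sigma_sets (space M) (\<Union>k\<in>K True. pieces s t k))
      (sigma_sets (space M) (\<Union>k\<in>K False. pieces s t k))"
    by (simp add: indep_set_def)
  have F: "sets (F s) \<subseteq> sigma_sets (space M) (\<Union>k\<in>K True. pieces s t k)"
    unfolding sets_F
  proof (rule sigma_sets_mono, rule Un_least)
    show "null_sets M \<subseteq> sigma_sets (space M) (\<Union>k\<in>K True. pieces s t k)"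
      by (auto simp: K_def intro!: sigma_sets.Basic)
    show "{W i u -` B \<inter> space M |i u B. i \<in> I \<and> 0 \<le> u \<and> u \<le> s \<and> u \<le> T \<and> B \<in> sets borel}
        \<subseteq> sigma_sets (space M) (\<Union>k\<in>K True. pieces s t k)"
    proof safe
      fix i u and B :: "real set" assume "i \<in> I" "0 \<le> u" "u \<le> s" "B \<in> sets borel"
      then have "W i u -` B \<inter> space M \<in> pieces s t (Some (i, True))" "Some (i, True) \<in> K True"
        by (auto simp: K_def)
      then show "W i u -` B \<inter> space M \<in> sigma_sets (space M) (\<Union>k\<in>K True. pieces s t k)"
        by (intro sigma_sets.Basic) blast
    qed
  qed
  define N where "N = sigma (space M) (\<Union>k\<in>K False. pieces s t k)"
  have Nsub: "(\<Union>k\<in>K False. pieces s t k) \<subseteq> Pow (space M)"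
    using sets.sets_into_space[of _ "vimage_algebra (space M) (\<lambda>\<omega>. W _ t \<omega> - W _ s \<omega>) borel"]
    by (fastforce simp: K_def)
  have sN: "sets N = sigma_sets (space M) (\<Union>k\<in>K False. pieces s t k)" "space N = space M"
    unfolding N_def using Nsub by (auto simp: space_measure_of_conv)
  have "\<Delta> i \<in> borel_measurable N" if "i \<in> A" for i
  proof (rule measurableI)
    fix B :: "real set" assume "B \<in> sets borel"
    then have "\<Delta> i -` B \<inter> space M \<in> pieces s t (Some (i, False))"
      using vim[of i] by (auto simp: \<Delta>_def)
    moreover have "Some (i, False) \<in> K False" using that by (simp add: K_def)
    ultimately show "\<Delta> i -` B \<inter> space N \<in> sets N" unfolding sN by (intro sigma_sets.Basic) blast
  qed simp
  then have YN: "(\<lambda>\<omega>. \<lambda>i\<in>A. \<Delta> i \<omega>) \<in> measurable N (PiM A (\<lambda>_. borel))"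
    by (rule measurable_restrict)
  have "sets (vimage_algebra (space M) (\<lambda>\<omega>. \<lambda>i\<in>A. \<Delta> i \<omega>) (PiM A (\<lambda>_. borel))) \<subseteq> sets N"
    using measurable_sets[OF YN] by (subst sets_vimage_algebra2) (auto simp: space_PiM sN(2))
  then show "indep_set (sets (F s)) (sets (vimage_algebra (space M) (\<lambda>\<omega>. \<lambda>i\<in>A. \<Delta> i \<omega>) (PiM A (\<lambda>_. borel))))"
    unfolding indep_set_def
    by (intro indep_sets_mono_sets[OF ind[unfolded indep_set_def]]) (use F in \<open>auto split: bool.split simp: sN(1)\<close>)
  have "indep_sets (pieces s t) (Some ` (A \<times> {False}))"
    using A by (intro indep_sets_mono_index[OF _ indep_pieces[OF st]]) auto
  then have "indep_sets (\<lambda>i. pieces s t (Some (i, False))) A"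
    unfolding indep_sets_def
  proof (elim conjE, intro conjI ballI allI impI)
    fix J B assume all: "\<forall>J\<subseteq>Some ` (A \<times> {False}). J \<noteq> {} \<longrightarrow> finite J \<longrightarrow>
        (\<forall>A\<in>Pi J (pieces s t). prob (\<Inter> (A ` J)) = (\<Prod>j\<in>J. prob (A j)))"
      and J: "J \<subseteq> A" "J \<noteq> {}" "finite J" and B: "B \<in> (\<Pi> i\<in>J. pieces s t (Some (i, False)))"
    let ?g = "\<lambda>i. Some (i, False)" and ?B = "\<lambda>k. B (fst (the k))"
    have "prob (\<Inter> (?B ` ?g ` J)) = (\<Prod>j\<in>?g ` J. prob (?B j))"
      by (rule all[rule_format]) (use J B in auto)
    also have "(\<Prod>j\<in>?g ` J. prob (?B j)) = (\<Prod>j\<in>J. prob (B j))"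
      by (subst prod.reindex) (auto simp: inj_on_def)
    finally show "prob (\<Inter> (B ` J)) = (\<Prod>j\<in>J. prob (B j))" by (simp add: image_comp comp_def)
  qed auto
  then have "indep_sets (\<lambda>i. {\<Delta> i -` B \<inter> space M |B. B \<in> sets borel}) A"
    using vim by (simp add: \<Delta>_def)
  then show "indep_vars (\<lambda>_. borel) \<Delta> A"
    using \<Delta>m by (auto simp: indep_vars_def2)
qed

text \<open>
  Joint independence of all increments from the whole filtration at time \<open>s\<close>, expressed as a product
  measure, so that the increments can be integrated out while the past is kept fixed.
\<close>

lemma distr_past_increments:
  assumes st: "0 \<le> s" "s < t" "t \<le> T" and A: "A \<subseteq> I" "finite A"
  defines "Y \<equiv> \<lambda>\<omega>. \<lambda>i\<in>A. W i t \<omega> - W i s \<omega>"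
  shows "distr M (F s \<Otimes>\<^sub>M PiM A (\<lambda>_. borel)) (\<lambda>\<omega>. (\<omega>, Y \<omega>)) =
    distr M (F s) (\<lambda>\<omega>. \<omega>) \<Otimes>\<^sub>M PiM A (\<lambda>_. density lborel (normal_density 0 (sqrt (t - s))))"
proof -
  let ?N = "density lborel (normal_density 0 (sqrt (t - s)))"
  interpret N: prob_space ?N
    using st by (intro prob_space_normal_density) simp
  interpret NP: product_sigma_finite "\<lambda>_::nat. ?N" ..
  interpret NPA: finite_product_sigma_finite "\<lambda>_::nat. ?N" A by standard (rule A)
  have \<Delta>m: "(\<lambda>\<omega>. W i t \<omega> - W i s \<omega>) \<in> borel_measurable M" if "i \<in> A" for i
    using brownian_measurable that A st by (intro borel_measurable_diff) auto
  have Ym: "Y \<in> measurable M (PiM A (\<lambda>_. borel))"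
    unfolding Y_def using \<Delta>m by (rule measurable_restrict)
  have idm: "(\<lambda>\<omega>. \<omega>) \<in> measurable M (F s)"
    using st by (intro measurable_F_imp[OF measurable_ident_sets[OF refl]]) auto
  have sP: "sets (PiM A (\<lambda>_. ?N)) = sets (PiM A (\<lambda>_. borel :: real measure))"
    by (intro sets_PiM_cong) auto
  have dY: "distr M (PiM A (\<lambda>_. borel)) Y = PiM A (\<lambda>_. ?N)"
  proof (cases "A = {}")
    case True
    have "distr M (PiM {} (\<lambda>_. borel :: real measure)) Y = PiM {} (\<lambda>_::nat. ?N)"
    proof (rule measure_eqI)
      fix B assume "B \<in> sets (distr M (PiM {} (\<lambda>_. borel :: real measure)) Y)"
      then have "B = {} \<or> B = {\<lambda>_. undefined}" by (auto simp: sets_PiM_empty)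
      moreover have "Y -` {\<lambda>_. undefined} \<inter> space M = space M" using True by (auto simp: Y_def)
      ultimately show "emeasure (distr M (PiM {} (\<lambda>_. borel)) Y) B = emeasure (PiM {} (\<lambda>_. ?N)) B"
        using Ym True by (auto simp: emeasure_distr emeasure_space_1 PiM_empty sets_PiM_empty)
    qed (simp add: sets_PiM_empty)
    then show ?thesis using True by simp
  next
    case False
    have "distr M (PiM A (\<lambda>_. borel)) Y = PiM A (\<lambda>i. distr M borel (\<lambda>\<omega>. W i t \<omega> - W i s \<omega>))"
      unfolding Y_def
      by (subst indep_vars_iff_distr_eq_PiM'[symmetric]) (use False \<Delta>m increments_indep[OF st A] in auto)
    also have "\<dots> = PiM A (\<lambda>_. ?N)"
    proof (rule PiM_cong[OF refl])
      fix i assume "i \<in> A"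
      then have "distributed M lborel (\<lambda>\<omega>. W i t \<omega> - W i s \<omega>) (normal_density 0 (sqrt (t - s)))"
        using brownian_increment(1) st A by auto
      then have "distr M lborel (\<lambda>\<omega>. W i t \<omega> - W i s \<omega>) = ?N"
        by (rule distributed_distr_eq_density)
      then show "distr M borel (\<lambda>\<omega>. W i t \<omega> - W i s \<omega>) = ?N"
        by (subst distr_cong[of M M borel lborel]) auto
    qed
    finally show ?thesis .
  qed
  show ?thesis
  proof (rule pair_measure_eqI[symmetric])
    show "sigma_finite_measure (distr M (F s) (\<lambda>\<omega>. \<omega>))"
      using prob_space_distr[OF idm] by (simp add: prob_space_imp_sigma_finite)
    show "sigma_finite_measure (PiM A (\<lambda>_. ?N))" by unfold_locales
    show "sets (distr M (F s) (\<lambda>\<omega>. \<omega>) \<Otimes>\<^sub>M PiM A (\<lambda>_. ?N)) =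
        sets (distr M (F s \<Otimes>\<^sub>M PiM A (\<lambda>_. borel)) (\<lambda>\<omega>. (\<omega>, Y \<omega>)))"
      using sP by (simp cong: sets_pair_measure_cong)
    fix G B assume "G \<in> sets (distr M (F s) (\<lambda>\<omega>. \<omega>))" "B \<in> sets (PiM A (\<lambda>_. ?N))"
    then have G: "G \<in> sets (F s)" and B: "B \<in> sets (PiM A (\<lambda>_. borel :: real measure))"
      unfolding sP by auto
    have GM: "G \<in> events" "G \<inter> space M = G" using G sets_F_subset[of s] st sets.sets_into_space by auto
    have YB: "Y -` B \<inter> space M \<in> events" using measurable_sets[OF Ym B] .
    have pm: "(\<lambda>\<omega>. (\<omega>, Y \<omega>)) \<in> measurable M (F s \<Otimes>\<^sub>M PiM A (\<lambda>_. borel))"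
      using idm Ym by simp
    have "emeasure (distr M (F s) (\<lambda>\<omega>. \<omega>)) G * emeasure (PiM A (\<lambda>_. ?N)) B =
        emeasure M G * emeasure M (Y -` B \<inter> space M)"
      unfolding dY[symmetric] using idm Ym G B GM by (simp add: emeasure_distr)
    also have "\<dots> = ennreal (prob G * prob (Y -` B \<inter> space M))"
      by (simp add: emeasure_eq_measure ennreal_mult)
    also have "prob G * prob (Y -` B \<inter> space M) = prob (G \<inter> (Y -` B \<inter> space M))"
      using increments_indep_past[OF st A] G B unfolding Y_def[symmetric]
      by (intro indep_setD[symmetric]) (auto simp: Y_def space_PiM sets_vimage_algebra2)
    also have "G \<inter> (Y -` B \<inter> space M) = (\<lambda>\<omega>. (\<omega>, Y \<omega>)) -` (G \<times> B) \<inter> space M"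
      using GM by auto
    also have "ennreal (prob \<dots>) = emeasure (distr M (F s \<Otimes>\<^sub>M PiM A (\<lambda>_. borel)) (\<lambda>\<omega>. (\<omega>, Y \<omega>))) (G \<times> B)"
      using pm G B by (subst emeasure_distr) (auto simp: emeasure_eq_measure)
    finally show "emeasure (distr M (F s) (\<lambda>\<omega>. \<omega>)) G * emeasure (PiM A (\<lambda>_. ?N)) B =
        emeasure (distr M (F s \<Otimes>\<^sub>M PiM A (\<lambda>_. borel)) (\<lambda>\<omega>. (\<omega>, Y \<omega>))) (G \<times> B)" .
  qed
qed

text \<open>
  The moment generating function of the centred normal distribution of variance \<open>t - s\<close> at \<open>b\<close> is
  \<open>exp (b\<^sup>2 (t - s) / 2)\<close>; equivalently, the exponential factor turns the centred density into the one with
  mean \<open>b (t - s)\<close>. This is applied conditionally on the past, on which the coefficients depend.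
\<close>

lemma exponential_increment:
  assumes st: "0 \<le> s" "s \<le> t" "t \<le> T" and A: "A \<subseteq> I" "finite A"
    and G: "G \<in> borel_measurable (F s)" and c: "\<And>i. i \<in> A \<Longrightarrow> c i \<in> borel_measurable (F s)"
  shows "(\<integral>\<^sup>+\<omega>. G \<omega> * ennreal (exp (\<Sum>i\<in>A. c i \<omega> * (W i t \<omega> - W i s \<omega>) - (c i \<omega>)\<^sup>2 * (t - s) / 2)) \<partial>M)
    = (\<integral>\<^sup>+\<omega>. G \<omega> \<partial>M)"
proof (cases "s = t")
  case False
  then have st': "0 \<le> s" "s < t" "t \<le> T" using st by auto
  define \<sigma> where "\<sigma> = sqrt (t - s)"
  have \<sigma>: "0 < \<sigma>" "\<sigma>\<^sup>2 = t - s" using st' by (auto simp: \<sigma>_def)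
  let ?N = "density lborel (normal_density 0 \<sigma>)"
  interpret N: prob_space ?N
    using \<sigma> by (intro prob_space_normal_density)
  interpret NP: product_sigma_finite "\<lambda>_::nat. ?N" ..
  interpret NPA: finite_product_sigma_finite "\<lambda>_::nat. ?N" A by standard (rule A)
  define Y where "Y = (\<lambda>\<omega>. \<lambda>i\<in>A. W i t \<omega> - W i s \<omega>)"
  define h where "h = (\<lambda>(\<omega>, y). G \<omega> * (\<Prod>i\<in>A. ennreal (exp (c i \<omega> * y i - (c i \<omega>)\<^sup>2 * (t - s) / 2))))"
  have \<Delta>m: "(\<lambda>\<omega>. W i t \<omega> - W i s \<omega>) \<in> borel_measurable M" if "i \<in> A" for i
    using brownian_measurable that A st by (intro borel_measurable_diff) auto
  have Ym: "Y \<in> measurable M (PiM A (\<lambda>_. borel))"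
    unfolding Y_def using \<Delta>m by (rule measurable_restrict)
  have idm: "(\<lambda>\<omega>. \<omega>) \<in> measurable M (F s)"
    using st by (intro measurable_F_imp[OF measurable_ident_sets[OF refl]]) auto
  have pm: "(\<lambda>\<omega>. (\<omega>, Y \<omega>)) \<in> measurable M (F s \<Otimes>\<^sub>M PiM A (\<lambda>_. borel))"
    using idm Ym by simp
  have c': "(\<lambda>x. c i (fst x)) \<in> borel_measurable (F s \<Otimes>\<^sub>M PiM A (\<lambda>_. borel :: real measure))" if "i \<in> A" for i
    by (rule measurable_compose[OF measurable_fst c[OF that]])
  have y': "(\<lambda>x. snd x i) \<in> borel_measurable (F s \<Otimes>\<^sub>M PiM A (\<lambda>_. borel :: real measure))" if "i \<in> A" for i
    by (rule measurable_compose[OF measurable_snd measurable_component_singleton[OF that]])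
  have G': "(\<lambda>x. G (fst x)) \<in> borel_measurable (F s \<Otimes>\<^sub>M PiM A (\<lambda>_. borel :: real measure))"
    by (rule measurable_compose[OF measurable_fst G])
  have hm: "h \<in> borel_measurable (F s \<Otimes>\<^sub>M PiM A (\<lambda>_. borel))"
    unfolding h_def case_prod_beta
    by (intro borel_measurable_times_ennreal borel_measurable_prod_ennreal G' measurable_compose[OF _ measurable_ennreal]
        borel_measurable_exp borel_measurable_diff borel_measurable_times borel_measurable_divide borel_measurable_power
        borel_measurable_const c' y' measurable_compose[OF _ borel_measurable_exp]) auto
  have hm': "h \<in> borel_measurable (distr M (F s) (\<lambda>\<omega>. \<omega>) \<Otimes>\<^sub>M PiM A (\<lambda>_. ?N))"
    using hm by (subst measurable_cong_sets[OF sets_pair_measure_cong[OF sets_distr sets_PiM_cong] refl]) auto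
  have gauss: "(\<integral>\<^sup>+y. ennreal (exp (b * y - b\<^sup>2 * (t - s) / 2)) \<partial>?N) = 1" for b
  proof -
    interpret N': prob_space "density lborel (normal_density (b * \<sigma>\<^sup>2) \<sigma>)"
      using \<sigma> by (intro prob_space_normal_density)
    have "(\<integral>\<^sup>+y. ennreal (exp (b * y - b\<^sup>2 * (t - s) / 2)) \<partial>?N) =
        (\<integral>\<^sup>+y. ennreal (normal_density 0 \<sigma> y) * ennreal (exp (b * y - b\<^sup>2 * (t - s) / 2)) \<partial>lborel)"
      by (rule nn_integral_density) auto
    also have "\<dots> = (\<integral>\<^sup>+y. ennreal (normal_density (b * \<sigma>\<^sup>2) \<sigma> y) \<partial>lborel)"
    proof (intro nn_integral_cong)
      fix y
      have "normal_density 0 \<sigma> y * exp (b * y - b\<^sup>2 * (t - s) / 2) = normal_density (b * \<sigma>\<^sup>2) \<sigma> y"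
        unfolding normal_density_def \<sigma>(2)[symmetric] mult.assoc exp_add[symmetric]
        using \<sigma>(1) by (simp add: field_simps power2_eq_square)
      then show "ennreal (normal_density 0 \<sigma> y) * ennreal (exp (b * y - b\<^sup>2 * (t - s) / 2)) =
          ennreal (normal_density (b * \<sigma>\<^sup>2) \<sigma> y)"
        by (simp add: ennreal_mult[symmetric])
    qed
    also have "\<dots> = 1"
      using N'.emeasure_space_1 by (simp add: emeasure_density)
    finally show ?thesis .
  qed
  have "(\<integral>\<^sup>+\<omega>. G \<omega> * ennreal (exp (\<Sum>i\<in>A. c i \<omega> * (W i t \<omega> - W i s \<omega>) - (c i \<omega>)\<^sup>2 * (t - s) / 2)) \<partial>M)
      = (\<integral>\<^sup>+\<omega>. h (\<omega>, Y \<omega>) \<partial>M)"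
    by (intro nn_integral_cong) (simp add: h_def Y_def exp_sum A prod_ennreal)
  also have "\<dots> = (\<integral>\<^sup>+x. h x \<partial>(distr M (F s) (\<lambda>\<omega>. \<omega>) \<Otimes>\<^sub>M PiM A (\<lambda>_. ?N)))"
    unfolding distr_past_increments[OF st' A, folded \<sigma>_def, symmetric] Y_def[THEN fun_cong, symmetric]
    by (subst nn_integral_distr[OF pm]) (simp_all add: hm)
  also have "\<dots> = (\<integral>\<^sup>+\<omega>. \<integral>\<^sup>+y. h (\<omega>, y) \<partial>PiM A (\<lambda>_. ?N) \<partial>distr M (F s) (\<lambda>\<omega>. \<omega>))"
    by (rule NPA.nn_integral_fst[symmetric, OF hm'])
  also have "\<dots> = (\<integral>\<^sup>+\<omega>. G \<omega> \<partial>distr M (F s) (\<lambda>\<omega>. \<omega>))"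
  proof (intro nn_integral_cong)
    fix \<omega>
    have "(\<integral>\<^sup>+y. h (\<omega>, y) \<partial>PiM A (\<lambda>_. ?N)) =
        G \<omega> * (\<integral>\<^sup>+y. (\<Prod>i\<in>A. ennreal (exp (c i \<omega> * y i - (c i \<omega>)\<^sup>2 * (t - s) / 2))) \<partial>PiM A (\<lambda>_. ?N))"
      unfolding h_def prod.case
      by (intro nn_integral_cmult borel_measurable_prod_ennreal measurable_compose[OF measurable_component_singleton]) auto
    also have "(\<integral>\<^sup>+y. (\<Prod>i\<in>A. ennreal (exp (c i \<omega> * y i - (c i \<omega>)\<^sup>2 * (t - s) / 2))) \<partial>PiM A (\<lambda>_. ?N)) =
        (\<Prod>i\<in>A. \<integral>\<^sup>+y. ennreal (exp (c i \<omega> * y - (c i \<omega>)\<^sup>2 * (t - s) / 2)) \<partial>?N)"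
      by (rule NP.product_nn_integral_prod[OF A(2)]) auto
    also have "\<dots> = 1" by (simp only: gauss prod.neutral_const)
    finally show "(\<integral>\<^sup>+y. h (\<omega>, y) \<partial>PiM A (\<lambda>_. ?N)) = G \<omega>" by simp
  qed
  also have "\<dots> = (\<integral>\<^sup>+\<omega>. G \<omega> \<partial>M)"
    by (subst nn_integral_distr[OF idm]) (simp_all add: G)
  finally show ?thesis .
qed simp

end

section \<open>Exponential pairs\<close>

text \<open>
  In the applications \<open>S\<close> is a stochastic integral and \<open>Q\<close> its quadratic variation. The first clause is
  the supermartingale bound for all multiples of the integrand. The second says that
  \<open>E exp (S - Q / 2)\<close> is at least \<open>1\<close> up to an error that is small when \<open>Q\<close> rarely exceeds \<open>K\<close>. The
  minima are continuous majorants of the indicators of \<open>Q \<le> K\<close> and of \<open>Q > K\<close>; being continuous, they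
  make the estimate stable under convergence of \<open>S\<close> and \<open>Q\<close>.
\<close>

definition exponential_pair :: "'a measure \<Rightarrow> ('a \<Rightarrow> real) \<Rightarrow> ('a \<Rightarrow> real) \<Rightarrow> bool" where
  "exponential_pair M S Q \<longleftrightarrow> S \<in> borel_measurable M \<and> Q \<in> borel_measurable M \<and>
    (\<forall>p. (\<integral>\<^sup>+\<omega>. ennreal (exp (p * S \<omega> - p\<^sup>2 * Q \<omega> / 2)) \<partial>M) \<le> 1) \<and>
    (\<forall>K\<ge>0. 1 \<le> (\<integral>\<^sup>+\<omega>. ennreal (exp (S \<omega> - Q \<omega> / 2) * min 1 (exp (K - Q \<omega>))) \<partial>M) +
       ennreal (exp (- K)) + ennreal (exp (2 * K)) * (\<integral>\<^sup>+\<omega>. ennreal (min 1 (exp (4 * (Q \<omega> - K)))) \<partial>M))"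

text \<open>
  The cut-off is strong enough to compensate the factor \<open>exp Q\<close> by which the square of
  \<open>exp (S - Q / 2)\<close> differs from the supermartingale \<open>exp (2 S - 2 Q)\<close>.
\<close>

lemma exp_mult_min_le: "exp q * (min 1 (exp (K - q)))\<^sup>2 \<le> exp (K::real)"
proof (cases "q \<le> K")
  case True
  then show ?thesis by (simp add: min_absorb1)
next
  case False
  then have "exp q * (min 1 (exp (K - q)))\<^sup>2 = exp (2 * K - q)"
    by (simp add: min_absorb2 exp_double[symmetric] exp_add[symmetric] algebra_simps)
  also have "\<dots> \<le> exp K" using False by simp
  finally show ?thesis .
qed

lemma le_min_add_square: "0 < C \<Longrightarrow> 0 \<le> z \<Longrightarrow> (z::real) \<le> min z C + z\<^sup>2 / C"
proof -
  assume C: "0 < C" "0 \<le> z"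
  show ?thesis
  proof (cases "z \<le> C")
    case False
    then have "z * C \<le> z * z" using C by (intro mult_left_mono) auto
    then have "z \<le> z\<^sup>2 / C" using C by (simp add: field_simps power2_eq_square)
    then show ?thesis using False C by simp
  qed (use C in simp)
qed

text \<open>
  The first clause passes to the limit by Fatou's lemma. In the second, the error terms converge by
  dominated convergence. The main term is bounded in \<open>L\<^sup>2\<close>, by the first clause for \<open>p = 2\<close>, hence
  uniformly integrable, and so no mass is lost.
\<close>

lemma (in prob_space) exponential_pair_limit:
  assumes pairs: "\<And>n. exponential_pair M (S n) (Q n)"
    and lim: "AE \<omega> in M. (\<lambda>n. S n \<omega>) \<longlonglongrightarrow> S' \<omega>" "AE \<omega> in M. (\<lambda>n. Q n \<omega>) \<longlonglongrightarrow> Q' \<omega>"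
    and [measurable]: "S' \<in> borel_measurable M" "Q' \<in> borel_measurable M"
  shows "exponential_pair M S' Q'"
proof -
  have [measurable]: "S n \<in> borel_measurable M" "Q n \<in> borel_measurable M" for n
    using pairs[of n] by (auto simp: exponential_pair_def)
  have P1: "(\<integral>\<^sup>+\<omega>. ennreal (exp (p * S n \<omega> - p\<^sup>2 * Q n \<omega> / 2)) \<partial>M) \<le> 1" for n p
    using pairs[of n] by (auto simp: exponential_pair_def)
  have P2: "1 \<le> (\<integral>\<^sup>+\<omega>. ennreal (exp (S n \<omega> - Q n \<omega> / 2) * min 1 (exp (K - Q n \<omega>))) \<partial>M) +
       ennreal (exp (- K)) + ennreal (exp (2 * K)) * (\<integral>\<^sup>+\<omega>. ennreal (min 1 (exp (4 * (Q n \<omega> - K)))) \<partial>M)"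
    if "0 \<le> K" for n K
    using pairs[of n] that by (auto simp: exponential_pair_def)
  have L1: "(\<integral>\<^sup>+\<omega>. ennreal (exp (p * S' \<omega> - p\<^sup>2 * Q' \<omega> / 2)) \<partial>M) \<le> 1" for p
  proof -
    have "(\<integral>\<^sup>+\<omega>. ennreal (exp (p * S' \<omega> - p\<^sup>2 * Q' \<omega> / 2)) \<partial>M) =
        (\<integral>\<^sup>+\<omega>. liminf (\<lambda>n. ennreal (exp (p * S n \<omega> - p\<^sup>2 * Q n \<omega> / 2))) \<partial>M)"
    proof (rule nn_integral_cong_AE)
      show "AE \<omega> in M. ennreal (exp (p * S' \<omega> - p\<^sup>2 * Q' \<omega> / 2)) =
          liminf (\<lambda>n. ennreal (exp (p * S n \<omega> - p\<^sup>2 * Q n \<omega> / 2)))"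
        using lim
      proof eventually_elim
        case (elim \<omega>)
        then have "(\<lambda>n. ennreal (exp (p * S n \<omega> - p\<^sup>2 * Q n \<omega> / 2))) \<longlonglongrightarrow>
            ennreal (exp (p * S' \<omega> - p\<^sup>2 * Q' \<omega> / 2))"
          by (intro tendsto_intros) auto
        from lim_imp_Liminf[OF trivial_limit_sequentially this] show ?case by (rule sym)
      qed
    qed
    also have "\<dots> \<le> liminf (\<lambda>n. \<integral>\<^sup>+\<omega>. ennreal (exp (p * S n \<omega> - p\<^sup>2 * Q n \<omega> / 2)) \<partial>M)"
      by (rule nn_integral_liminf) measurable
    also have "\<dots> \<le> liminf (\<lambda>n. 1)"
      by (rule Liminf_mono) (simp add: P1)
    finally show ?thesis by (simp add: Liminf_const)
  qed
  have L2: "1 \<le> (\<integral>\<^sup>+\<omega>. ennreal (exp (S' \<omega> - Q' \<omega> / 2) * min 1 (exp (K - Q' \<omega>))) \<partial>M) +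
       ennreal (exp (- K)) + ennreal (exp (2 * K)) * (\<integral>\<^sup>+\<omega>. ennreal (min 1 (exp (4 * (Q' \<omega> - K)))) \<partial>M)"
    if K: "0 \<le> K" for K
  proof -
    define Z where "Z = (\<lambda>n \<omega>. exp (S n \<omega> - Q n \<omega> / 2) * min 1 (exp (K - Q n \<omega>)))"
    define Z' where "Z' = (\<lambda>\<omega>. exp (S' \<omega> - Q' \<omega> / 2) * min 1 (exp (K - Q' \<omega>)))"
    define \<psi> where "\<psi> = (\<lambda>n \<omega>. min 1 (exp (4 * (Q n \<omega> - K))))"
    define \<psi>' where "\<psi>' = (\<lambda>\<omega>. min 1 (exp (4 * (Q' \<omega> - K))))"
    have [measurable]: "Z n \<in> borel_measurable M" "Z' \<in> borel_measurable M"
      "\<psi> n \<in> borel_measurable M" "\<psi>' \<in> borel_measurable M" for n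
      unfolding Z_def Z'_def \<psi>_def \<psi>'_def by measurable
    have Z0: "0 \<le> Z n \<omega>" "0 \<le> Z' \<omega>" for n \<omega> by (auto simp: Z_def Z'_def)
    have Zlim: "AE \<omega> in M. (\<lambda>n. Z n \<omega>) \<longlonglongrightarrow> Z' \<omega>"
      using lim by eventually_elim (auto simp: Z_def Z'_def intro!: tendsto_intros)
    have \<psi>lim: "AE \<omega> in M. (\<lambda>n. \<psi> n \<omega>) \<longlonglongrightarrow> \<psi>' \<omega>"
      using lim by eventually_elim (auto simp: \<psi>_def \<psi>'_def intro!: tendsto_intros)
    have Z2: "(\<integral>\<^sup>+\<omega>. ennreal ((Z n \<omega>)\<^sup>2) \<partial>M) \<le> ennreal (exp K)" for n
    proof -
      have "(\<integral>\<^sup>+\<omega>. ennreal ((Z n \<omega>)\<^sup>2) \<partial>M) \<le>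
          (\<integral>\<^sup>+\<omega>. ennreal (exp K) * ennreal (exp (2 * S n \<omega> - 2\<^sup>2 * Q n \<omega> / 2)) \<partial>M)"
      proof (intro nn_integral_mono)
        fix \<omega>
        have "(Z n \<omega>)\<^sup>2 = exp (2 * S n \<omega> - 2\<^sup>2 * Q n \<omega> / 2) * (exp (Q n \<omega>) * (min 1 (exp (K - Q n \<omega>)))\<^sup>2)"
          unfolding Z_def power_mult_distrib exp_double[symmetric] mult.assoc[symmetric] exp_add[symmetric]
          by (simp add: algebra_simps)
        also have "\<dots> \<le> exp (2 * S n \<omega> - 2\<^sup>2 * Q n \<omega> / 2) * exp K"
          by (intro mult_left_mono exp_mult_min_le) simp
        finally show "ennreal ((Z n \<omega>)\<^sup>2) \<le> ennreal (exp K) * ennreal (exp (2 * S n \<omega> - 2\<^sup>2 * Q n \<omega> / 2))"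
          by (simp add: ennreal_mult[symmetric] ennreal_leI mult.commute)
      qed
      also have "\<dots> = ennreal (exp K) * (\<integral>\<^sup>+\<omega>. ennreal (exp (2 * S n \<omega> - 2\<^sup>2 * Q n \<omega> / 2)) \<partial>M)"
        by (rule nn_integral_cmult) measurable
      also have "\<dots> \<le> ennreal (exp K) * 1"
        by (intro mult_left_mono P1) simp
      finally show ?thesis by simp
    qed
    have \<psi>int: "(\<lambda>n. \<integral>\<^sup>+\<omega>. ennreal (\<psi> n \<omega>) \<partial>M) \<longlonglongrightarrow> (\<integral>\<^sup>+\<omega>. ennreal (\<psi>' \<omega>) \<partial>M)"
    proof (rule nn_integral_dominated_convergence[where w="\<lambda>_. 1"])
      show "AE \<omega> in M. (\<lambda>n. ennreal (\<psi> n \<omega>)) \<longlonglongrightarrow> ennreal (\<psi>' \<omega>)"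
        using \<psi>lim by eventually_elim (rule tendsto_ennrealI)
      show "AE \<omega> in M. ennreal (\<psi> n \<omega>) \<le> 1" for n
        by (auto simp: \<psi>_def ennreal_le_1)
    qed (auto simp: emeasure_space_1)
    \<comment> \<open>truncation of the main term at a level C, at the expense of an error controlled by the
      second moment\<close>
    have main: "1 \<le> (\<integral>\<^sup>+\<omega>. ennreal (Z' \<omega>) \<partial>M) + ennreal (exp K / C) + ennreal (exp (- K)) +
        ennreal (exp (2 * K)) * (\<integral>\<^sup>+\<omega>. ennreal (\<psi>' \<omega>) \<partial>M)" if C: "0 < C" for C
    proof -
      have Cint: "(\<lambda>n. \<integral>\<^sup>+\<omega>. ennreal (min (Z n \<omega>) C) \<partial>M) \<longlonglongrightarrow> (\<integral>\<^sup>+\<omega>. ennreal (min (Z' \<omega>) C) \<partial>M)"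
      proof (rule nn_integral_dominated_convergence[where w="\<lambda>_. ennreal C"])
        show "AE \<omega> in M. (\<lambda>n. ennreal (min (Z n \<omega>) C)) \<longlonglongrightarrow> ennreal (min (Z' \<omega>) C)"
          using Zlim by eventually_elim (auto intro!: tendsto_intros)
        show "AE \<omega> in M. ennreal (min (Z n \<omega>) C) \<le> ennreal C" for n
          by (auto intro!: ennreal_leI)
      qed (auto simp: emeasure_space_1)
      have "1 \<le> (\<integral>\<^sup>+\<omega>. ennreal (min (Z n \<omega>) C) \<partial>M) + ennreal (exp K / C) + ennreal (exp (- K)) +
        ennreal (exp (2 * K)) * (\<integral>\<^sup>+\<omega>. ennreal (\<psi> n \<omega>) \<partial>M)" for n
      proof -
        have "(\<integral>\<^sup>+\<omega>. ennreal (Z n \<omega>) \<partial>M) \<le> (\<integral>\<^sup>+\<omega>. ennreal (min (Z n \<omega>) C) + ennreal (1 / C) * ennreal ((Z n \<omega>)\<^sup>2) \<partial>M)"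
          using le_min_add_square[OF C Z0(1)] C Z0
          by (intro nn_integral_mono) (simp add: ennreal_plus[symmetric] ennreal_mult[symmetric] ennreal_leI del: ennreal_plus)
        also have "\<dots> = (\<integral>\<^sup>+\<omega>. ennreal (min (Z n \<omega>) C) \<partial>M) + ennreal (1 / C) * (\<integral>\<^sup>+\<omega>. ennreal ((Z n \<omega>)\<^sup>2) \<partial>M)"
          by (simp add: nn_integral_add nn_integral_cmult)
        also have "\<dots> \<le> (\<integral>\<^sup>+\<omega>. ennreal (min (Z n \<omega>) C) \<partial>M) + ennreal (1 / C) * ennreal (exp K)"
          by (intro add_left_mono mult_left_mono Z2) simp
        also have "ennreal (1 / C) * ennreal (exp K) = ennreal (exp K / C)"
          using C by (simp add: ennreal_mult[symmetric])
        finally have *: "(\<integral>\<^sup>+\<omega>. ennreal (Z n \<omega>) \<partial>M) \<le>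
            (\<integral>\<^sup>+\<omega>. ennreal (min (Z n \<omega>) C) \<partial>M) + ennreal (exp K / C)" .
        have "1 \<le> (\<integral>\<^sup>+\<omega>. ennreal (Z n \<omega>) \<partial>M) + ennreal (exp (- K)) +
            ennreal (exp (2 * K)) * (\<integral>\<^sup>+\<omega>. ennreal (\<psi> n \<omega>) \<partial>M)"
          using P2[OF K, of n] unfolding Z_def \<psi>_def .
        also have "\<dots> \<le> (\<integral>\<^sup>+\<omega>. ennreal (min (Z n \<omega>) C) \<partial>M) + ennreal (exp K / C) + ennreal (exp (- K)) +
            ennreal (exp (2 * K)) * (\<integral>\<^sup>+\<omega>. ennreal (\<psi> n \<omega>) \<partial>M)"
          by (intro add_right_mono *)
        finally show ?thesis .
      qed
      then have "1 \<le> (\<integral>\<^sup>+\<omega>. ennreal (min (Z' \<omega>) C) \<partial>M) + ennreal (exp K / C) + ennreal (exp (- K)) +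
        ennreal (exp (2 * K)) * (\<integral>\<^sup>+\<omega>. ennreal (\<psi>' \<omega>) \<partial>M)"
        by (intro LIMSEQ_le_const[OF tendsto_add[OF tendsto_add[OF tendsto_add[OF Cint tendsto_const] tendsto_const]
            ennreal_tendsto_cmult[OF _ \<psi>int]]]) auto
      also have "\<dots> \<le> (\<integral>\<^sup>+\<omega>. ennreal (Z' \<omega>) \<partial>M) + ennreal (exp K / C) + ennreal (exp (- K)) +
        ennreal (exp (2 * K)) * (\<integral>\<^sup>+\<omega>. ennreal (\<psi>' \<omega>) \<partial>M)"
        by (intro add_right_mono nn_integral_mono ennreal_leI) simp
      finally show ?thesis .
    qed
    have lim0: "(\<lambda>n. ennreal (exp K / real (Suc n))) \<longlonglongrightarrow> ennreal 0"
      by (intro tendsto_ennrealI) real_asymp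
    have "1 \<le> (\<integral>\<^sup>+\<omega>. ennreal (Z' \<omega>) \<partial>M) + ennreal 0 + ennreal (exp (- K)) +
        ennreal (exp (2 * K)) * (\<integral>\<^sup>+\<omega>. ennreal (\<psi>' \<omega>) \<partial>M)"
      by (rule LIMSEQ_le_const[OF tendsto_add[OF tendsto_add[OF tendsto_add[OF tendsto_const lim0] tendsto_const] tendsto_const]])
        (use main in auto)
    then show ?thesis by (simp add: Z'_def \<psi>'_def)
  qed
  show ?thesis
    unfolding exponential_pair_def using L1 L2 by auto
qed

text \<open>
  Split \<open>p (S - Q / 2)\<close> into \<open>p S - p\<^sup>2 Q\<close> and a multiple of \<open>Q\<close>. The square of the exponential of the
  first part is controlled by the supermartingale bound for \<open>2 p\<close>, that of the second by the
  exponential moments of \<open>Q\<close>.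
\<close>

lemma (in prob_space) exponential_pair_moment:
  assumes "exponential_pair M S Q" and Q: "\<And>\<omega>. \<omega> \<in> space M \<Longrightarrow> 0 \<le> Q \<omega>"
    and ex: "\<And>b. 0 \<le> b \<Longrightarrow> integrable M (\<lambda>\<omega>. exp (b * Q \<omega>))"
  shows "integrable M (\<lambda>\<omega>. exp (p * (S \<omega> - Q \<omega> / 2)))"
proof -
  have [measurable]: "S \<in> borel_measurable M" "Q \<in> borel_measurable M"
    using assms by (auto simp: exponential_pair_def)
  have "(\<integral>\<^sup>+\<omega>. ennreal (exp ((2 * p) * S \<omega> - (2 * p)\<^sup>2 * Q \<omega> / 2)) \<partial>M) \<le> 1"
    using assms(1) unfolding exponential_pair_def by blast
  then have 1: "integrable M (\<lambda>\<omega>. exp ((2 * p) * S \<omega> - (2 * p)\<^sup>2 * Q \<omega> / 2))"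
    by (intro integrableI_nonneg) (auto intro: order.strict_trans1)
  have 2: "integrable M (\<lambda>\<omega>. exp ((2 * p\<^sup>2 + \<bar>p\<bar>) * Q \<omega>))"
    by (rule ex) simp
  show ?thesis
  proof (rule Bochner_Integration.integrable_bound[OF Bochner_Integration.integrable_add[OF 1 2]])
    show "AE \<omega> in M. norm (exp (p * (S \<omega> - Q \<omega> / 2))) \<le>
        norm (exp ((2 * p) * S \<omega> - (2 * p)\<^sup>2 * Q \<omega> / 2) + exp ((2 * p\<^sup>2 + \<bar>p\<bar>) * Q \<omega>))"
    proof (rule AE_I2)
      fix \<omega> assume w: "\<omega> \<in> space M"
      define x y where "x = p * S \<omega> - p\<^sup>2 * Q \<omega>" and "y = (p\<^sup>2 - p / 2) * Q \<omega>"
      have "exp (p * (S \<omega> - Q \<omega> / 2)) = exp x * exp y"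
        by (simp add: x_def y_def exp_add[symmetric] algebra_simps)
      also have "\<dots> \<le> (exp x)\<^sup>2 + (exp y)\<^sup>2"
        using zero_le_power2[of "exp x - exp y"] mult_pos_pos[OF exp_gt_zero[of x] exp_gt_zero[of y]]
        unfolding power2_diff by linarith
      also have "(exp x)\<^sup>2 = exp ((2 * p) * S \<omega> - (2 * p)\<^sup>2 * Q \<omega> / 2)"
      proof -
        have "2 * x = (2 * p) * S \<omega> - (2 * p)\<^sup>2 * Q \<omega> / 2"
          by (simp add: x_def power_mult_distrib)
        then show ?thesis by (metis exp_double)
      qed
      also have "(exp y)\<^sup>2 \<le> exp ((2 * p\<^sup>2 + \<bar>p\<bar>) * Q \<omega>)"
      proof -
        have "(2 * p\<^sup>2 - p) * Q \<omega> \<le> (2 * p\<^sup>2 + \<bar>p\<bar>) * Q \<omega>"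
          using Q[OF w] by (intro mult_right_mono) auto
        then show ?thesis by (simp add: y_def exp_double[symmetric] algebra_simps)
      qed
      finally show "norm (exp (p * (S \<omega> - Q \<omega> / 2))) \<le>
        norm (exp ((2 * p) * S \<omega> - (2 * p)\<^sup>2 * Q \<omega> / 2) + exp ((2 * p\<^sup>2 + \<bar>p\<bar>) * Q \<omega>))"
        by simp
    qed
  qed measurable
qed

text \<open>
  Novikov's theorem. By Markov's inequality the last error term in the definition is at most
  \<open>exp (2 K) exp (- 4 K)\<close> times the exponential moment of order \<open>4\<close> of \<open>Q\<close>, which tends to zero.
\<close>

lemma (in prob_space) exponential_pair_expectation:
  assumes pair: "exponential_pair M S Q" and Q: "\<And>\<omega>. \<omega> \<in> space M \<Longrightarrow> 0 \<le> Q \<omega>"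
    and ex: "\<And>b. 0 \<le> b \<Longrightarrow> integrable M (\<lambda>\<omega>. exp (b * Q \<omega>))"
  shows "expectation (\<lambda>\<omega>. exp (S \<omega> - Q \<omega> / 2)) = 1"
proof -
  have [measurable]: "S \<in> borel_measurable M" "Q \<in> borel_measurable M"
    using assms by (auto simp: exponential_pair_def)
  have int: "integrable M (\<lambda>\<omega>. exp (S \<omega> - Q \<omega> / 2))"
    using exponential_pair_moment[OF assms, of 1] by simp
  define E c where "E = expectation (\<lambda>\<omega>. exp (S \<omega> - Q \<omega> / 2))" and "c = expectation (\<lambda>\<omega>. exp (4 * Q \<omega>))"
  have E: "(\<integral>\<^sup>+\<omega>. ennreal (exp (S \<omega> - Q \<omega> / 2)) \<partial>M) = ennreal E"
    unfolding E_def using int by (intro nn_integral_eq_integral) auto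
  have E0: "0 \<le> E" unfolding E_def by (intro Bochner_Integration.integral_nonneg) auto
  have c0: "0 \<le> c" unfolding c_def by (intro Bochner_Integration.integral_nonneg) auto
  have "(\<integral>\<^sup>+\<omega>. ennreal (exp (1 * S \<omega> - 1\<^sup>2 * Q \<omega> / 2)) \<partial>M) \<le> 1"
    using pair unfolding exponential_pair_def by blast
  then have "E \<le> 1" using E E0 by (simp add: ennreal_le_1)
  moreover have "1 \<le> E"
  proof -
    have "1 \<le> E + exp (- real n) + exp (2 * real n) * (exp (- 4 * real n) * c)" for n
    proof -
      let ?K = "real n"
      have "(\<integral>\<^sup>+\<omega>. ennreal (min 1 (exp (4 * (Q \<omega> - ?K)))) \<partial>M) \<le>
          (\<integral>\<^sup>+\<omega>. ennreal (exp (- 4 * ?K) * exp (4 * Q \<omega>)) \<partial>M)"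
        by (intro nn_integral_mono ennreal_leI) (simp add: exp_add[symmetric] algebra_simps min_le_iff_disj)
      also have "\<dots> = ennreal (exp (- 4 * ?K) * c)"
        unfolding c_def using ex[of 4] by (subst nn_integral_eq_integral) auto
      finally have 1: "(\<integral>\<^sup>+\<omega>. ennreal (min 1 (exp (4 * (Q \<omega> - ?K)))) \<partial>M) \<le> ennreal (exp (- 4 * ?K) * c)" .
      have 2: "(\<integral>\<^sup>+\<omega>. ennreal (exp (S \<omega> - Q \<omega> / 2) * min 1 (exp (?K - Q \<omega>))) \<partial>M) \<le> ennreal E"
        unfolding E[symmetric] by (intro nn_integral_mono ennreal_leI) (simp add: mult_le_cancel_left1)
      have "1 \<le> (\<integral>\<^sup>+\<omega>. ennreal (exp (S \<omega> - Q \<omega> / 2) * min 1 (exp (?K - Q \<omega>))) \<partial>M) +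
         ennreal (exp (- ?K)) + ennreal (exp (2 * ?K)) * (\<integral>\<^sup>+\<omega>. ennreal (min 1 (exp (4 * (Q \<omega> - ?K)))) \<partial>M)"
        using pair unfolding exponential_pair_def by (meson of_nat_0_le_iff)
      also have "\<dots> \<le> ennreal E + ennreal (exp (- ?K)) + ennreal (exp (2 * ?K)) * ennreal (exp (- 4 * ?K) * c)"
        by (intro add_mono mult_left_mono 1 2) auto
      also have "\<dots> = ennreal (E + exp (- ?K) + exp (2 * ?K) * (exp (- 4 * ?K) * c))"
        using E0 c0 by (simp add: ennreal_plus ennreal_mult)
      finally show ?thesis by simp
    qed
    moreover have "(\<lambda>n. E + exp (- real n) + exp (2 * real n) * (exp (- 4 * real n) * c)) \<longlonglongrightarrow> E"
      by real_asymp
    ultimately show ?thesis by (intro LIMSEQ_le_const) auto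
  qed
  ultimately show ?thesis by (simp add: E_def)
qed

section \<open>Exponential martingales in discrete time\<close>

context brownian_space
begin

text \<open>
  The last increment is integrated out given the past, and so on down to time zero.
\<close>

lemma discrete_exponential_expectation:
  assumes A: "A \<subseteq> I" "finite A"
    and d: "\<And>k. k \<le> N \<Longrightarrow> 0 \<le> d k \<and> d k \<le> T" "\<And>k. k < N \<Longrightarrow> d k \<le> d (Suc k)"
    and c: "\<And>k i. k < N \<Longrightarrow> i \<in> A \<Longrightarrow> c k i \<in> borel_measurable (F (d k))"
  shows "(\<integral>\<^sup>+\<omega>. ennreal (exp (\<Sum>k<N. \<Sum>i\<in>A. c k i \<omega> * (W i (d (Suc k)) \<omega> - W i (d k) \<omega>)
      - (c k i \<omega>)\<^sup>2 * (d (Suc k) - d k) / 2)) \<partial>M) = 1"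
  using d c
proof (induction N)
  case 0
  then show ?case by (simp add: emeasure_space_1)
next
  case (Suc N)
  let ?e = "\<lambda>k \<omega>. \<Sum>i\<in>A. c k i \<omega> * (W i (d (Suc k)) \<omega> - W i (d k) \<omega>) - (c k i \<omega>)\<^sup>2 * (d (Suc k) - d k) / 2"
  have mono: "j \<le> k \<Longrightarrow> k \<le> Suc N \<Longrightarrow> d j \<le> d k" for j k
  proof (induction k rule: dec_induct)
    case (step k)
    then show ?case using Suc.prems(2)[of k] by force
  qed simp
  have Wm: "W i (d k) \<in> borel_measurable (F (d N))" if "i \<in> A" "k \<le> N" for i k
    by (rule measurable_F_mono[OF brownian_adapted mono])
      (use that A Suc.prems(1)[of k] in \<open>simp_all add: subsetD\<close>)
  have cm: "c k i \<in> borel_measurable (F (d N))" if "i \<in> A" "k \<le> N" for i k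
    by (rule measurable_F_mono[OF Suc.prems(3) mono]) (use that in simp_all)
  have G: "(\<lambda>\<omega>. ennreal (exp (\<Sum>k<N. ?e k \<omega>))) \<in> borel_measurable (F (d N))"
    by (intro measurable_compose[OF _ measurable_ennreal] measurable_compose[OF _ borel_measurable_exp]
        borel_measurable_sum borel_measurable_diff borel_measurable_times borel_measurable_divide
        borel_measurable_power borel_measurable_const Wm cm) auto
  have "(\<integral>\<^sup>+\<omega>. ennreal (exp (\<Sum>k<Suc N. ?e k \<omega>)) \<partial>M) =
      (\<integral>\<^sup>+\<omega>. ennreal (exp (\<Sum>k<N. ?e k \<omega>)) * ennreal (exp (?e N \<omega>)) \<partial>M)"
    by (simp add: exp_add ennreal_mult)
  also have "\<dots> = (\<integral>\<^sup>+\<omega>. ennreal (exp (\<Sum>k<N. ?e k \<omega>)) \<partial>M)"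
    using Suc.prems by (intro exponential_increment A G) auto
  also have "\<dots> = 1"
    using Suc.prems by (intro Suc.IH) auto
  finally show ?case .
qed

text \<open>
  Multiplying the coefficients by \<open>p\<close> gives the first clause, with equality. For the second clause the
  expectation \<open>1\<close> is computed for the coefficients switched off at level \<open>K\<close>. Where \<open>Q \<le> K\<close> nothing has
  been switched off. Where \<open>Q > K\<close>, the truncated exponential \<open>Z\<close> is at most
  \<open>exp (- 2 K) Z\<^sup>2 + exp (2 K)\<close>, and since the truncated quadratic variation is bounded by \<open>K\<close>, the
  expectation of \<open>Z\<^sup>2\<close> is at most \<open>exp K\<close>.
\<close>

lemma discrete_exponential_pair:
  assumes A: "A \<subseteq> I" "finite A"
    and d: "\<And>k. k \<le> N \<Longrightarrow> 0 \<le> d k \<and> d k \<le> T" "\<And>k. k < N \<Longrightarrow> d k \<le> d (Suc k)"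
    and c: "\<And>k i. k < N \<Longrightarrow> i \<in> A \<Longrightarrow> c k i \<in> borel_measurable (F (d k))"
  shows "exponential_pair M (\<lambda>\<omega>. \<Sum>k<N. \<Sum>i\<in>A. c k i \<omega> * (W i (d (Suc k)) \<omega> - W i (d k) \<omega>))
      (\<lambda>\<omega>. \<Sum>k<N. \<Sum>i\<in>A. (c k i \<omega>)\<^sup>2 * (d (Suc k) - d k))"
proof -
  define S where "S = (\<lambda>c \<omega>. \<Sum>k<N. \<Sum>i\<in>A. c k i \<omega> * (W i (d (Suc k)) \<omega> - W i (d k) \<omega>))"
  define q where "q = (\<lambda>(c::nat \<Rightarrow> nat \<Rightarrow> 'a \<Rightarrow> real) k \<omega>. \<Sum>i\<in>A. (c k i \<omega>)\<^sup>2 * (d (Suc k) - d k))"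
  define Q where "Q = (\<lambda>c m \<omega>. \<Sum>k<m. q c k \<omega>)"
  have mono: "j \<le> k \<Longrightarrow> k \<le> N \<Longrightarrow> d j \<le> d k" for j k
  proof (induction k rule: dec_induct)
    case (step k)
    then show ?case using d(2)[of k] by force
  qed simp
  have one: "(\<integral>\<^sup>+\<omega>. ennreal (exp (S c \<omega> - Q c N \<omega> / 2)) \<partial>M) = 1"
    if "\<And>k i. k < N \<Longrightarrow> i \<in> A \<Longrightarrow> c k i \<in> borel_measurable (F (d k))" for c
    using discrete_exponential_expectation[where N=N and d=d and c=c, OF A d that]
    by (simp add: S_def Q_def q_def sum_subtractf sum_divide_distrib)
  have Sp: "S (\<lambda>k i \<omega>. p * c k i \<omega>) \<omega> = p * S c \<omega>" "Q (\<lambda>k i \<omega>. p * c k i \<omega>) N \<omega> = p\<^sup>2 * Q c N \<omega>" for p c \<omega>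
    by (simp_all add: S_def Q_def q_def sum_distrib_left power_mult_distrib mult.assoc)
  have P1: "(\<integral>\<^sup>+\<omega>. ennreal (exp (p * S c \<omega> - p\<^sup>2 * Q c N \<omega> / 2)) \<partial>M) = 1"
    if "\<And>k i. k < N \<Longrightarrow> i \<in> A \<Longrightarrow> c k i \<in> borel_measurable (F (d k))" for p c
    using one[of "\<lambda>k i \<omega>. p * c k i \<omega>"] that unfolding Sp by simp
  have Wm[measurable]: "W i (d k) \<in> borel_measurable M" if "i \<in> A" "k \<le> N" for i k
    by (rule brownian_measurable) (use that A d(1)[of k] in \<open>simp_all add: subsetD\<close>)
  have cm[measurable]: "c k i \<in> borel_measurable M" if "i \<in> A" "k < N" for i k
    by (rule measurable_F_imp[OF c]) (use that d(1)[of k] in simp_all)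
  have Sm[measurable]: "S c \<in> borel_measurable M"
    unfolding S_def by (intro borel_measurable_sum borel_measurable_times borel_measurable_diff cm Wm) auto
  have Qm[measurable]: "Q c N \<in> borel_measurable M"
    unfolding Q_def q_def
    by (intro borel_measurable_sum borel_measurable_times borel_measurable_power borel_measurable_const cm) auto
  have P2: "1 \<le> (\<integral>\<^sup>+\<omega>. ennreal (exp (S c \<omega> - Q c N \<omega> / 2) * min 1 (exp (K - Q c N \<omega>))) \<partial>M) +
       ennreal (exp (- K)) + ennreal (exp (2 * K)) * (\<integral>\<^sup>+\<omega>. ennreal (min 1 (exp (4 * (Q c N \<omega> - K)))) \<partial>M)"
    if K: "0 \<le> K" for K
  proof -
    \<comment> \<open>the contribution of the interval from d k to d (Suc k) to Q is already known at time d k,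
      so that the truncation is adapted\<close>
    define c' where "c' = (\<lambda>k i \<omega>. c k i \<omega> * (if Q c (Suc k) \<omega> \<le> K then 1 else 0))"
    have q0: "0 \<le> q c k \<omega>" if "k < N" for k \<omega>
      unfolding q_def using d(2)[OF that] by (intro sum_nonneg) auto
    have Qmono: "Q c m \<omega> \<le> Q c m' \<omega>" if "m \<le> m'" "m' \<le> N" for m m' \<omega>
      unfolding Q_def using that q0 by (intro sum_mono2) auto
    have c'm: "c' k i \<in> borel_measurable (F (d k))" if k: "k < N" and i: "i \<in> A" for k i
    proof -
      have cm': "c j l \<in> borel_measurable (F (d k))" if "j \<le> k" "l \<in> A" for j l
        by (rule measurable_F_mono[OF c mono]) (use that k in simp_all)
      have [measurable]: "Q c (Suc k) \<in> borel_measurable (F (d k))"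
        unfolding Q_def q_def
        by (intro borel_measurable_sum borel_measurable_times borel_measurable_power borel_measurable_const cm') auto
      have [measurable]: "c k i \<in> borel_measurable (F (d k))" using c[OF k i] .
      show ?thesis unfolding c'_def by measurable
    qed
    have q': "q c' k \<omega> = (if Q c (Suc k) \<omega> \<le> K then q c k \<omega> else 0)" for k \<omega>
      by (simp add: q_def c'_def)
    have Q'K: "m \<le> N \<Longrightarrow> Q c' m \<omega> \<le> K" for m \<omega>
    proof (induction m)
      case 0
      then show ?case using K by (simp add: Q_def)
    next
      case (Suc m)
      show ?case
      proof (cases "Q c (Suc m) \<omega> \<le> K")
        case True
        have "Q c' (Suc m) \<omega> \<le> Q c (Suc m) \<omega>"
          unfolding Q_def q' using q0 Suc.prems by (intro sum_mono) auto
        then show ?thesis using True by simp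
      next
        case False
        then show ?thesis using Suc by (simp add: Q_def q')
      qed
    qed
    have same: "S c' \<omega> = S c \<omega>" "Q c' N \<omega> = Q c N \<omega>" if "Q c N \<omega> \<le> K" for \<omega>
    proof -
      have c'c: "c' k i \<omega> = c k i \<omega>" if "k < N" for k i
        using Qmono[of "Suc k" N \<omega>] that \<open>Q c N \<omega> \<le> K\<close> by (auto simp: c'_def)
      show "S c' \<omega> = S c \<omega>"
        unfolding S_def by (intro sum.cong refl) (simp add: c'c)
      show "Q c' N \<omega> = Q c N \<omega>"
        unfolding Q_def q_def by (intro sum.cong refl) (simp add: c'c)
    qed
    have [measurable]: "S c' \<in> borel_measurable M" "Q c' N \<in> borel_measurable M"
    proof -
      have cm[measurable]: "c' k i \<in> borel_measurable M" if "i \<in> A" "k < N" for i k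
        by (rule measurable_F_imp[OF c'm]) (use that d(1)[of k] in simp_all)
      show "S c' \<in> borel_measurable M"
        unfolding S_def by (intro borel_measurable_sum borel_measurable_times borel_measurable_diff cm Wm) auto
      show "Q c' N \<in> borel_measurable M"
        unfolding Q_def q_def
        by (intro borel_measurable_sum borel_measurable_times borel_measurable_power borel_measurable_const cm) auto
    qed
    have "1 = (\<integral>\<^sup>+\<omega>. ennreal (exp (S c' \<omega> - Q c' N \<omega> / 2)) \<partial>M)"
      using one[OF c'm] by simp
    also have "\<dots> \<le> (\<integral>\<^sup>+\<omega>. ennreal (exp (S c \<omega> - Q c N \<omega> / 2) * min 1 (exp (K - Q c N \<omega>))) +
        (ennreal (exp (- K)) * ennreal (exp (2 * S c' \<omega> - 2\<^sup>2 * Q c' N \<omega> / 2)) +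
         ennreal (exp (2 * K)) * ennreal (min 1 (exp (4 * (Q c N \<omega> - K))))) \<partial>M)"
    proof (intro nn_integral_mono)
      fix \<omega>
      have "exp (S c' \<omega> - Q c' N \<omega> / 2) \<le> exp (S c \<omega> - Q c N \<omega> / 2) * min 1 (exp (K - Q c N \<omega>)) +
        (exp (- K) * exp (2 * S c' \<omega> - 2\<^sup>2 * Q c' N \<omega> / 2) + exp (2 * K) * min 1 (exp (4 * (Q c N \<omega> - K))))"
      proof (cases "Q c N \<omega> \<le> K")
        case True
        then show ?thesis using same[OF True] by (simp add: min_absorb1)
      next
        case False
        \<comment> \<open>here y * exp K is the truncated exponential, and the product is bounded by the sum of
          the squares\<close>
        define x where "x = S c' \<omega> - Q c' N \<omega> / 2"
        define y where "y = exp (x - K)"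
        have "exp x = exp K * y" by (simp add: y_def exp_add[symmetric])
        also have "\<dots> \<le> y\<^sup>2 + (exp K)\<^sup>2"
          using zero_le_power2[of "y - exp K"] mult_pos_pos[OF exp_gt_zero[of "x - K"] exp_gt_zero[of K]]
            mult.commute[of y "exp K"]
          unfolding power2_diff y_def[symmetric] by linarith
        also have "y\<^sup>2 = exp (2 * x - 2 * K)" by (simp add: y_def exp_double[symmetric] algebra_simps)
        also have "\<dots> \<le> exp (- K + (2 * S c' \<omega> - 2\<^sup>2 * Q c' N \<omega> / 2))"
          using Q'K[of N \<omega>] by (simp add: x_def)
        also have "\<dots> = exp (- K) * exp (2 * S c' \<omega> - 2\<^sup>2 * Q c' N \<omega> / 2)" by (rule exp_add)
        also have "(exp K)\<^sup>2 = exp (2 * K) * min 1 (exp (4 * (Q c N \<omega> - K)))"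
          using False by (simp add: min_absorb1 exp_double)
        finally have "exp x \<le> exp (- K) * exp (2 * S c' \<omega> - 2\<^sup>2 * Q c' N \<omega> / 2) + exp (2 * K) * min 1 (exp (4 * (Q c N \<omega> - K)))"
          by simp
        moreover have "0 \<le> exp (S c \<omega> - Q c N \<omega> / 2) * min 1 (exp (K - Q c N \<omega>))" by simp
        ultimately show ?thesis unfolding x_def by linarith
      qed
      then show "ennreal (exp (S c' \<omega> - Q c' N \<omega> / 2)) \<le> ennreal (exp (S c \<omega> - Q c N \<omega> / 2) * min 1 (exp (K - Q c N \<omega>))) +
        (ennreal (exp (- K)) * ennreal (exp (2 * S c' \<omega> - 2\<^sup>2 * Q c' N \<omega> / 2)) +
         ennreal (exp (2 * K)) * ennreal (min 1 (exp (4 * (Q c N \<omega> - K)))))"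
        by (simp add: ennreal_plus[symmetric] ennreal_mult[symmetric] ennreal_leI del: ennreal_plus)
    qed
    also have "\<dots> = (\<integral>\<^sup>+\<omega>. ennreal (exp (S c \<omega> - Q c N \<omega> / 2) * min 1 (exp (K - Q c N \<omega>))) \<partial>M) +
        (ennreal (exp (- K)) * (\<integral>\<^sup>+\<omega>. ennreal (exp (2 * S c' \<omega> - 2\<^sup>2 * Q c' N \<omega> / 2)) \<partial>M) +
         ennreal (exp (2 * K)) * (\<integral>\<^sup>+\<omega>. ennreal (min 1 (exp (4 * (Q c N \<omega> - K)))) \<partial>M))"
      by (simp add: nn_integral_add nn_integral_cmult)
    also have "(\<integral>\<^sup>+\<omega>. ennreal (exp (2 * S c' \<omega> - 2\<^sup>2 * Q c' N \<omega> / 2)) \<partial>M) = 1"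
      by (rule P1[OF c'm])
    finally show ?thesis by (simp add: add.assoc)
  qed
  have "exponential_pair M (S c) (Q c N)"
    unfolding exponential_pair_def using P1[OF c] P2 Sm Qm by simp
  then show ?thesis by (simp add: S_def[abs_def] Q_def q_def)
qed

end

section \<open>Elementary integrands on a common partition\<close>

lemma elementary_times:
  assumes "elementary M T F n \<tau> c" "k \<le> n"
  shows "0 \<le> \<tau> k" "\<tau> k \<le> T"
proof -
  have mono: "j \<le> k \<Longrightarrow> k \<le> n \<Longrightarrow> \<tau> j \<le> \<tau> k" for j k
  proof (induction k rule: dec_induct)
    case (step k)
    then show ?case using assms(1) unfolding elementary_def by (meson Suc_le_lessD less_imp_le order_trans)
  qed simp
  show "0 \<le> \<tau> k" "\<tau> k \<le> T"
    using mono[of 0 k] mono[of k n] assms unfolding elementary_def by auto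
qed

text \<open>
  Between consecutive points of a partition that contains all the times of an elementary integrand, the
  integrand is constant and its integral is linear in the integrator.
\<close>

lemma elementary_process_on_gap:
  assumes "\<And>k. k \<le> n \<Longrightarrow> \<tau> k \<notin> {s<..<t}" and "s < t"
    and mono: "\<And>k. k < n \<Longrightarrow> \<tau> k \<le> \<tau> (Suc k)"
  shows "r \<in> {s<..t} \<Longrightarrow> elementary_process n \<tau> c r \<omega> = elementary_process n \<tau> c t \<omega>"
    and "elementary_integral X n \<tau> c t \<omega> - elementary_integral X n \<tau> c s \<omega> =
      elementary_process n \<tau> c t \<omega> * (X t \<omega> - X s \<omega>)"
proof -
  have gap: "\<tau> k \<le> s \<or> t \<le> \<tau> k" if "k \<le> n" for k using assms(1)[OF that] by auto
  show "elementary_process n \<tau> c r \<omega> = elementary_process n \<tau> c t \<omega>" if r: "r \<in> {s<..t}"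
    unfolding elementary_process_def
  proof (intro sum.cong refl arg_cong2[of _ _ _ _ "(*)"])
    fix k assume "k \<in> {..<n}"
    then show "(indicator {\<tau> k<..\<tau> (Suc k)} r :: real) = indicator {\<tau> k<..\<tau> (Suc k)} t"
      using gap[of k] gap[of "Suc k"] r by (auto simp: indicator_def)
  qed
  show "elementary_integral X n \<tau> c t \<omega> - elementary_integral X n \<tau> c s \<omega> =
      elementary_process n \<tau> c t \<omega> * (X t \<omega> - X s \<omega>)"
    unfolding elementary_integral_def elementary_process_def sum_subtractf[symmetric] sum_distrib_right
  proof (intro sum.cong refl)
    fix k assume "k \<in> {..<n}"
    then have "\<tau> k \<le> \<tau> (Suc k)" and k: "\<tau> k \<le> s \<or> t \<le> \<tau> k" "\<tau> (Suc k) \<le> s \<or> t \<le> \<tau> (Suc k)"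
      using gap[of k] gap[of "Suc k"] mono[of k] by auto
    then consider "t \<le> \<tau> k" "t \<le> \<tau> (Suc k)" 
        | "\<tau> k \<le> s" "\<tau> (Suc k) \<le> s" | "\<tau> k \<le> s" "t \<le> \<tau> (Suc k)"
      using assms(2) by linarith
    then show "c k \<omega> * (X (min (\<tau> (Suc k)) t) \<omega> - X (min (\<tau> k) t) \<omega>) -
        c k \<omega> * (X (min (\<tau> (Suc k)) s) \<omega> - X (min (\<tau> k) s) \<omega>) =
        c k \<omega> * indicator {\<tau> k<..\<tau> (Suc k)} t * (X t \<omega> - X s \<omega>)"
      using assms(2) by cases (auto simp: min_def algebra_simps)
  qed
qed

text \<open>
  The half-open cells of a partition cover each point exactly once.
\<close>

lemma sum_indicator_partition:
  assumes "\<And>k. k < N \<Longrightarrow> d k < d (Suc k)"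
    and "\<And>k. k < N \<Longrightarrow> r \<in> {d k<..d (Suc k)} \<Longrightarrow> f k = (y :: real)"
  shows "d 0 \<le> d N \<and> (\<Sum>k<N. f k * indicator {d k<..d (Suc k)} r) = y * indicator {d 0<..d N} (r::real)"
  using assms
proof (induction N)
  case (Suc N)
  have IH: "d 0 \<le> d N" "(\<Sum>k<N. f k * indicator {d k<..d (Suc k)} r) = y * indicator {d 0<..d N} r"
    using Suc by auto
  have "f N * indicator {d N<..d (Suc N)} r = y * indicator {d N<..d (Suc N)} r"
    using Suc.prems(2)[of N] by (auto simp: indicator_def)
  moreover have "indicator {d 0<..d (Suc N)} r = indicator {d 0<..d N} r + (indicator {d N<..d (Suc N)} r :: real)"
    using IH(1) Suc.prems(1)[of N] by (auto simp: indicator_def)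
  ultimately show ?case using IH Suc.prems(1)[of N] by (simp add: algebra_simps)
qed simp

text \<open>
  Integrands against different Brownian motions come with different time grids; this refines them into a
  single one.
\<close>

lemma common_partition:
  fixes D :: "real set"
  assumes "finite D" "0 \<in> D" "T \<in> D" "D \<subseteq> {0..T}"
  obtains N d where "d 0 = 0" "d N = T" "\<And>k. k < N \<Longrightarrow> d k < d (Suc k)"
    "\<And>k. k \<le> N \<Longrightarrow> 0 \<le> d k \<and> d k \<le> T" "\<And>k. k < N \<Longrightarrow> D \<inter> {d k<..<d (Suc k)} = {}"
proof -
  define xs where "xs = sorted_list_of_set D"
  define N where "N = length xs - 1"
  have xs: "set xs = D" "sorted_wrt (<) xs" using assms by (auto simp: xs_def)
  have ne: "xs \<noteq> []" using assms(2) xs(1) by auto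
  have len: "length xs = Suc N" using ne by (simp add: N_def)
  have less: "xs ! j < xs ! k" if "j < k" "k \<le> N" for j k
    using xs(2) that len by (auto simp: sorted_wrt_iff_nth_less)
  have in01: "0 \<le> xs ! k \<and> xs ! k \<le> T" if "k \<le> N" for k
    using assms(4) xs(1) that len nth_mem[of k xs] by auto
  have idx: "\<exists>k\<le>N. xs ! k = x" if "x \<in> D" for x
    using that xs(1) len by (metis in_set_conv_nth less_Suc_eq_le)
  show thesis
  proof (rule that[of "\<lambda>k. xs ! k" N])
    obtain k where "k \<le> N" "xs ! k = 0" using idx[OF assms(2)] by auto
    then show "xs ! 0 = 0" using less[of 0 k] in01[of 0] by (cases "k = 0") auto
    obtain k where "k \<le> N" "xs ! k = T" using idx[OF assms(3)] by auto
    then show "xs ! N = T" using less[of k N] in01[of N] by (cases "k = N") auto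
    fix k assume k: "k < N"
    show "xs ! k < xs ! Suc k" using less[of k "Suc k"] k by auto
    show "D \<inter> {xs ! k<..<xs ! Suc k} = {}"
    proof (rule ccontr)
      assume "D \<inter> {xs ! k<..<xs ! Suc k} \<noteq> {}"
      then obtain x where x: "x \<in> D" "xs ! k < x" "x < xs ! Suc k" by auto
      obtain j where j: "j \<le> N" "xs ! k < xs ! j" "xs ! j < xs ! Suc k"
        using idx[OF x(1)] x(2,3) by blast
      have "\<not> j \<le> k" using less[of j k] j k by (cases "j = k") auto
      moreover have "\<not> Suc k \<le> j" using less[of "Suc k" j] j k by (cases "j = Suc k") auto
      ultimately show False by auto
    qed
  qed (rule in01)
qed

context brownian_space
begin

text \<open>
  A coefficient that is active at time \<open>t\<close> was fixed at a grid point before \<open>t\<close>, which cannot lie in the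
  gap and hence is at most \<open>s\<close>.
\<close>

lemma elementary_process_adapted:
  assumes el: "elementary M T F n \<tau> c" and gap: "\<And>k. k \<le> n \<Longrightarrow> \<tau> k \<notin> {s<..<t}"
  shows "elementary_process n \<tau> c t \<in> borel_measurable (F s)"
proof -
  have "(\<lambda>\<omega>. \<Sum>k<n. c k \<omega> * indicator {\<tau> k<..\<tau> (Suc k)} t) \<in> borel_measurable (F s)"
  proof (rule borel_measurable_sum)
    fix k assume k: "k \<in> {..<n}"
    show "(\<lambda>\<omega>. c k \<omega> * indicator {\<tau> k<..\<tau> (Suc k)} t) \<in> borel_measurable (F s)"
    proof (cases "\<tau> k \<le> s")
      case True
      have "c k \<in> borel_measurable (F (\<tau> k))" using el k by (simp add: elementary_def)
      from measurable_F_mono[OF this True] show ?thesis by simp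
    next
      case False
      then have "indicator {\<tau> k<..\<tau> (Suc k)} t = (0 :: real)" using gap[of k] k by auto
      then show ?thesis by simp
    qed
  qed
  then show ?thesis unfolding elementary_process_def[abs_def] .
qed

text \<open>
  On a common partition the elementary integrals are discrete sums over Brownian increments with
  coefficients known at the beginning of each cell.
\<close>

lemma elementary_exponential_pair:
  assumes A: "A \<subseteq> I" "finite A" and el: "\<And>i. i \<in> A \<Longrightarrow> elementary M T F (n i) (\<tau> i) (c i)"
  shows "exponential_pair M (\<lambda>\<omega>. - (\<Sum>i\<in>A. elementary_integral (W i) (n i) (\<tau> i) (c i) T \<omega>))
    (\<lambda>\<omega>. \<Sum>i\<in>A. LINT r:{0..T}|lborel. (elementary_process (n i) (\<tau> i) (c i) r \<omega>)\<^sup>2)"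
proof -
  have T: "0 < T" by (rule brownian_settingD)
  define D where "D = {0, T} \<union> (\<Union>i\<in>A. \<tau> i ` {..n i})"
  have D: "finite D" "0 \<in> D" "T \<in> D" "D \<subseteq> {0..T}"
    using A(2) T elementary_times[OF el] by (auto simp: D_def)
  obtain N d where d: "d 0 = 0" "d N = T" "\<And>k. k < N \<Longrightarrow> d k < d (Suc k)"
    "\<And>k. k \<le> N \<Longrightarrow> 0 \<le> d k \<and> d k \<le> T" "\<And>k. k < N \<Longrightarrow> D \<inter> {d k<..<d (Suc k)} = {}"
    by (rule common_partition[OF D]) blast
  have gap: "\<tau> i j \<notin> {d k<..<d (Suc k)}" if "k < N" "i \<in> A" "j \<le> n i" for i j k
  proof -
    have "\<tau> i j \<in> D" using that unfolding D_def by blast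
    then show ?thesis using d(5)[OF that(1)] by blast
  qed
  have mono: "\<tau> i k \<le> \<tau> i (Suc k)" if "i \<in> A" "k < n i" for i k
    using el[OF that(1)] that(2) by (simp add: elementary_def)
  define p where "p = (\<lambda>i. elementary_process (n i) (\<tau> i) (c i))"
  define J where "J = (\<lambda>i. elementary_integral (W i) (n i) (\<tau> i) (c i))"
  have J: "J i T \<omega> = (\<Sum>k<N. p i (d (Suc k)) \<omega> * (W i (d (Suc k)) \<omega> - W i (d k) \<omega>))" if i: "i \<in> A" for i \<omega>
  proof -
    have "J i 0 \<omega> = 0"
      using elementary_times(1)[OF el[OF i]] by (simp add: J_def elementary_integral_def min_absorb2)
    then have "J i T \<omega> = (\<Sum>k<N. J i (d (Suc k)) \<omega> - J i (d k) \<omega>)"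
      using sum_lessThan_telescope[of "\<lambda>k. J i (d k) \<omega>" N] by (simp add: d)
    also have "\<dots> = (\<Sum>k<N. p i (d (Suc k)) \<omega> * (W i (d (Suc k)) \<omega> - W i (d k) \<omega>))"
      unfolding J_def p_def
      by (intro sum.cong refl elementary_process_on_gap(2)) (use gap i d mono in auto)
    finally show ?thesis .
  qed
  have Q: "(LINT r:{0..T}|lborel. (p i r \<omega>)\<^sup>2) = (\<Sum>k<N. (p i (d (Suc k)) \<omega>)\<^sup>2 * (d (Suc k) - d k))"
    if i: "i \<in> A" for i \<omega>
  proof -
    \<comment> \<open>the intervals of an elementary integrand are open on the left, so time 0 belongs to none\<close>
    have p0: "p i 0 \<omega> = 0"
      unfolding p_def elementary_process_def
    proof (intro sum.neutral ballI)
      fix k assume "k \<in> {..<n i}"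
      then have "0 \<le> \<tau> i k" using elementary_times(1)[OF el[OF i], of k] by simp
      then show "c i k \<omega> * indicator {\<tau> i k<..\<tau> i (Suc k)} 0 = 0" by simp
    qed
    have eq: "indicator {0..T} r *\<^sub>R (p i r \<omega>)\<^sup>2 =
        (\<Sum>k<N. (p i (d (Suc k)) \<omega>)\<^sup>2 * indicator {d k<..d (Suc k)} r)" for r
    proof -
      have "(p i (d (Suc k)) \<omega>)\<^sup>2 = (p i r \<omega>)\<^sup>2" if "k < N" "r \<in> {d k<..d (Suc k)}" for k
      proof -
        have "p i r \<omega> = p i (d (Suc k)) \<omega>"
          unfolding p_def
          by (rule elementary_process_on_gap(1)[where s="d k"])
            (use gap[OF that(1) i] d(3)[OF that(1)] mono[OF i] that(2) in auto)
        then show ?thesis by simp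
      qed
      then have "(\<Sum>k<N. (p i (d (Suc k)) \<omega>)\<^sup>2 * indicator {d k<..d (Suc k)} r) = (p i r \<omega>)\<^sup>2 * indicator {d 0<..d N} r"
        using sum_indicator_partition[of N d r "\<lambda>k. (p i (d (Suc k)) \<omega>)\<^sup>2"] d(3) by blast
      then show ?thesis using p0 by (cases "r = 0") (auto simp: d indicator_def)
    qed
    have "(LINT r:{0..T}|lborel. (p i r \<omega>)\<^sup>2) =
        (LINT r|lborel. (\<Sum>k<N. (p i (d (Suc k)) \<omega>)\<^sup>2 * indicator {d k<..d (Suc k)} r))"
      unfolding set_lebesgue_integral_def eq ..
    also have "\<dots> = (\<Sum>k<N. LINT r|lborel. (p i (d (Suc k)) \<omega>)\<^sup>2 * indicator {d k<..d (Suc k)} r)"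
      by (intro Bochner_Integration.integral_sum integrable_mult_right integrable_real_indicator)
        (auto simp: less_imp_le d(3))
    also have "\<dots> = (\<Sum>k<N. (p i (d (Suc k)) \<omega>)\<^sup>2 * (d (Suc k) - d k))"
      using d(3) by (intro sum.cong refl) (auto simp: less_imp_le)
    finally show ?thesis .
  qed
  have "exponential_pair M (\<lambda>\<omega>. \<Sum>k<N. \<Sum>i\<in>A. - p i (d (Suc k)) \<omega> * (W i (d (Suc k)) \<omega> - W i (d k) \<omega>))
      (\<lambda>\<omega>. \<Sum>k<N. \<Sum>i\<in>A. (- p i (d (Suc k)) \<omega>)\<^sup>2 * (d (Suc k) - d k))"
  proof (rule discrete_exponential_pair[OF A, of N d "\<lambda>k i \<omega>. - p i (d (Suc k)) \<omega>"])
    fix k i assume "k < N" "i \<in> A"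
    then have "p i (d (Suc k)) \<in> borel_measurable (F (d k))"
      unfolding p_def by (intro elementary_process_adapted el gap)
    then show "(\<lambda>\<omega>. - p i (d (Suc k)) \<omega>) \<in> borel_measurable (F (d k))"
      by (rule borel_measurable_uminus)
  qed (use d(3,4) in \<open>auto simp: less_imp_le\<close>)
  also have "(\<lambda>\<omega>. \<Sum>k<N. \<Sum>i\<in>A. - p i (d (Suc k)) \<omega> * (W i (d (Suc k)) \<omega> - W i (d k) \<omega>)) =
      (\<lambda>\<omega>. - (\<Sum>i\<in>A. J i T \<omega>))"
    by (rule ext, subst sum.swap) (simp add: J sum_negf)
  also have "(\<lambda>\<omega>. \<Sum>k<N. \<Sum>i\<in>A. (- p i (d (Suc k)) \<omega>)\<^sup>2 * (d (Suc k) - d k)) =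
      (\<lambda>\<omega>. \<Sum>i\<in>A. LINT r:{0..T}|lborel. (p i r \<omega>)\<^sup>2)"
    by (rule ext, subst sum.swap) (simp add: Q)
  finally show ?thesis by (simp add: J_def p_def)
qed

end

section \<open>Passage to square integrable integrands\<close>

lemma nn_integral_tendsto_0_AE_subseq:
  assumes [measurable]: "\<And>n. f n \<in> borel_measurable M"
    and lim: "(\<lambda>n. \<integral>\<^sup>+x. f n x \<partial>M) \<longlonglongrightarrow> 0"
  shows "\<exists>r::nat \<Rightarrow> nat. strict_mono r \<and> (AE x in M. (\<lambda>n. f (r n) x) \<longlonglongrightarrow> 0)"
proof -
  have "\<forall>\<^sub>F n in sequentially. (\<integral>\<^sup>+x. f n x \<partial>M) < 1"
    by (rule order_tendstoD(2)[OF lim]) simp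
  then obtain m where m: "\<And>n. m \<le> n \<Longrightarrow> (\<integral>\<^sup>+x. f n x \<partial>M) < 1"
    by (auto simp: eventually_sequentially)
  define u where "u = (\<lambda>n x. enn2real (f (n + m) x))"
  have fin: "AE x in M. f (n + m) x = ennreal (u n x)" for n
  proof -
    have "(\<integral>\<^sup>+x. f (n + m) x \<partial>M) \<noteq> \<infinity>" using m[of "n + m"] by auto
    then have "AE x in M. f (n + m) x \<noteq> \<infinity>" by (intro nn_integral_PInf_AE) auto
    then show ?thesis by eventually_elim (simp add: u_def less_top)
  qed
  have eq: "(\<integral>\<^sup>+x. ennreal (u n x) \<partial>M) = (\<integral>\<^sup>+x. f (n + m) x \<partial>M)" for n
    using fin[of n] by (intro nn_integral_cong_AE) auto
  have int: "integrable M (u n)" for n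
  proof (rule integrableI_nonneg)
    have "(\<integral>\<^sup>+x. ennreal (u n x) \<partial>M) < 1" unfolding eq by (rule m) simp
    then show "(\<integral>\<^sup>+x. ennreal (u n x) \<partial>M) < \<infinity>" by (rule less_trans) simp
  qed (auto simp: u_def)
  have "(\<lambda>n. \<integral>x. norm (u n x) \<partial>M) \<longlonglongrightarrow> 0"
  proof -
    have "(\<integral>x. norm (u n x) \<partial>M) = enn2real (\<integral>\<^sup>+x. f (n + m) x \<partial>M)" for n
      unfolding eq[symmetric] by (subst integral_eq_nn_integral) (auto simp: u_def)
    moreover have "(\<lambda>n. enn2real (\<integral>\<^sup>+x. f (n + m) x \<partial>M)) \<longlonglongrightarrow> enn2real 0"
      using tendsto_enn2real[of _ 0] LIMSEQ_ignore_initial_segment[OF lim, of m] by simp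
    ultimately show ?thesis by simp
  qed
  from tendsto_L1_AE_subseq[OF int this] obtain r where r: "strict_mono r" "AE x in M. (\<lambda>n. u (r n) x) \<longlonglongrightarrow> 0"
    by auto
  have "AE x in M. \<forall>n. f (n + m) x = ennreal (u n x)" using fin by (simp add: AE_all_countable)
  with r(2) have "AE x in M. (\<lambda>n. f (r n + m) x) \<longlonglongrightarrow> 0"
  proof eventually_elim
    case (elim x)
    have "(\<lambda>n. ennreal (u (r n) x)) \<longlonglongrightarrow> ennreal 0" using elim(1) by (rule tendsto_ennrealI)
    then show ?case using elim(2) by simp
  qed
  then show ?thesis
    using r(1) by (intro exI[of _ "\<lambda>n. r n + m"]) (auto simp: strict_mono_def)
qed

text \<open>
  Convergence in \<open>L\<^sup>2\<close> implies convergence of the norms. The mixed term is split by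
  \<open>2 u v \<le> b u\<^sup>2 + v\<^sup>2 / b\<close> with a weight \<open>b\<close> that tends to zero more slowly than the squared distance.
\<close>

lemma tendsto_integral_square:
  fixes g :: "'b \<Rightarrow> real"
  assumes [measurable]: "g \<in> borel_measurable L" "\<And>n. h n \<in> borel_measurable L"
    and g: "integrable L (\<lambda>x. (g x)\<^sup>2)" and h: "\<And>n. integrable L (\<lambda>x. (h n x)\<^sup>2)"
    and lim: "(\<lambda>n. \<integral>\<^sup>+x. ennreal ((g x - h n x)\<^sup>2) \<partial>L) \<longlonglongrightarrow> 0"
  shows "(\<lambda>n. \<integral>x. (h n x)\<^sup>2 \<partial>L) \<longlonglongrightarrow> (\<integral>x. (g x)\<^sup>2 \<partial>L)"
proof -
  have int: "integrable L (\<lambda>x. (g x - h n x)\<^sup>2)" for n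
  proof (rule Bochner_Integration.integrable_bound)
    show "integrable L (\<lambda>x. 2 * (g x)\<^sup>2 + 2 * (h n x)\<^sup>2)" using g h by auto
    have "(g x - h n x)\<^sup>2 \<le> 2 * (g x)\<^sup>2 + 2 * (h n x)\<^sup>2" for x
      using zero_le_power2[of "g x + h n x"] by (simp add: power2_sum power2_diff)
    then show "AE x in L. norm ((g x - h n x)\<^sup>2) \<le> norm (2 * (g x)\<^sup>2 + 2 * (h n x)\<^sup>2)" by simp
  qed measurable
  define e where "e = (\<lambda>n. \<integral>x. (g x - h n x)\<^sup>2 \<partial>L)"
  have e0: "0 \<le> e n" for n unfolding e_def by (rule Bochner_Integration.integral_nonneg) simp
  have "(\<integral>\<^sup>+x. ennreal ((g x - h n x)\<^sup>2) \<partial>L) = ennreal (e n)" for n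
    unfolding e_def using int by (intro nn_integral_eq_integral) auto
  then have elim: "e \<longlonglongrightarrow> 0" using lim e0 by (simp add: ennreal_tendsto_0_iff)
  define G where "G = (\<integral>x. (g x)\<^sup>2 \<partial>L)"
  \<comment> \<open>the second summand only keeps the weight positive when the distance vanishes\<close>
  define b where "b = (\<lambda>n. sqrt (e n) + 1 / real (Suc n))"
  have b0: "0 < b n" for n using e0[of n] by (simp add: b_def add_nonneg_pos)
  have bound: "norm ((\<integral>x. (h n x)\<^sup>2 \<partial>L) - G) \<le> b n * G + e n + sqrt (e n)" for n
  proof -
    have "norm ((\<integral>x. (h n x)\<^sup>2 \<partial>L) - G) = norm (\<integral>x. (h n x)\<^sup>2 - (g x)\<^sup>2 \<partial>L)"
      unfolding G_def using g h by simp
    also have "\<dots> \<le> (\<integral>x. norm ((h n x)\<^sup>2 - (g x)\<^sup>2) \<partial>L)"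
      by (rule integral_norm_bound)
    also have "\<dots> \<le> (\<integral>x. b n * (g x)\<^sup>2 + (1 + 1 / b n) * (g x - h n x)\<^sup>2 \<partial>L)"
    proof (rule integral_mono)
      fix x
      define u v where "u = g x" and "v = g x - h n x"
      have "\<bar>2 * u * v\<bar> \<le> b n * u\<^sup>2 + v\<^sup>2 / b n"
      proof -
        have "0 \<le> (b n * \<bar>u\<bar> - \<bar>v\<bar>)\<^sup>2 / b n" using b0[of n] by simp
        also have "\<dots> = b n * u\<^sup>2 + v\<^sup>2 / b n - \<bar>2 * u * v\<bar>"
          using b0[of n] by (simp add: power2_diff abs_mult power_mult_distrib field_simps power2_eq_square)
        finally show ?thesis by simp
      qed
      moreover have "(h n x)\<^sup>2 - (g x)\<^sup>2 = v\<^sup>2 - 2 * u * v"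
        by (simp add: u_def v_def power2_eq_square algebra_simps)
      ultimately have "\<bar>(h n x)\<^sup>2 - (g x)\<^sup>2\<bar> \<le> b n * u\<^sup>2 + v\<^sup>2 / b n + v\<^sup>2"
        using zero_le_power2[of v] by linarith
      then show "norm ((h n x)\<^sup>2 - (g x)\<^sup>2) \<le> b n * (g x)\<^sup>2 + (1 + 1 / b n) * (g x - h n x)\<^sup>2"
        by (simp add: u_def v_def algebra_simps)
    qed (use g h int in auto)
    also have "\<dots> = b n * G + (1 + 1 / b n) * e n"
      unfolding G_def e_def using g int by simp
    also have "\<dots> \<le> b n * G + e n + sqrt (e n)"
    proof -
      have "e n = sqrt (e n) * sqrt (e n)" using e0[of n] by simp
      also have "\<dots> \<le> sqrt (e n) * b n" using e0[of n] by (intro mult_left_mono) (auto simp: b_def)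
      finally have "e n / b n \<le> sqrt (e n)" using b0[of n] by (simp add: field_simps)
      then show ?thesis by (simp add: algebra_simps)
    qed
    finally show ?thesis .
  qed
  have "(\<lambda>n. sqrt (e n)) \<longlonglongrightarrow> sqrt 0" by (intro tendsto_real_sqrt elim)
  then have s: "(\<lambda>n. sqrt (e n)) \<longlonglongrightarrow> 0" by simp
  have "b \<longlonglongrightarrow> 0 + 0"
    unfolding b_def by (intro tendsto_add s LIMSEQ_Suc lim_1_over_n)
  then have "(\<lambda>n. b n * G + e n + sqrt (e n)) \<longlonglongrightarrow> 0 * G + 0 + 0"
    by (intro tendsto_intros elim s) simp
  then have "(\<lambda>n. b n * G + e n + sqrt (e n)) \<longlonglongrightarrow> 0" by simp
  then have "(\<lambda>n. (\<integral>x. (h n x)\<^sup>2 \<partial>L) - G) \<longlonglongrightarrow> 0"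
    by (rule Lim_null_comparison[rotated]) (use bound in auto)
  then show ?thesis unfolding G_def by (simp add: LIM_zero_iff)
qed

lemma ennreal_square_tendsto_0:
  assumes "(\<lambda>n. ennreal ((x - y n)\<^sup>2)) \<longlonglongrightarrow> 0"
  shows "y \<longlonglongrightarrow> x"
proof -
  have "(\<lambda>n. (x - y n)\<^sup>2) \<longlonglongrightarrow> 0" using assms by (simp add: ennreal_tendsto_0_iff)
  then have "(\<lambda>n. sqrt ((x - y n)\<^sup>2)) \<longlonglongrightarrow> sqrt 0" by (rule tendsto_real_sqrt)
  then have "(\<lambda>n. \<bar>x - y n\<bar>) \<longlonglongrightarrow> 0" by simp
  then have "(\<lambda>n. x - y n) \<longlonglongrightarrow> 0" by (simp add: tendsto_rabs_zero_iff)
  then have "(\<lambda>n. x - (x - y n)) \<longlonglongrightarrow> x - 0" by (intro tendsto_intros)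
  then show ?thesis by simp
qed

abbreviation time_measure :: "real \<Rightarrow> real measure" where
  "time_measure T \<equiv> restrict_space lborel {0..T}"

lemma time_measure:
  shows "finite_measure (time_measure T)" "space (time_measure T) = {0..T}"
    and "set_integrable lborel {0..T} f \<longleftrightarrow> integrable (time_measure T) (f :: real \<Rightarrow> real)"
    and "(LINT r:{0..T}|lborel. f r) = (\<integral>r. f r \<partial>time_measure T)"
    and "(\<integral>\<^sup>+r\<in>{0..T}. k r \<partial>lborel) = (\<integral>\<^sup>+r. k r \<partial>time_measure T)"
proof -
  show "finite_measure (time_measure T)"
    by (rule finite_measureI) (simp add: emeasure_restrict_space space_restrict_space emeasure_lborel_Icc_eq)
  show "space (time_measure T) = {0..T}" by (simp add: space_restrict_space)
  show "set_integrable lborel {0..T} f \<longleftrightarrow> integrable (time_measure T) (f :: real \<Rightarrow> real)"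
    by (simp add: set_integrable_def integrable_restrict_space)
  show "(LINT r:{0..T}|lborel. f r) = (\<integral>r. f r \<partial>time_measure T)"
    by (simp add: set_lebesgue_integral_def integral_restrict_space)
  show "(\<integral>\<^sup>+r\<in>{0..T}. k r \<partial>lborel) = (\<integral>\<^sup>+r. k r \<partial>time_measure T)"
    by (simp add: nn_integral_restrict_space)
qed

context brownian_space
begin

lemma elementary_process_measurable:
  assumes el: "elementary M T F n \<tau> c"
  shows "(\<lambda>(\<omega>, r). elementary_process n \<tau> c r \<omega>) \<in> borel_measurable (M \<Otimes>\<^sub>M time_measure T)"
proof -
  have [measurable]: "c k \<in> borel_measurable M" if "k < n" for k
    by (rule measurable_F_imp[of _ "\<tau> k"]) (use el that elementary_times(2)[OF el, of k] in \<open>auto simp: elementary_def\<close>)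
  have [measurable]: "(\<lambda>r. indicator {\<tau> k<..\<tau> (Suc k)} r :: real) \<in> borel_measurable (time_measure T)" for k
    by (intro measurable_restrict_space1) measurable
  have "(\<lambda>x. \<Sum>k<n. c k (fst x) * indicator {\<tau> k<..\<tau> (Suc k)} (snd x)) \<in> borel_measurable (M \<Otimes>\<^sub>M time_measure T)"
    by (intro borel_measurable_sum borel_measurable_times measurable_compose[OF measurable_fst] measurable_compose[OF measurable_snd]) auto
  then show ?thesis by (simp add: elementary_process_def case_prod_beta)
qed

lemma elementary_integral_measurable:
  assumes el: "elementary M T F n \<tau> c" and i: "i \<in> I"
  shows "elementary_integral (W i) n \<tau> c T \<in> borel_measurable M"
proof -
  have "c k \<in> borel_measurable M" if "k < n" for k
    by (rule measurable_F_imp[of _ "\<tau> k"]) (use el that elementary_times(2)[OF el, of k] in \<open>auto simp: elementary_def\<close>)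
  moreover have "W i (min (\<tau> k) T) \<in> borel_measurable M" if "k \<le> n" for k
    by (rule brownian_measurable[OF i]) (use elementary_times[OF el that] in auto)
  ultimately have "(\<lambda>\<omega>. elementary_integral (W i) n \<tau> c T \<omega>) \<in> borel_measurable M"
    unfolding elementary_integral_def
    by (intro borel_measurable_sum borel_measurable_times borel_measurable_diff) auto
  then show ?thesis by simp
qed

lemma elementary_process_square_integrable:
  assumes el: "elementary M T F n \<tau> c" and \<omega>: "\<omega> \<in> space M"
  shows "integrable (time_measure T) (\<lambda>r. (elementary_process n \<tau> c r \<omega>)\<^sup>2)"
proof -
  interpret L: finite_measure "time_measure T" by (rule time_measure)
  have m: "(\<lambda>r. elementary_process n \<tau> c r \<omega>) \<in> borel_measurable (time_measure T)"
    using measurable_Pair2[OF elementary_process_measurable[OF el] \<omega>] by simp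
  have "\<bar>elementary_process n \<tau> c r \<omega>\<bar> \<le> (\<Sum>k<n. \<bar>c k \<omega>\<bar>)" for r
    unfolding elementary_process_def
    by (rule order_trans[OF sum_abs]) (auto intro!: sum_mono simp: indicator_def)
  then have "(elementary_process n \<tau> c r \<omega>)\<^sup>2 \<le> (\<Sum>k<n. \<bar>c k \<omega>\<bar>)\<^sup>2" for r
    by (metis abs_ge_zero power2_abs power_mono)
  then show ?thesis
    using m by (intro L.integrable_const_bound[where B="(\<Sum>k<n. \<bar>c k \<omega>\<bar>)\<^sup>2"]) auto
qed

text \<open>
  Along a common subsequence, the elementary approximations of finitely many integrals and of their
  integrands converge almost surely, the latter in \<open>L\<^sup>2\<close> of the time interval.
\<close>

lemma finite_sum_exponential_pair:
  fixes \<gamma> :: "real \<Rightarrow> 'a \<Rightarrow> nat \<Rightarrow> real"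
  assumes A: "A \<subseteq> I" "finite A"
    and K: "\<And>i. i \<in> A \<Longrightarrow> has_ito_integral M T F (W i) (\<lambda>r \<omega>. \<gamma> r \<omega> i) T (K i)"
    and gm: "\<And>i. i \<in> A \<Longrightarrow> (\<lambda>(\<omega>, r). \<gamma> r \<omega> i) \<in> borel_measurable (M \<Otimes>\<^sub>M time_measure T)"
    and int: "AE \<omega> in M. \<forall>i\<in>A. integrable (time_measure T) (\<lambda>r. (\<gamma> r \<omega> i)\<^sup>2)"
  shows "exponential_pair M (\<lambda>\<omega>. - (\<Sum>i\<in>A. K i \<omega>)) (\<lambda>\<omega>. \<Sum>i\<in>A. \<integral>r. (\<gamma> r \<omega> i)\<^sup>2 \<partial>time_measure T)"
proof -
  interpret L: finite_measure "time_measure T" by (rule time_measure)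
  have Km: "K i \<in> borel_measurable M" if "i \<in> A" for i
    using K[OF that] by (simp add: has_ito_integral_def)
  define P where "P = (\<lambda>i n \<tau> c. (\<forall>j::nat. elementary M T F (n j) (\<tau> j) (c j)) \<and>
        (\<lambda>j. \<integral>\<^sup>+ \<omega>. (\<integral>\<^sup>+ r. ennreal ((\<gamma> r \<omega> i - elementary_process (n j) (\<tau> j) (c j) r \<omega>)\<^sup>2) \<partial>time_measure T) \<partial>M) \<longlonglongrightarrow> 0 \<and>
        (\<lambda>j. \<integral>\<^sup>+ \<omega>. ennreal ((K i \<omega> - elementary_integral (W i) (n j) (\<tau> j) (c j) T \<omega>)\<^sup>2) \<partial>M) \<longlonglongrightarrow> 0)"
  have "\<forall>i\<in>A. \<exists>n \<tau> c. P i n \<tau> c"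
    using K unfolding has_ito_integral_def time_measure(5) P_def by blast
  from bchoice[OF this] obtain n where "\<forall>i\<in>A. \<exists>\<tau> c. P i (n i) \<tau> c" ..
  from bchoice[OF this] obtain \<tau> where "\<forall>i\<in>A. \<exists>c. P i (n i) (\<tau> i) c" ..
  from bchoice[OF this] obtain c where *: "\<forall>i\<in>A. P i (n i) (\<tau> i) (c i)" ..
  define p where "p = (\<lambda>i j. elementary_process (n i j) (\<tau> i j) (c i j))"
  define J where "J = (\<lambda>i j. elementary_integral (W i) (n i j) (\<tau> i j) (c i j) T)"
  define D where "D = (\<lambda>i j \<omega>. \<integral>\<^sup>+ r. ennreal ((\<gamma> r \<omega> i - p i j r \<omega>)\<^sup>2) \<partial>time_measure T)"
  define R where "R = (\<lambda>i j \<omega>. ennreal ((K i \<omega> - J i j \<omega>)\<^sup>2))"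
  have el: "elementary M T F (n i j) (\<tau> i j) (c i j)" if "i \<in> A" for i j using * that unfolding P_def by blast
  have Dlim: "(\<lambda>j. \<integral>\<^sup>+ \<omega>. D i j \<omega> \<partial>M) \<longlonglongrightarrow> 0" if "i \<in> A" for i
    using * that unfolding D_def p_def P_def by blast
  have Rlim: "(\<lambda>j. \<integral>\<^sup>+ \<omega>. R i j \<omega> \<partial>M) \<longlonglongrightarrow> 0" if "i \<in> A" for i
    using * that unfolding R_def J_def P_def by blast
  have Jm: "J i j \<in> borel_measurable M" if "i \<in> A" for i j
    unfolding J_def using that A by (intro elementary_integral_measurable el) auto
  have pm: "(\<lambda>(\<omega>, r). p i j r \<omega>) \<in> borel_measurable (M \<Otimes>\<^sub>M time_measure T)" if "i \<in> A" for i j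
    unfolding p_def by (rule elementary_process_measurable[OF el[OF that]])
  have Dm: "D i j \<in> borel_measurable M" if "i \<in> A" for i j
  proof -
    have "(\<lambda>(\<omega>, r). ennreal ((\<gamma> r \<omega> i - p i j r \<omega>)\<^sup>2)) \<in> borel_measurable (M \<Otimes>\<^sub>M time_measure T)"
      using gm[OF that] pm[OF that, of j] unfolding case_prod_beta
      by (intro measurable_compose[OF _ measurable_ennreal] borel_measurable_power borel_measurable_diff)
    then have "(\<lambda>\<omega>. D i j \<omega>) \<in> borel_measurable M"
      unfolding D_def by (rule L.borel_measurable_nn_integral)
    then show ?thesis by simp
  qed
  have Rm: "R i j \<in> borel_measurable M" if "i \<in> A" for i j
    unfolding R_def using Jm[OF that] Km[OF that]
    by (intro measurable_compose[OF _ measurable_ennreal] borel_measurable_power borel_measurable_diff)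
  define f where "f = (\<lambda>j \<omega>. \<Sum>i\<in>A. D i j \<omega> + R i j \<omega>)"
  have fm: "f j \<in> borel_measurable M" for j
    unfolding f_def by (intro borel_measurable_sum borel_measurable_add Dm Rm)
  have "(\<lambda>j. \<integral>\<^sup>+ \<omega>. f j \<omega> \<partial>M) \<longlonglongrightarrow> (\<Sum>i\<in>A. 0 + 0)"
  proof -
    have "(\<integral>\<^sup>+ \<omega>. f j \<omega> \<partial>M) = (\<Sum>i\<in>A. (\<integral>\<^sup>+ \<omega>. D i j \<omega> \<partial>M) + (\<integral>\<^sup>+ \<omega>. R i j \<omega> \<partial>M))" for j
      unfolding f_def using Dm Rm by (simp add: nn_integral_sum nn_integral_add)
    then show ?thesis by (simp only:) (intro tendsto_sum tendsto_add Dlim Rlim)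
  qed
  then have "(\<lambda>j. \<integral>\<^sup>+ \<omega>. f j \<omega> \<partial>M) \<longlonglongrightarrow> 0" by simp
  from nn_integral_tendsto_0_AE_subseq[OF fm this] obtain s :: "nat \<Rightarrow> nat"
    where s: "strict_mono s" "AE \<omega> in M. (\<lambda>j. f (s j) \<omega>) \<longlonglongrightarrow> 0" by blast
  have le: "D i j \<omega> \<le> f j \<omega>" "R i j \<omega> \<le> f j \<omega>" if "i \<in> A" for i j \<omega>
  proof -
    have "D i j \<omega> + R i j \<omega> \<le> f j \<omega>"
      unfolding f_def using that A(2) by (intro member_le_sum) auto
    then show "D i j \<omega> \<le> f j \<omega>" "R i j \<omega> \<le> f j \<omega>"
      by (auto intro: order_trans[rotated] simp: add_increasing add_increasing2)
  qed
  show ?thesis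
  proof (rule exponential_pair_limit[where S="\<lambda>j \<omega>. - (\<Sum>i\<in>A. J i (s j) \<omega>)"
        and Q="\<lambda>j \<omega>. \<Sum>i\<in>A. \<integral>r. (p i (s j) r \<omega>)\<^sup>2 \<partial>time_measure T"])
    show "exponential_pair M (\<lambda>\<omega>. - (\<Sum>i\<in>A. J i (s j) \<omega>)) (\<lambda>\<omega>. \<Sum>i\<in>A. \<integral>r. (p i (s j) r \<omega>)\<^sup>2 \<partial>time_measure T)" for j
      unfolding J_def p_def time_measure(4)[symmetric]
      by (rule elementary_exponential_pair[OF A el])
    show "AE \<omega> in M. (\<lambda>j. - (\<Sum>i\<in>A. J i (s j) \<omega>)) \<longlonglongrightarrow> - (\<Sum>i\<in>A. K i \<omega>)"
      using s(2)
    proof eventually_elim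
      case (elim \<omega>)
      show ?case
      proof (intro tendsto_minus tendsto_sum)
        fix i assume i: "i \<in> A"
        have "(\<lambda>j. R i (s j) \<omega>) \<longlonglongrightarrow> 0"
          by (rule tendsto_sandwich[OF _ _ tendsto_const elim]) (use le i in auto)
        then show "(\<lambda>j. J i (s j) \<omega>) \<longlonglongrightarrow> K i \<omega>"
          unfolding R_def by (rule ennreal_square_tendsto_0)
      qed
    qed
    show "AE \<omega> in M. (\<lambda>j. \<Sum>i\<in>A. \<integral>r. (p i (s j) r \<omega>)\<^sup>2 \<partial>time_measure T) \<longlonglongrightarrow>
        (\<Sum>i\<in>A. \<integral>r. (\<gamma> r \<omega> i)\<^sup>2 \<partial>time_measure T)"
      using s(2) int AE_space
    proof eventually_elim
      case (elim \<omega>)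
      show ?case
      proof (rule tendsto_sum)
        fix i assume i: "i \<in> A"
        have "(\<lambda>j. D i (s j) \<omega>) \<longlonglongrightarrow> 0"
          by (rule tendsto_sandwich[OF _ _ tendsto_const elim(1)]) (use le i in auto)
        then show "(\<lambda>j. \<integral>r. (p i (s j) r \<omega>)\<^sup>2 \<partial>time_measure T) \<longlonglongrightarrow> (\<integral>r. (\<gamma> r \<omega> i)\<^sup>2 \<partial>time_measure T)"
          unfolding D_def
        proof (rule tendsto_integral_square[rotated -1])
          show "(\<lambda>r. \<gamma> r \<omega> i) \<in> borel_measurable (time_measure T)"
            using measurable_Pair2[OF gm[OF i] elim(3)] by simp
          show "(\<lambda>r. p i (s j) r \<omega>) \<in> borel_measurable (time_measure T)" for j
            using measurable_Pair2[OF pm[OF i] elim(3)] by simp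
          show "integrable (time_measure T) (\<lambda>r. (\<gamma> r \<omega> i)\<^sup>2)" using elim(2) i by blast
          show "integrable (time_measure T) (\<lambda>r. (p i (s j) r \<omega>)\<^sup>2)" for j
            unfolding p_def by (rule elementary_process_square_integrable[OF el[OF i] elim(3)])
        qed
      qed
    qed
    show "(\<lambda>\<omega>. - (\<Sum>i\<in>A. K i \<omega>)) \<in> borel_measurable M"
      by (intro borel_measurable_uminus borel_measurable_sum Km)
    show "(\<lambda>\<omega>. \<Sum>i\<in>A. \<integral>r. (\<gamma> r \<omega> i)\<^sup>2 \<partial>time_measure T) \<in> borel_measurable M"
      using gm unfolding case_prod_beta
      by (intro borel_measurable_sum L.borel_measurable_lebesgue_integral) (auto simp: case_prod_beta)
  qed
qed

end

section \<open>The density of a market price of risk\<close>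

lemma abs_coordinate_le_l2_norm:
  assumes "z \<in> l2_space I" "i \<in> I"
  shows "\<bar>z i\<bar> \<le> l2_norm I z"
proof -
  have "(\<Sum>j\<in>{i}. (z j)\<^sup>2) \<le> (\<Sum>\<^sub>\<infinity>j\<in>I. (z j)\<^sup>2)"
    using assms by (intro finite_sum_le_infsum) (auto simp: l2_space_def)
  then have "sqrt ((z i)\<^sup>2) \<le> l2_norm I z"
    unfolding l2_norm_def by (intro real_sqrt_le_mono) simp
  then show ?thesis by simp
qed

lemma l2_space_diff:
  assumes "f \<in> l2_space I" "g \<in> l2_space I"
  shows "(\<lambda>i. g i - f i) \<in> l2_space I"
proof -
  have "(\<lambda>i. 2 * (g i)\<^sup>2 + 2 * (f i)\<^sup>2) summable_on I"
    using assms by (intro summable_on_add summable_on_cmult_right) (auto simp: l2_space_def)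
  moreover have "(g i - f i)\<^sup>2 \<le> 2 * (g i)\<^sup>2 + 2 * (f i)\<^sup>2" for i
    using zero_le_power2[of "g i + f i"] zero_le_power2[of "g i - f i"]
    unfolding power2_sum power2_diff by linarith
  ultimately show ?thesis
    unfolding l2_space_def mem_Collect_eq by (rule summable_on_comparison_test) simp_all
qed

text \<open>
  Coordinates are continuous for the norm of \<open>\<ell>\<^sup>2\<close>, and preimages of open sets generate.
\<close>

lemma measurable_l2_coordinate:
  assumes "i \<in> I"
  shows "(\<lambda>z. z i) \<in> borel_measurable (norm_borel (l2_space I) (l2_norm I))"
proof -
  let ?S = "l2_space I" and ?N = "l2_norm I"
  let ?G = "{U. U \<subseteq> ?S \<and> (\<forall>f\<in>U. \<exists>e>0. \<forall>g\<in>?S. ?N (\<lambda>x. g x - f x) < e \<longrightarrow> g \<in> U)}"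
  have sp: "space (norm_borel ?S ?N) = ?S"
    unfolding norm_borel_def by (rule space_measure_of) auto
  have sets: "sets (norm_borel ?S ?N) = sigma_sets ?S ?G"
    unfolding norm_borel_def by (rule sets_measure_of) auto
  show ?thesis
  proof (rule borel_measurableI)
    fix B :: "real set" assume B: "open B"
    have "(\<lambda>z. z i) -` B \<inter> ?S \<in> ?G"
    proof (intro CollectI conjI ballI)
      fix f assume f: "f \<in> (\<lambda>z. z i) -` B \<inter> ?S"
      then obtain e where e: "0 < e" "ball (f i) e \<subseteq> B" using B by (auto simp: open_contains_ball)
      have "g \<in> (\<lambda>z. z i) -` B \<inter> ?S" if "g \<in> ?S" "?N (\<lambda>x. g x - f x) < e" for g
      proof -
        have "\<bar>g i - f i\<bar> < e"
          using abs_coordinate_le_l2_norm[OF l2_space_diff[of f I g] assms] f that by auto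
        then show ?thesis using e that by (auto simp: dist_real_def abs_minus_commute)
      qed
      then show "\<exists>e>0. \<forall>g\<in>?S. ?N (\<lambda>x. g x - f x) < e \<longrightarrow> g \<in> (\<lambda>z. z i) -` B \<inter> ?S"
        using e(1) by blast
    qed auto
    then show "(\<lambda>z. z i) -` B \<inter> space (norm_borel ?S ?N) \<in> sets (norm_borel ?S ?N)"
      unfolding sp sets by (rule sigma_sets.Basic)
  qed
qed

lemma space_norm_borel: "space (norm_borel S N) = S"
  unfolding norm_borel_def by (rule space_measure_of) auto

context brownian_space
begin

text \<open>
  A second passage to the limit, from finitely many driving Brownian motions to all of them: the
  stochastic integrals converge almost surely along a subsequence, and the quadratic variations by
  dominated convergence in time, with the squared norm of \<open>\<gamma>\<close> as the bound.
\<close>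

lemma market_price_of_risk_exponential_pair:
  assumes mpr: "market_price_of_risk M T I W s m \<sigma> \<gamma>"
    and J: "has_ito_integral_sum M T F I W \<gamma> T J"
  defines "Q \<equiv> \<lambda>\<omega>. LINT r:{0..T}|lborel. (l2_norm I (\<gamma> r \<omega>))\<^sup>2"
  shows "exponential_pair M (\<lambda>\<omega>. - J \<omega>) Q"
proof -
  interpret L: finite_measure "time_measure T" by (rule time_measure)
  let ?N = "norm_borel (l2_space I) (l2_norm I)"
  have "(\<lambda>(r, \<omega>). \<gamma> r \<omega>) \<in> measurable (restrict_space borel {0..T} \<Otimes>\<^sub>M F T) ?N"
    using mpr brownian_settingD(1) unfolding market_price_of_risk_def progressively_measurable_def by auto
  also have "measurable (restrict_space borel {0..T} \<Otimes>\<^sub>M F T) ?N = measurable (time_measure T \<Otimes>\<^sub>M M) ?N"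
    by (intro measurable_cong_sets sets_pair_measure_cong refl sets_restrict_space_cong)
      (simp_all add: brownian_settingD(4))
  finally have \<gamma>m: "(\<lambda>(r, \<omega>). \<gamma> r \<omega>) \<in> measurable (time_measure T \<Otimes>\<^sub>M M) ?N" .
  have \<gamma>l2: "\<gamma> r \<omega> \<in> l2_space I" if "r \<in> {0..T}" "\<omega> \<in> space M" for r \<omega>
    using measurable_space[OF \<gamma>m, of "(r, \<omega>)"] that
    by (simp add: space_norm_borel space_pair_measure space_restrict_space)
  have gm: "(\<lambda>(\<omega>, r). \<gamma> r \<omega> i) \<in> borel_measurable (M \<Otimes>\<^sub>M time_measure T)" if "i \<in> I" for i
  proof -
    have "(\<lambda>x. (\<lambda>(r, \<omega>). \<gamma> r \<omega>) x i) \<in> borel_measurable (time_measure T \<Otimes>\<^sub>M M)"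
      by (rule measurable_compose[OF \<gamma>m measurable_l2_coordinate[OF that]])
    then have "(\<lambda>x. (\<lambda>(r, \<omega>). \<gamma> r \<omega>) (case x of (\<omega>, r) \<Rightarrow> (r, \<omega>)) i) \<in> borel_measurable (M \<Otimes>\<^sub>M time_measure T)"
      by (rule measurable_compose[OF measurable_pair_swap'])
    then show ?thesis by (simp add: case_prod_beta)
  qed
  have intN: "AE \<omega> in M. integrable (time_measure T) (\<lambda>r. (l2_norm I (\<gamma> r \<omega>))\<^sup>2)"
    using mpr unfolding market_price_of_risk_def time_measure(3)[symmetric] by simp
  have int: "AE \<omega> in M. \<forall>i\<in>I. integrable (time_measure T) (\<lambda>r. (\<gamma> r \<omega> i)\<^sup>2)"
    using intN AE_space
  proof eventually_elim
    case (elim \<omega>)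
    show ?case
    proof
      fix i assume i: "i \<in> I"
      have [measurable]: "(\<lambda>r. \<gamma> r \<omega> i) \<in> borel_measurable (time_measure T)"
        using measurable_Pair2[OF gm[OF i] elim(2)] by simp
      show "integrable (time_measure T) (\<lambda>r. (\<gamma> r \<omega> i)\<^sup>2)"
      proof (rule Bochner_Integration.integrable_bound[OF elim(1)])
        show "AE r in time_measure T. norm ((\<gamma> r \<omega> i)\<^sup>2) \<le> norm ((l2_norm I (\<gamma> r \<omega>))\<^sup>2)"
        proof (rule AE_I2)
          fix r assume "r \<in> space (time_measure T)"
          then have "\<bar>\<gamma> r \<omega> i\<bar> \<le> l2_norm I (\<gamma> r \<omega>)"
            using elim(2) by (intro abs_coordinate_le_l2_norm \<gamma>l2 i) (auto simp: time_measure(2))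
          then have "(\<gamma> r \<omega> i)\<^sup>2 \<le> (l2_norm I (\<gamma> r \<omega>))\<^sup>2"
            by (metis abs_ge_zero power2_abs power_mono)
          then show "norm ((\<gamma> r \<omega> i)\<^sup>2) \<le> norm ((l2_norm I (\<gamma> r \<omega>))\<^sup>2)" by simp
        qed
      qed measurable
    qed
  qed
  define A where "A = (\<lambda>n. I \<inter> {..<n})"
  have A: "A n \<subseteq> I" "finite (A n)" for n by (auto simp: A_def)
  have Alim: "filterlim A (finite_subsets_at_top I) sequentially"
    unfolding filterlim_finite_subsets_at_top
  proof (intro allI impI)
    fix X assume X: "finite X \<and> X \<subseteq> I"
    then obtain n0 where "X \<subseteq> {..<n0}" using finite_nat_iff_bounded by blast
    then show "\<forall>\<^sub>F n in sequentially. finite (A n) \<and> X \<subseteq> A n \<and> A n \<subseteq> I"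
      using X by (intro eventually_sequentiallyI[of n0]) (auto simp: A_def)
  qed
  obtain K where K: "\<And>i. i \<in> I \<Longrightarrow> has_ito_integral M T F (W i) (\<lambda>r \<omega>. \<gamma> r \<omega> i) T (K i)"
    and Jlim: "((\<lambda>A. \<integral>\<^sup>+ \<omega>. ennreal ((J \<omega> - (\<Sum>i\<in>A. K i \<omega>))\<^sup>2) \<partial>M) \<longlongrightarrow> 0) (finite_subsets_at_top I)"
    using J unfolding has_ito_integral_sum_def by blast
  have Jm: "J \<in> borel_measurable M" using J by (simp add: has_ito_integral_sum_def)
  have Km: "K i \<in> borel_measurable M" if "i \<in> I" for i
    using K[OF that] by (simp add: has_ito_integral_def)
  have Sm: "(\<lambda>\<omega>. \<Sum>i\<in>A n. K i \<omega>) \<in> borel_measurable M" for n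
    using A by (intro borel_measurable_sum Km) auto
  have "(\<lambda>n. \<integral>\<^sup>+ \<omega>. ennreal ((J \<omega> - (\<Sum>i\<in>A n. K i \<omega>))\<^sup>2) \<partial>M) \<longlonglongrightarrow> 0"
    by (rule filterlim_compose[OF Jlim Alim])
  moreover have "(\<lambda>\<omega>. ennreal ((J \<omega> - (\<Sum>i\<in>A n. K i \<omega>))\<^sup>2)) \<in> borel_measurable M" for n
    by (intro measurable_compose[OF _ measurable_ennreal] borel_measurable_power borel_measurable_diff Jm Sm)
  ultimately obtain q :: "nat \<Rightarrow> nat"
    where q: "strict_mono q" "AE \<omega> in M. (\<lambda>n. ennreal ((J \<omega> - (\<Sum>i\<in>A (q n). K i \<omega>))\<^sup>2)) \<longlonglongrightarrow> 0"
    using nn_integral_tendsto_0_AE_subseq[of "\<lambda>n \<omega>. ennreal ((J \<omega> - (\<Sum>i\<in>A n. K i \<omega>))\<^sup>2)" M] by blast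
  \<comment> \<open>measurability of Q is read off from its exponential moment\<close>
  have ex: "integrable M (\<lambda>\<omega>. exp (1 * Q \<omega>))"
    using mpr[unfolded market_price_of_risk_def, THEN conjunct2, THEN conjunct2, THEN conjunct2]
    unfolding Q_def by (elim allE[of _ 1]) simp
  have Qm: "Q \<in> borel_measurable M"
  proof -
    have "(\<lambda>\<omega>. exp (1 * Q \<omega>)) \<in> borel_measurable M" using ex by auto
    then have "(\<lambda>\<omega>. ln (exp (1 * Q \<omega>))) \<in> borel_measurable M" by (rule borel_measurable_ln)
    then show ?thesis by simp
  qed
  show ?thesis
  proof (rule exponential_pair_limit[where S="\<lambda>n \<omega>. - (\<Sum>i\<in>A (q n). K i \<omega>)"
        and Q="\<lambda>n \<omega>. \<Sum>i\<in>A (q n). \<integral>r. (\<gamma> r \<omega> i)\<^sup>2 \<partial>time_measure T"])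
    show "exponential_pair M (\<lambda>\<omega>. - (\<Sum>i\<in>A (q n). K i \<omega>)) (\<lambda>\<omega>. \<Sum>i\<in>A (q n). \<integral>r. (\<gamma> r \<omega> i)\<^sup>2 \<partial>time_measure T)" for n
    proof (rule finite_sum_exponential_pair[OF A])
      show "AE \<omega> in M. \<forall>i\<in>A (q n). integrable (time_measure T) (\<lambda>r. (\<gamma> r \<omega> i)\<^sup>2)"
        using int by eventually_elim (use A in auto)
    qed (use A K gm in \<open>auto simp: subset_iff\<close>)
    show "AE \<omega> in M. (\<lambda>n. - (\<Sum>i\<in>A (q n). K i \<omega>)) \<longlonglongrightarrow> - J \<omega>"
      using q(2) by eventually_elim (intro tendsto_minus ennreal_square_tendsto_0)
    show "AE \<omega> in M. (\<lambda>n. \<Sum>i\<in>A (q n). \<integral>r. (\<gamma> r \<omega> i)\<^sup>2 \<partial>time_measure T) \<longlonglongrightarrow> Q \<omega>"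
      using intN int AE_space
    proof eventually_elim
      case (elim \<omega>)
      have m: "(\<lambda>r. \<gamma> r \<omega> i) \<in> borel_measurable (time_measure T)" if "i \<in> I" for i
        using measurable_Pair2[OF gm[OF that] elim(3)] by simp
      have le: "(\<Sum>i\<in>A n. (\<gamma> r \<omega> i)\<^sup>2) \<le> (l2_norm I (\<gamma> r \<omega>))\<^sup>2"
        and lim: "(\<lambda>n. \<Sum>i\<in>A n. (\<gamma> r \<omega> i)\<^sup>2) \<longlonglongrightarrow> (l2_norm I (\<gamma> r \<omega>))\<^sup>2"
        if "r \<in> space (time_measure T)" for r n
      proof -
        have sum: "(\<lambda>i. (\<gamma> r \<omega> i)\<^sup>2) summable_on I"
          using \<gamma>l2[of r \<omega>] that elim(3) by (auto simp: l2_space_def time_measure(2))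
        have norm: "(l2_norm I (\<gamma> r \<omega>))\<^sup>2 = (\<Sum>\<^sub>\<infinity>i\<in>I. (\<gamma> r \<omega> i)\<^sup>2)"
          unfolding l2_norm_def by (simp add: infsum_nonneg)
        show "(\<Sum>i\<in>A n. (\<gamma> r \<omega> i)\<^sup>2) \<le> (l2_norm I (\<gamma> r \<omega>))\<^sup>2"
          unfolding norm by (rule finite_sum_le_infsum[OF sum]) (use A in auto)
        have "((\<lambda>A. \<Sum>i\<in>A. (\<gamma> r \<omega> i)\<^sup>2) \<longlongrightarrow> (\<Sum>\<^sub>\<infinity>i\<in>I. (\<gamma> r \<omega> i)\<^sup>2)) (finite_subsets_at_top I)"
          using has_sum_infsum[OF sum] by (simp add: has_sum_def)
        from filterlim_compose[OF this Alim]
        show "(\<lambda>n. \<Sum>i\<in>A n. (\<gamma> r \<omega> i)\<^sup>2) \<longlonglongrightarrow> (l2_norm I (\<gamma> r \<omega>))\<^sup>2" unfolding norm .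
      qed
      have "(\<lambda>n. \<integral>r. (\<Sum>i\<in>A n. (\<gamma> r \<omega> i)\<^sup>2) \<partial>time_measure T) \<longlonglongrightarrow> (\<integral>r. (l2_norm I (\<gamma> r \<omega>))\<^sup>2 \<partial>time_measure T)"
      proof (rule integral_dominated_convergence[where w="\<lambda>r. (l2_norm I (\<gamma> r \<omega>))\<^sup>2"])
        show "(\<lambda>r. \<Sum>i\<in>A n. (\<gamma> r \<omega> i)\<^sup>2) \<in> borel_measurable (time_measure T)" for n
          using A by (intro borel_measurable_sum borel_measurable_power m) auto
        show "AE r in time_measure T. (\<lambda>n. \<Sum>i\<in>A n. (\<gamma> r \<omega> i)\<^sup>2) \<longlonglongrightarrow> (l2_norm I (\<gamma> r \<omega>))\<^sup>2"
          by (rule AE_I2[OF lim])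
        show "AE r in time_measure T. norm (\<Sum>i\<in>A n. (\<gamma> r \<omega> i)\<^sup>2) \<le> (l2_norm I (\<gamma> r \<omega>))\<^sup>2" for n
          by (rule AE_I2) (use le in \<open>simp add: sum_nonneg\<close>)
      qed (use elim(1) in auto)
      then have "(\<lambda>n. \<Sum>i\<in>A n. \<integral>r. (\<gamma> r \<omega> i)\<^sup>2 \<partial>time_measure T) \<longlonglongrightarrow> Q \<omega>"
        unfolding Q_def time_measure(4)
        by (subst (asm) Bochner_Integration.integral_sum) (use A elim(2) in auto)
      from LIMSEQ_subseq_LIMSEQ[OF this q(1)] show ?case by (simp add: comp_def)
    qed
    show "(\<lambda>\<omega>. - J \<omega>) \<in> borel_measurable M" using Jm by (rule borel_measurable_uminus)
  qed (rule Qm)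
qed

lemma density_properties:
  assumes mpr: "market_price_of_risk M T I W s m \<sigma> \<gamma>"
    and dens: "density_process M T I W \<gamma> \<xi>"
  shows "\<xi> T \<in> borel_measurable M" and "\<And>\<omega>. \<omega> \<in> space M \<Longrightarrow> 0 < \<xi> T \<omega>"
    and "integrable M (\<lambda>\<omega>. \<xi> T \<omega> powr p)" and "expectation (\<xi> T) = 1"
proof -
  define Q where "Q = (\<lambda>\<omega>. LINT r:{0..T}|lborel. (l2_norm I (\<gamma> r \<omega>))\<^sup>2)"
  obtain J where J: "has_ito_integral_sum M T F I W \<gamma> T J"
    and \<xi>: "\<And>\<omega>. \<omega> \<in> space M \<Longrightarrow> \<xi> T \<omega> = exp (- (1/2) * Q \<omega> - J \<omega>)"
    using dens brownian_settingD(1) unfolding density_process_def Q_def by (meson atLeastAtMost_iff less_imp_le order_refl)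
  have \<xi>': "\<xi> T \<omega> = exp (- J \<omega> - Q \<omega> / 2)" if "\<omega> \<in> space M" for \<omega>
    using \<xi>[OF that] by (simp add: algebra_simps)
  have pair: "exponential_pair M (\<lambda>\<omega>. - J \<omega>) Q"
    unfolding Q_def by (rule market_price_of_risk_exponential_pair[OF mpr J])
  then have [measurable]: "(\<lambda>\<omega>. - J \<omega>) \<in> borel_measurable M" "Q \<in> borel_measurable M"
    by (auto simp: exponential_pair_def)
  have Q0: "0 \<le> Q \<omega>" for \<omega>
    unfolding Q_def set_lebesgue_integral_def by (rule Bochner_Integration.integral_nonneg) simp
  have ex: "integrable M (\<lambda>\<omega>. exp (b * Q \<omega>))" if "0 \<le> b" for b
    using mpr[unfolded market_price_of_risk_def, THEN conjunct2, THEN conjunct2, THEN conjunct2] that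
    unfolding Q_def by simp
  show "0 < \<xi> T \<omega>" if "\<omega> \<in> space M" for \<omega> using \<xi>[OF that] by simp
  show "\<xi> T \<in> borel_measurable M"
    by (subst measurable_cong[OF \<xi>']) measurable
  have "integrable M (\<lambda>\<omega>. \<xi> T \<omega> powr p) \<longleftrightarrow> integrable M (\<lambda>\<omega>. exp (p * (- J \<omega> - Q \<omega> / 2)))"
    by (rule Bochner_Integration.integrable_cong) (simp_all add: \<xi>' powr_def)
  then show "integrable M (\<lambda>\<omega>. \<xi> T \<omega> powr p)"
    using exponential_pair_moment[OF pair Q0 ex] by simp
  have "expectation (\<xi> T) = expectation (\<lambda>\<omega>. exp (- J \<omega> - Q \<omega> / 2))"
    by (rule Bochner_Integration.integral_cong) (simp_all add: \<xi>')
  then show "expectation (\<xi> T) = 1"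
    using exponential_pair_expectation[OF pair Q0 ex] by simp
qed

end

section \<open>Optimality\<close>

theorem proposition43:
  fixes M :: "'a measure" and T s v :: real and I :: "nat set"
    and W :: "nat \<Rightarrow> real \<Rightarrow> 'a \<Rightarrow> real"
    and m :: "real \<Rightarrow> 'a \<Rightarrow> real \<Rightarrow> real" and \<sigma> :: "nat \<Rightarrow> real \<Rightarrow> 'a \<Rightarrow> real \<Rightarrow> real"
    and \<gamma> :: "real \<Rightarrow> 'a \<Rightarrow> nat \<Rightarrow> real" and \<xi> :: "real \<Rightarrow> 'a \<Rightarrow> real"
    and U :: "real \<Rightarrow> ereal" and a :: ereal
  assumes "brownian_setting M T I W"
    and "1/2 < s"
    and "bond_market M T I W s m \<sigma>"
    and "market_price_of_risk M T I W s m \<sigma> \<gamma>"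
    and "density_process M T I W \<gamma> \<xi>"
    and "admissible_utility U a"
    and "v \<in> utility_domain a"
  shows "(\<exists>!lam. lam \<in> marginal_range U a \<and>
            has_bochner_integral M (\<lambda>\<omega>. inverse_marginal U a (lam * \<xi> T \<omega>) * \<xi> T \<omega>) v) \<and>
         (\<forall>lam X. lam \<in> marginal_range U a \<and>
            has_bochner_integral M (\<lambda>\<omega>. inverse_marginal U a (lam * \<xi> T \<omega>) * \<xi> T \<omega>) v \<and>
            X = (\<lambda>\<omega>. inverse_marginal U a (lam * \<xi> T \<omega>)) \<longrightarrow>
            is_utility_maximizer M U (\<xi> T) v X \<and>
            (\<forall>Y. is_utility_maximizer M U (\<xi> T) v Y \<longrightarrow> (AE \<omega> in M. Y \<omega> = X \<omega>)))"
proof -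
  interpret brownian_space M T I W by standard (rule assms)
  note \<xi> = density_properties[OF assms(4,5)]
  note hyps = prob_space_axioms assms(6) \<xi>(1,2,3)
  show ?thesis
    using ex1_multiplier[OF hyps \<xi>(4) assms(7)] optimal_payoff[OF hyps assms(7)] by blast
qed

end
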